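(* Let $r\ge2$ and let $\zeta_r(s,\ldots,s)$ denote the Euler–Zagier multiple zeta-function on the diagonal (meromorphically continued). Then for any $1/2<\sigma_1<\sigma_2<1$, the function $s\mapsto\zeta_r(s,\ldots,s)$ has $\asymp T$ zeros in the rectangle $\sigma_1<\sigma<\sigma_2$, $0<t<T$; that is, there are constants $0<C_1<C_2$ such that for all sufficiently large $T$ the number $N(T)$ of zeros (with multiplicity) in this rectangle satisfies $C_1T\le N(T)\le C_2T$.
   Context: The Euler–Zagier multiple zeta-function is $\zeta_r(s_1,\ldots,s_r)=\sum_{n_1>n_2>\cdots>n_r>0}n_1^{-s_1}\cdots n_r^{-s_r}$, absolutely convergent for $\Re(s_1)>1$, $\Re(s_j)\ge1$ ($2\le j\le r$), and continued meromorphically to $\mathbb{C}^r$ (with possible poles only at $s_1=1$ and $s_1+\cdots+s_k=k-n$, $1\le k\le r$, $n\in\mathbb{Z}_{\ge0}$). In particular $\zeta_r(s,\ldots,s)$ is meromorphic in $s\in\mathbb{C}$. *)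

theory Defs
  imports "HOL-Complex_Analysis.Complex_Analysis"
begin

text \<open>The Euler--Zagier series at the argument tuple \<open>ss = [s\<^sub>1, ..., s\<^sub>r]\<close>; the summation
  index is the tuple \<open>ns = [n\<^sub>1, ..., n\<^sub>r]\<close> with \<open>n\<^sub>1 > ... > n\<^sub>r > 0\<close>.\<close>

definition euler_zagier_series :: "complex list \<Rightarrow> complex" where
  "euler_zagier_series ss =
     (\<Sum>\<^sub>\<infinity>ns\<in>{ns :: nat list. length ns = length ss \<and> sorted_wrt (>) ns \<and> (\<forall>n\<in>set ns. n > 0)}.
        \<Prod>i<length ss. of_nat (ns ! i) powr (- (ss ! i)))"

text \<open>The meromorphic continuation to the whole plane of the series on the diagonal
  \<open>s\<^sub>1 = ... = s\<^sub>r = s\<close>. The condition \<^const>\<open>nicely_meromorphic_on\<close> fills in removable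
  singularities and fixes the value 0 at poles, so that, by the identity theorem, the
  described function is unique.\<close>

definition euler_zagier_diag :: "nat \<Rightarrow> complex \<Rightarrow> complex" where
  "euler_zagier_diag r =
     (THE f. f nicely_meromorphic_on UNIV \<and>
             (\<forall>s. Re s > 1 \<longrightarrow> f s = euler_zagier_series (replicate r s)))"

text \<open>Number of zeros of a meromorphic function in a set, with multiplicity. Testing
  \<^const>\<open>isolated_zero\<close> rather than \<open>f z = 0\<close> excludes poles, where \<open>f\<close> may be 0 by
  convention.\<close>

definition zero_count :: "(complex \<Rightarrow> complex) \<Rightarrow> complex set \<Rightarrow> int" where
  "zero_count f A = (\<Sum>z\<in>{z\<in>A. isolated_zero f z}. zorder f z)"

end

theory Submission
  imports Defs "HOL-Real_Asymp.Real_Asymp" "HOL-Computational_Algebra.Fundamental_Theorem_Algebra"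
begin

text \<open>
  By Newton's identities \<open>F(s) = \<zeta>\<^sub>r(s,...,s)\<close> is a polynomial in \<open>\<zeta>(s), \<zeta>(2s), ..., \<zeta>(rs)\<close>, where in
  \<open>Re s > 1/2\<close> only \<open>\<zeta>(s)\<close> is not given by an absolutely convergent series. The function \<open>\<zeta>\<close> is handled
  through the entire function \<open>\<eta>(s) = (1 - 2\<^sup>1\<^sup>-\<^sup>s) \<zeta>(s)\<close>, which has no pole to avoid; Euler's series transformation
  shows that \<open>\<eta>(\<sigma> + it)\<close> is approximated by its partial sums of length \<open>T\<^sup>\<beta>\<close>, for any \<open>\<beta> > 1\<close>, and hence
  has bounded mean square for \<open>\<sigma> > 1/2\<close>.

  Upper bound: Jensen's inequality in discs centred far to the right, where \<open>F\<close> is bounded away from 0 by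
  its leading term \<open>(r!)\<^sup>-\<^sup>s\<close>; the logarithm of \<open>F\<close> on the circle is bounded by a local mean square of \<open>\<eta>\<close>.

  Lower bound: for suitable unimodular \<open>\<xi>(p)\<close>, \<open>p \<le> N\<close>, replacing every prime power \<open>p\<^sup>-\<^sup>k\<^sup>s\<close> in the truncated Euler
  products by \<open>\<xi>(p)\<^sup>k p\<^sup>-\<^sup>k\<^sup>s\<close> turns \<open>F\<close> into a function with a zero in a small disc. To find \<open>\<xi>\<close>, take
  alternating signs on the small primes, so that all products converge, and a constant direction on a block of
  primes just above some \<open>M\<close>; on the scale \<open>s = \<sigma> + w / ln M\<close> the block multiplies \<open>\<zeta>(s)\<close> by \<open>exp (v e\<^sup>-\<^sup>w)\<close>,
  and \<open>v\<close> is chosen so that the limit vanishes at \<open>w = 0\<close>. The actual \<open>F(s + it)\<close> has a zero near \<open>\<sigma> + it\<close>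
  whenever \<open>p\<^sup>-\<^sup>i\<^sup>t\<close> is close to \<open>\<xi>(p)\<close> for all \<open>p \<le> N\<close> and \<open>\<zeta>(s + it)\<close> is close to its Euler product over
  \<open>p \<le> N\<close>. That this happens for a positive proportion of \<open>t\<close> follows from mean values with the weight
  \<open>|D(t)|\<^sup>2\<close>, where \<open>D(t) = \<Sum> cnj (\<xi>(n)) n\<^sup>-\<^sup>i\<^sup>t\<close> over the divisors \<open>n\<close> of a high power of \<open>\<Prod> p\<close>: it concentrates on
  the wanted \<open>t\<close>, and being a Dirichlet polynomial it needs no equidistribution theorem.
\<close>

section \<open>Analytic continuation of the alternating zeta function\<close>

text \<open>The hypothesis r \<ge> 2 enters through one algebraic fact: as a polynomial in
  \<zeta>(s), with the other values \<zeta>(ks) held fixed, F has a root other than 0. Euler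
  products reach only non-zero values, and for r = 1 the polynomial has no such root. On a fixed
  disc one would have to approximate a whole function by twisted products; on a disc shrinking like
  1 / ln M everything except one exponential is frozen, so that only the number v has to be matched.
  Once M and the phases are fixed, the radius is fixed too, and it suffices that finitely many phase
  conditions and one tail condition hold often enough. The obstacle is the tail of \<zeta>(s + it)
  beyond the primes up to N: the weight |D|^2 could amplify it. It does not, since D involves only
  integers composed of primes up to N and the tail only integers free of them. Their products factor
  uniquely, so the weighted mean square of the tail is bounded by a multiple of the number of terms
  of D, which is also the mean of |D|^2. The multiple is small for large N whatever D is, hence N
  can be chosen before D.\<close>

primrec fdiff :: "nat \<Rightarrow> complex \<Rightarrow> real \<Rightarrow> complex" where
  "fdiff 0 s x = of_real x powr (- s)"
| "fdiff (Suc k) s x = fdiff k s x - fdiff k s (x + 1)"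

text \<open>Differentiation commutes with the operator (1 - E)^k, where E is the shift by 1, and
  sends x^(-s) to -s x^(-s-1). So the order k is kept while s moves to s + 1.\<close>

lemma fdiff_has_vector_derivative:
  assumes "x > 0"
  shows "((\<lambda>x. fdiff k s x) has_vector_derivative (- s * fdiff k (s + 1) x)) (at x within A)"
  using assms
proof (induction k arbitrary: x A)
  case 0
  have "((\<lambda>z. z powr (-s)) has_field_derivative (-s) * of_real x powr (-s - 1)) (at (complex_of_real x))"
    using 0 by (intro has_field_derivative_powr) auto
  moreover have "(complex_of_real has_vector_derivative 1) (at x)"
    using has_vector_derivative_of_real[of "\<lambda>x. x" 1 "at x"] by (simp add: has_real_derivative_iff_has_vector_derivative [symmetric])
  ultimately have "((\<lambda>x. of_real x powr (-s)) has_vector_derivative (-s) * of_real x powr (-s - 1)) (at x)"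
    using field_vector_diff_chain_at[of complex_of_real 1 x "\<lambda>z. z powr (-s)"]
    by (simp add: o_def)
  moreover have "-s - 1 = -(s + 1)" by simp
  ultimately show ?case
    by (metis fdiff.simps(1) has_vector_derivative_at_within has_vector_derivative_transform_within_open
       open_UNIV UNIV_I)
next
  case (Suc k)
  have "((\<lambda>x. fdiff k s (x + 1)) has_vector_derivative (- s * fdiff k (s + 1) (x + 1))) (at x within A)"
  proof -
    have "((\<lambda>x. fdiff k s x) has_vector_derivative (- s * fdiff k (s + 1) (x + 1))) (at (x + 1))"
      using Suc.IH[of "x+1" UNIV] Suc.prems by simp
    moreover have "((\<lambda>x. x + 1) has_vector_derivative (1::real)) (at x within A)"
      by (auto intro!: derivative_eq_intros)
    ultimately show ?thesis
      using vector_diff_chain_within[of "\<lambda>x. x + 1" 1 x A "\<lambda>x. fdiff k s x"]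
      by (auto simp: o_def intro: has_vector_derivative_at_within)
  qed
  from has_vector_derivative_diff[OF Suc.IH[OF Suc.prems] this] show ?case
    by (simp add: algebra_simps)
qed

text \<open>Each difference is bounded by the mean value inequality, which costs a factor |s + i|
  and gains a power of x; the induction lowers the order while passing to s + 1. The condition on Re
  s + k makes the bounding power decreasing on [x, x + 1].\<close>

lemma norm_fdiff_le:
  assumes "x > 0" and "Re s + k \<ge> 0"
  shows "norm (fdiff k s x) \<le> (\<Prod>i<k. norm (s + of_nat i)) * x powr (- Re s - k)"
  using assms
proof (induction k arbitrary: s x)
  case 0
  thus ?case by (simp add: norm_powr_real_powr)
next
  case (Suc k)
  define B where "B = norm s * ((\<Prod>i<k. norm (s + 1 + of_nat i)) * x powr (- Re (s+1) - k))"
  have "norm (fdiff k s (x+1) - fdiff k s x) \<le> B * norm (x + 1 - x)"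
  proof (rule differentiable_bound[of "{x..x+1}"])
    fix u assume u: "u \<in> {x..x+1}"
    show "((\<lambda>x. fdiff k s x) has_derivative (\<lambda>h. h *\<^sub>R (- s * fdiff k (s + 1) u))) (at u within {x..x+1})"
      using fdiff_has_vector_derivative[of u k s "{x..x+1}"] u Suc.prems
      by (simp add: has_vector_derivative_def)
    have "norm (fdiff k (s + 1) u) \<le> (\<Prod>i<k. norm (s + 1 + of_nat i)) * u powr (- Re (s+1) - k)"
      using Suc.IH[of u "s+1"] u Suc.prems by simp
    also have "\<dots> \<le> (\<Prod>i<k. norm (s + 1 + of_nat i)) * x powr (- Re (s+1) - k)"
      using u Suc.prems by (intro mult_left_mono powr_mono2' prod_nonneg) auto
    finally have "norm (- s * fdiff k (s + 1) u) \<le> B"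
      unfolding B_def by (simp add: norm_mult mult_left_mono)
    thus "onorm (\<lambda>h. h *\<^sub>R (- s * fdiff k (s + 1) u)) \<le> B"
      by (intro onorm_le) (simp only: norm_scaleR real_norm_def mult.commute[of "\<bar>_\<bar>"] mult_right_mono abs_ge_zero)
  qed auto
  hence "norm (fdiff (Suc k) s x) \<le> B"
    by (simp add: norm_minus_commute)
  also have "B = (\<Prod>i<Suc k. norm (s + of_nat i)) * x powr (- Re s - Suc k)"
  proof -
    have "- Re (s+1) - real k = - Re s - real (Suc k)" by simp
    thus ?thesis unfolding B_def prod.lessThan_Suc_shift by (simp only:) (simp add: algebra_simps)
  qed
  finally show ?case .
qed

lemma fdiff_holomorphic [holomorphic_intros]:
  "x > 0 \<Longrightarrow> (\<lambda>s. fdiff k s x) holomorphic_on A"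
  by (induction k arbitrary: x) (auto intro!: holomorphic_intros)

definition alt :: "nat \<Rightarrow> complex" where "alt n = (-1) ^ (n + 1)"

lemma alt_Suc [simp]: "alt (Suc n) = - alt n"
  by (simp add: alt_def)

lemma norm_alt [simp]: "norm (alt n) = 1"
  by (simp add: alt_def norm_power)

text \<open>The alternating series, with its tail from M on replaced by k steps of Euler's
  transformation. The remaining series converges for Re s > 1 - k: large k continues the function to
  the left, and large M turns the formula into an approximation by partial sums.\<close>

definition eta_euler :: "nat \<Rightarrow> nat \<Rightarrow> complex \<Rightarrow> complex" where
  "eta_euler k M s = (\<Sum>n\<in>{1..<M}. alt n * of_nat n powr (- s))
     + alt M * (\<Sum>j<k. fdiff j s M / 2 ^ Suc j)
     + (\<Sum>n. alt (n + M) * fdiff k s (real (n + M))) / 2 ^ k"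

lemma summable_fdiff_bound:
  assumes "M > 0" "a > 1"
  shows "summable (\<lambda>n. real (n + M) powr - a)"
proof -
  have "summable (\<lambda>n. real n powr - a)"
    using assms by (subst summable_real_powr_iff) auto
  thus ?thesis by (subst summable_iff_shift)
qed

lemma summable_norm_fdiff:
  assumes "M > 0" "Re s > 1 - real k"
  shows "summable (\<lambda>n. norm (fdiff k s (real (n + M))))"
proof -
  define C where "C = (\<Prod>i<k. norm (s + of_nat i))"
  have 1: "summable (\<lambda>n. C * real (n + M) powr -(Re s + real k))"
    using assms by (intro summable_mult summable_fdiff_bound) auto
  have 2: "norm (norm (fdiff k s (real (n + M)))) \<le> C * real (n + M) powr -(Re s + real k)" for n
  proof -
    have "- Re s - real k = - (Re s + real k)" by simp
    thus ?thesis using norm_fdiff_le[of "real (n+M)" s k] assms by (simp add: C_def del: of_nat_add)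
  qed
  show ?thesis by (rule summable_comparison_test'[OF 1 2])
qed

lemma summable_alt_fdiff:
  assumes "M > 0" "Re s > 1 - real k"
  shows "summable (\<lambda>n. alt (n + M) * fdiff k s (real (n + M)))"
  using summable_norm_fdiff[OF assms]
  by - (rule summable_norm_cancel[where f = "\<lambda>n. alt (n + M) * fdiff k s (real (n + M))"], simp add: norm_mult)

text \<open>A difference of order k + 1 at n produces, after the sign change, the terms of order k
  at n and at n + 1. The new series is therefore twice the old one less its first term, and that
  term is compensated by the additional boundary term.\<close>

lemma eta_euler_Suc_left:
  assumes "M > 0" "Re s > 1 - real k"
  shows "eta_euler (Suc k) M s = eta_euler k M s"
proof -
  let ?g = "\<lambda>n. alt (n + M) * fdiff k s (real (n + M))"
  have sm: "summable ?g" by (rule summable_alt_fdiff) fact+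
  have sm': "summable (\<lambda>n. ?g (Suc n))" using sm by (subst summable_Suc_iff)
  have eq: "alt (n + M) * fdiff (Suc k) s (n + M) = ?g n + ?g (Suc n)" for n
    by (simp add: algebra_simps)
  have "(\<Sum>n. alt (n + M) * fdiff (Suc k) s (n + M)) = (\<Sum>n. ?g n) + (\<Sum>n. ?g (Suc n))"
    unfolding eq using sm sm' by (rule suminf_add [symmetric])
  also have "(\<Sum>n. ?g (Suc n)) = (\<Sum>n. ?g n) - ?g 0"
    using suminf_split_head[OF sm] by simp
  finally have e: "(\<Sum>n. alt (n + M) * fdiff (Suc k) s (n + M)) = 2 * (\<Sum>n. ?g n) - alt M * fdiff k s M"
    by simp
  show ?thesis
    unfolding eta_euler_def e by (simp add: field_simps del: fdiff.simps)
qed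

lemma eta_euler_Suc_right:
  assumes "M > 0" "Re s > 1 - real k"
  shows "eta_euler k (Suc M) s = eta_euler k M s"
proof -
  let ?g = "\<lambda>n. alt (n + M) * fdiff k s (real (n + M))"
  have sm: "summable ?g" by (rule summable_alt_fdiff) fact+
  have 1: "(\<Sum>n. alt (n + Suc M) * fdiff k s (n + Suc M)) = (\<Sum>n. ?g n) - alt M * fdiff k s M"
    using suminf_split_head[OF sm] by simp
  \<comment> \<open>\<open>M\<close> and \<open>Suc M\<close> carry opposite signs, which turns the
    difference of the two boundary sums into this sum. It telescopes because a shift by 1 is the
    identity minus a difference.\<close>
  have 2: "(\<Sum>j<k. fdiff j s M / 2 ^ Suc j) + (\<Sum>j<k. fdiff j s (Suc M) / 2 ^ Suc j)
           = of_nat M powr (-s) - fdiff k s M / 2 ^ k"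
  proof (induction k)
    case (Suc k)
    have "fdiff k s (real (Suc M)) = fdiff k s M - fdiff (Suc k) s M"
      by (simp add: add.commute)
    hence e: "fdiff (Suc k) s M = fdiff k s M - fdiff k s (real (Suc M))" by simp
    show ?case unfolding sum.lessThan_Suc e power_Suc using Suc
      by (simp add: algebra_simps diff_divide_distrib del: fdiff.simps of_nat_Suc)
  qed auto
  show ?thesis
    unfolding eta_euler_def 1
    using arg_cong[OF 2, of "\<lambda>x. alt M * x"] assms
    by (simp add: field_simps del: fdiff.simps)
qed

text \<open>For fixed order the starting point is free, so both sides are moved to
  \<open>M = 1\<close>; there the larger of the two orders is reached by single Euler steps.\<close>

lemma eta_euler_cong:
  assumes "M > 0" "M' > 0" "Re s > 1 - real k" "Re s > 1 - real k'"
  shows "eta_euler k M s = eta_euler k' M' s"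
proof -
  have 1: "eta_euler k M s = eta_euler k 1 s" if "M > 0" "Re s > 1 - real k" for k M :: nat
    using that
  proof (induction M)
    case (Suc M)
    thus ?case by (cases "M = 0") (auto simp: eta_euler_Suc_right)
  qed auto
  have 2: "eta_euler k' 1 s = eta_euler k 1 s" if "k \<le> k'" "Re s > 1 - real k" for k k' :: nat
    using that
  proof (induction k' rule: dec_induct)
    case (step n)
    thus ?case by (subst eta_euler_Suc_left) auto
  qed auto
  show ?thesis
    using 1[of M k] 1[of M' k'] 2[of k k'] 2[of k' k] assms by (cases "k \<le> k'") auto
qed

text \<open>The order grows as Re s decreases so that the tail always converges. Rounding up 2 - Re
  s rather than 1 - Re s secures the strict inequality Re s > 1 - k.\<close>

definition eta :: "complex \<Rightarrow> complex" where
  "eta s = eta_euler (nat \<lceil>2 - Re s\<rceil>) 1 s"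

lemma eta_eq_eta_euler:
  assumes "M > 0" "Re s > 1 - real k"
  shows "eta s = eta_euler k M s"
  unfolding eta_def using assms by (intro eta_euler_cong) linarith+

lemma eta_euler_holomorphic:
  "(\<lambda>s. eta_euler k 1 s) holomorphic_on {s. Re s > 1 - real k}"
proof -
  let ?S = "{s. Re s > 1 - real k}"
  have op: "open ?S" by (rule open_halfspace_Re_gt)
  have "(\<lambda>s. \<Sum>n. alt (n + 1) * fdiff k s (real (n + 1))) holomorphic_on ?S"
  proof (rule holomorphic_uniform_sequence[OF op, of "\<lambda>N s. \<Sum>n<N. alt (n+1) * fdiff k s (real (n + 1))"])
    fix s0 assume s0: "s0 \<in> ?S"
    \<comment> \<open>Half the distance to the line Re s = 1 - k: on the closed disc of this radius
      the n-th term is dominated by a multiple of (n + 1)^(-1-d).\<close>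
    define d where "d = (Re s0 - (1 - real k)) / 2"
    have d: "d > 0" using s0 by (simp add: d_def)
    define B where "B = (\<Prod>i<k. norm s0 + d + real i)"
    have sub: "Re s \<ge> 1 - real k + d" "norm s \<le> norm s0 + d" if "s \<in> cball s0 d" for s
    proof -
      have "norm (s0 - s) \<le> d" using that by (simp add: dist_norm)
      moreover have "\<bar>Re (s0 - s)\<bar> \<le> norm (s0 - s)" by (rule abs_Re_le_cmod)
      ultimately show "Re s \<ge> 1 - real k + d" by (simp add: d_def field_simps)
      have "norm s \<le> norm s0 + norm (s - s0)" using norm_triangle_sub by blast
      thus "norm s \<le> norm s0 + d" using \<open>norm (s0 - s) \<le> d\<close> by (simp add: norm_minus_commute)
    qed
    have "uniform_limit (cball s0 d) (\<lambda>N s. \<Sum>n<N. alt (n+1) * fdiff k s (real (n + 1)))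
            (\<lambda>s. \<Sum>n. alt (n+1) * fdiff k s (real (n + 1))) sequentially"
    proof (rule Weierstrass_m_test)
      show "summable (\<lambda>n. B * real (n + 1) powr -(1 + d))"
        using d by (intro summable_mult summable_fdiff_bound) auto
    next
      fix n s assume s: "s \<in> cball s0 d"
      have P: "(\<Prod>i<k. norm (s + of_nat i)) \<le> B"
        unfolding B_def
      proof (intro prod_mono conjI)
        fix i
        show "norm (s + of_nat i) \<le> norm s0 + d + real i"
          using norm_triangle_ineq[of s "of_nat i"] sub[OF s] by simp
      qed auto
      have B0: "B \<ge> 0" unfolding B_def using d by (intro prod_nonneg) auto
      have "norm (fdiff k s (real (n+1))) \<le> (\<Prod>i<k. norm (s + of_nat i)) * real (n+1) powr (- Re s - real k)"
        using sub[OF s] d by (intro norm_fdiff_le) simp_all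
      also have "\<dots> \<le> B * real (n+1) powr (- (1 + d))"
        using sub[OF s] d by (intro mult_mono P powr_mono B0) simp_all
      finally show "norm (alt (n+1) * fdiff k s (real (n+1))) \<le> B * real (n+1) powr (- (1 + d))"
        by (simp add: norm_mult)
    qed
    moreover have "cball s0 d \<subseteq> ?S"
    proof
      fix s assume "s \<in> cball s0 d"
      from sub(1)[OF this] d show "s \<in> ?S" by simp
    qed
    ultimately show "\<exists>d>0. cball s0 d \<subseteq> ?S \<and> uniform_limit (cball s0 d)
        (\<lambda>N s. \<Sum>n<N. alt (n+1) * fdiff k s (real (n + 1)))
        (\<lambda>s. \<Sum>n. alt (n+1) * fdiff k s (real (n + 1))) sequentially"
      using d by blast
  next
    fix N
    show "(\<lambda>s. \<Sum>n<N. alt (n+1) * fdiff k s (real (n + 1))) holomorphic_on ?S"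
      by (intro holomorphic_on_sum holomorphic_on_mult holomorphic_on_const fdiff_holomorphic) simp
  qed
  moreover have "(\<lambda>s. \<Sum>j<k. fdiff j s (real 1) / 2 ^ Suc j) holomorphic_on ?S"
    by (intro holomorphic_intros) simp_all
  ultimately have "(\<lambda>s. alt 1 * (\<Sum>j<k. fdiff j s (real 1) / 2 ^ Suc j)
      + (\<Sum>n. alt (n + 1) * fdiff k s (real (n + 1))) / 2 ^ k) holomorphic_on ?S"
    by (intro holomorphic_on_add holomorphic_on_mult holomorphic_on_divide holomorphic_on_const) simp_all
  thus ?thesis by (rule holomorphic_transform) (simp add: eta_euler_def)
qed

lemma eta_holomorphic [holomorphic_intros]: "eta holomorphic_on A"
proof -
  have "eta field_differentiable (at s)" for s
  proof -
    define k where "k = nat \<lceil>2 - Re s\<rceil>"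
    have k: "Re s > 1 - real k" unfolding k_def by linarith
    have "eta holomorphic_on {s. Re s > 1 - real k}"
      using eta_euler_holomorphic[of k]
      by (rule holomorphic_transform) (auto intro!: eta_eq_eta_euler[symmetric])
    thus ?thesis
      using k open_halfspace_Re_gt[of "1 - real k"] holomorphic_on_imp_differentiable_at by blast
  qed
  thus ?thesis by (simp add: field_differentiable_at_within holomorphic_onI)
qed

lemma eta_sums:
  assumes "Re s > 1"
  shows "(\<lambda>n. alt (Suc n) * of_nat (Suc n) powr (- s)) sums eta s"
proof -
  have "eta s = (\<Sum>n. alt (n + 1) * fdiff 0 s (n + 1))"
    using eta_eq_eta_euler[of 1 0 s] assms by (simp add: eta_euler_def)
  with summable_alt_fdiff[of 1 0 s] assms show ?thesis
    by (simp add: summable_sums add.commute)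
qed

text \<open>Here the free order k pays off. Each boundary term is at most M^(-\<alpha>) because |s|
  + k \<le> Y \<le> M, and the remaining series is of size Y^k M^(2-k), which is small for large k
  as soon as M exceeds a power of Y with exponent above 1.\<close>

lemma norm_eta_minus_sum_le:
  assumes "Re s \<ge> \<alpha>" "\<alpha> > 0" "norm s + k \<le> Y" "Y \<le> M" "M > 0" "k \<ge> 2" "Y \<ge> 1"
  shows "norm (eta s - (\<Sum>n\<in>{1..<M}. alt n * of_nat n powr (- s)))
           \<le> k * M powr (-\<alpha>) + (\<Sum>n. 1 / real (Suc n)^2) * Y ^ k * M powr (2 - real k)"
proof -
  have M1: "real M \<ge> 1" using assms by simp
  have P: "(\<Prod>i<j. norm (s + of_nat i)) \<le> Y ^ j" if "j \<le> k" for j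
  proof -
    have "(\<Prod>i<j. norm (s + of_nat i)) \<le> (\<Prod>i<j. Y)"
    proof (intro prod_mono conjI)
      fix i assume "i \<in> {..<j}"
      hence "norm (s + of_nat i) \<le> norm s + real k"
        using norm_triangle_ineq[of s "of_nat i"] that by simp
      thus "norm (s + of_nat i) \<le> Y" using assms by simp
    qed auto
    thus ?thesis by simp
  qed
  have 1: "norm (\<Sum>j<k. fdiff j s M / 2 ^ Suc j) \<le> k * M powr (-\<alpha>)"
  proof -
    have "norm (fdiff j s M / 2 ^ Suc j) \<le> M powr (-\<alpha>)" if "j < k" for j
    proof -
      have "norm (fdiff j s M / 2 ^ Suc j) \<le> norm (fdiff j s M) / 1"
        unfolding norm_divide by (intro divide_left_mono) (auto simp: norm_mult norm_power intro!: mult_ge1_I)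
      also have "norm (fdiff j s M) / 1 \<le> (\<Prod>i<j. norm (s + of_nat i)) * real M powr (- Re s - j)"
        using norm_fdiff_le[of "real M" s j] assms by simp
      also have "\<dots> \<le> Y ^ j * real M powr (- \<alpha> - j)"
        using that assms M1 P[of j] by (intro mult_mono powr_mono) auto
      also have "\<dots> \<le> real M ^ j * real M powr (- \<alpha> - j)"
        using assms by (intro mult_right_mono power_mono) auto
      also have "\<dots> = real M powr (-\<alpha>)"
        using assms by (simp add: powr_diff powr_realpow)
      finally show ?thesis .
    qed
    hence "norm (\<Sum>j<k. fdiff j s M / 2 ^ Suc j) \<le> (\<Sum>j<k. M powr (-\<alpha>))"
      by (intro sum_norm_le) auto
    thus ?thesis by simp
  qed
  have sq: "summable (\<lambda>n. 1 / real (Suc n)^2)"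
    using inverse_squares_sums by (simp add: sums_iff add.commute)
  have bd: "norm (alt (n + M) * fdiff k s (real (n + M))) \<le> Y ^ k * M powr (2 - real k) * (1 / real (Suc n)^2)" for n
  proof -
    have "norm (fdiff k s (real (n + M))) \<le> (\<Prod>i<k. norm (s + of_nat i)) * real (n+M) powr (- Re s - k)"
      using assms by (intro norm_fdiff_le) auto
    also have "\<dots> \<le> Y ^ k * real (n+M) powr (- 0 - k)"
      using assms P[of k] by (intro mult_mono powr_mono) auto
    \<comment> \<open>Two powers of n + M are kept to make the series converge; the others give the
      power of M.\<close>
    also have "real (n+M) powr (- 0 - k) = real (n+M) powr (2 - real k) * real (n+M) powr (-2)"
      by (subst powr_add [symmetric]) simp
    also have "\<dots> \<le> real M powr (2 - real k) * real (Suc n) powr (-2)"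
      using assms by (intro mult_mono powr_mono2') auto
    also have "real (Suc n) powr (-2) = 1 / real (Suc n)^2"
      by (simp add: powr_minus_divide powr_numeral)
    finally show ?thesis using assms by (simp add: norm_mult mult_left_mono mult.assoc)
  qed
  have 2: "norm (\<Sum>n. alt (n + M) * fdiff k s (real (n + M))) \<le> (\<Sum>n. 1 / real (Suc n)^2) * Y ^ k * M powr (2 - real k)"
  proof -
    have "norm (\<Sum>n. alt (n + M) * fdiff k s (real (n + M))) \<le> (\<Sum>n. Y ^ k * M powr (2 - real k) * (1 / real (Suc n)^2))"
      using bd by (intro norm_suminf_le summable_mult sq) auto
    also have "\<dots> = Y ^ k * M powr (2 - real k) * (\<Sum>n. 1 / real (Suc n)^2)"
      using sq by (rule suminf_mult)
    finally show ?thesis by (simp add: mult_ac)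
  qed
  have "eta s = eta_euler k M s" using assms by (intro eta_eq_eta_euler) auto
  hence "eta s - (\<Sum>n\<in>{1..<M}. alt n * of_nat n powr (- s)) =
     alt M * (\<Sum>j<k. fdiff j s M / 2 ^ Suc j) + (\<Sum>n. alt (n + M) * fdiff k s (real (n + M))) / 2 ^ k"
    by (simp add: eta_euler_def del: fdiff.simps)
  also have "norm \<dots> \<le> norm (\<Sum>j<k. fdiff j s M / 2 ^ Suc j) + norm (\<Sum>n. alt (n + M) * fdiff k s (real (n + M))) / 1"
    by (intro norm_triangle_mono)
       (simp_all add: norm_mult norm_divide norm_power divide_le_eq mult_le_cancel_left1 del: of_nat_add)
  finally show ?thesis using 1 2 by simp
qed

section \<open>Mean values of Dirichlet polynomials\<close>

definition nit :: "nat \<Rightarrow> real \<Rightarrow> complex" where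
  "nit n t = cis (- (t * ln (real n)))"

lemma norm_nit [simp]: "norm (nit n t) = 1"
  by (simp add: nit_def)

lemma nit_1 [simp]: "nit 1 t = 1" "nit (Suc 0) t = 1"
  by (simp_all add: nit_def)

lemma nit_mult: "m > 0 \<Longrightarrow> n > 0 \<Longrightarrow> nit (m * n) t = nit m t * nit n t"
  by (simp add: nit_def ln_mult cis_mult algebra_simps)

lemma powr_shift_eq_nit:
  assumes "n > 0"
  shows "of_nat n powr (- (s + \<i> * of_real t)) = of_nat n powr (- s) * nit n t"
proof -
  have "of_nat n powr (- (s + \<i> * of_real t)) = exp (- s * Ln (of_nat n)) * exp (- (\<i> * of_real t) * Ln (of_nat n))"
    using assms by (simp add: powr_def algebra_simps flip: exp_add)
  also have "Ln (of_nat n) = of_real (ln (real n))"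
    using assms by (metis Ln_of_real of_nat_0_less_iff of_real_of_nat_eq)
  also have "exp (- (\<i> * of_real t) * of_real (ln (real n))) = nit n t"
    by (simp add: nit_def cis_conv_exp mult_ac)
  also have "exp (- s * of_real (ln (real n))) = of_nat n powr (- s)"
    using assms by (simp add: powr_def)
  finally show ?thesis .
qed

lemma continuous_on_nit [continuous_intros]:
  assumes "continuous_on A f"
  shows "continuous_on A (\<lambda>x. nit n (f x))"
  unfolding nit_def by (intro continuous_intros assms)

lemma cis_has_integral:
  assumes "a \<noteq> 0" "T \<ge> 0"
  shows "((\<lambda>t. cis (a * t)) has_integral ((cis (a * T) - 1) / (\<i> * of_real a))) {0..T}"
proof -
  have "((\<lambda>t. cis (a * t)) has_integral (cis (a * T) / (\<i> * of_real a) - cis (a * 0) / (\<i> * of_real a))) {0..T}"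
  proof (rule fundamental_theorem_of_calculus[OF assms(2)])
    fix t assume "t \<in> {0..T}"
    have "((\<lambda>z. exp (\<i> * of_real a * z) / (\<i> * of_real a)) has_field_derivative exp (\<i> * of_real a * of_real t)) (at (of_real t))"
      using assms by (auto intro!: derivative_eq_intros)
    hence "((\<lambda>t. exp (\<i> * of_real a * of_real t) / (\<i> * of_real a)) has_vector_derivative exp (\<i> * of_real a * of_real t)) (at t within {0..T})"
      by (rule has_vector_derivative_real_field)
    thus "((\<lambda>t. cis (a * t) / (\<i> * of_real a)) has_vector_derivative cis (a * t)) (at t within {0..T})"
      by (simp add: cis_conv_exp mult_ac)
  qed
  thus ?thesis by (simp add: diff_divide_distrib)
qed

lemma norm_integral_cis_le:
  assumes "a \<noteq> 0" "T \<ge> 0"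
  shows "norm (integral {0..T} (\<lambda>t. cis (a * t))) \<le> 2 / \<bar>a\<bar>"
proof -
  have "integral {0..T} (\<lambda>t. cis (a * t)) = (cis (a * T) - 1) / (\<i> * of_real a)"
    using cis_has_integral[OF assms] by (rule integral_unique)
  also have "norm \<dots> = norm (cis (a * T) - 1) / \<bar>a\<bar>"
    by (simp add: norm_divide norm_mult)
  also have "norm (cis (a * T) - 1) \<le> 2"
    using norm_triangle_ineq4[of "cis (a*T)" 1] by simp
  finally show ?thesis by (simp add: divide_right_mono)
qed

text \<open>Opening the square, the diagonal produces the main term, and every other pair is the
  integral of a pure oscillation of frequency ln n - ln m, hence at most 2 divided by that
  frequency.\<close>

lemma mean_square_dirichlet_poly:
  assumes "finite A" "\<And>m. m \<in> A \<Longrightarrow> m > 0" "T \<ge> 0"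
  shows "\<bar>integral {0..T} (\<lambda>t. norm (\<Sum>m\<in>A. c m * nit m t)^2) - T * (\<Sum>m\<in>A. norm (c m)^2)\<bar>
     \<le> (\<Sum>m\<in>A. \<Sum>n\<in>A-{m}. norm (c m) * norm (c n) * (2 / \<bar>ln (real m) - ln (real n)\<bar>))"
proof -
  let ?I = "\<lambda>m n. integral {0..T} (\<lambda>t. cis ((ln (real n) - ln (real m)) * t))"
  have "of_real (norm (\<Sum>m\<in>A. c m * nit m t)^2)
     = (\<Sum>m\<in>A. \<Sum>n\<in>A. c m * cnj (c n) * cis ((ln (real n) - ln (real m)) * t))" for t
  proof -
    have "of_real (norm (\<Sum>m\<in>A. c m * nit m t)^2) = (\<Sum>m\<in>A. c m * nit m t) * cnj (\<Sum>m\<in>A. c m * nit m t)"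
      by (rule complex_norm_square)
    also have "\<dots> = (\<Sum>m\<in>A. \<Sum>n\<in>A. (c m * nit m t) * cnj (c n * nit n t))"
      by (simp add: sum_product)
    also have "\<dots> = (\<Sum>m\<in>A. \<Sum>n\<in>A. c m * cnj (c n) * cis ((ln (real n) - ln (real m)) * t))"
    proof (intro sum.cong refl)
      fix m n
      have "nit m t * cnj (nit n t) = cis ((ln (real n) - ln (real m)) * t)"
        by (simp add: nit_def cis_cnj cis_mult algebra_simps)
      thus "(c m * nit m t) * cnj (c n * nit n t) = c m * cnj (c n) * cis ((ln (real n) - ln (real m)) * t)"
        by (simp add: mult_ac)
    qed
    finally show ?thesis .
  qed
  note eq = this
  have int: "(\<lambda>t. c m * cnj (c n) * cis ((ln (real n) - ln (real m)) * t)) integrable_on {0..T}" for m n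
    by (intro integrable_continuous_interval continuous_intros)
  have "of_real (integral {0..T} (\<lambda>t. norm (\<Sum>m\<in>A. c m * nit m t)^2))
      = integral {0..T} (\<lambda>t. complex_of_real (norm (\<Sum>m\<in>A. c m * nit m t)^2))"
    by (intro integral_linear[OF _ bounded_linear_of_real, unfolded o_def, symmetric] integrable_continuous_interval continuous_intros)
  also have "\<dots> = (\<Sum>m\<in>A. \<Sum>n\<in>A. c m * cnj (c n) * ?I m n)"
  proof -
    have "integral {0..T} (\<lambda>t. complex_of_real (norm (\<Sum>m\<in>A. c m * nit m t)^2))
      = (\<Sum>m\<in>A. \<Sum>n\<in>A. integral {0..T} (\<lambda>t. c m * cnj (c n) * cis ((ln (real n) - ln (real m)) * t)))"
      unfolding eq by (simp add: integral_sum integrable_sum int assms del: integral_mult_right)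
    thus ?thesis by simp
  qed
  also have "\<dots> = (\<Sum>m\<in>A. c m * cnj (c m) * ?I m m + (\<Sum>n\<in>A-{m}. c m * cnj (c n) * ?I m n))"
    using assms by (intro sum.cong refl) (simp add: sum.remove)
  also have "\<dots> = of_real T * (\<Sum>m\<in>A. of_real (norm (c m)^2)) + (\<Sum>m\<in>A. \<Sum>n\<in>A-{m}. c m * cnj (c n) * ?I m n)"
  proof -
    have "?I m m = of_real T" for m
      using assms by (simp add: scaleR_conv_of_real)
    thus ?thesis
      by (simp add: sum.distrib sum_distrib_left complex_norm_square mult.commute del: of_real_power)
  qed
  finally have "of_real (integral {0..T} (\<lambda>t. norm (\<Sum>m\<in>A. c m * nit m t)^2) - T * (\<Sum>m\<in>A. norm (c m)^2))
     = (\<Sum>m\<in>A. \<Sum>n\<in>A-{m}. c m * cnj (c n) * ?I m n)"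
    by simp
  from arg_cong[OF this, of norm] have "\<bar>integral {0..T} (\<lambda>t. norm (\<Sum>m\<in>A. c m * nit m t)^2) - T * (\<Sum>m\<in>A. norm (c m)^2)\<bar>
     = norm (\<Sum>m\<in>A. \<Sum>n\<in>A-{m}. c m * cnj (c n) * ?I m n)"
    by (simp only: norm_of_real)
  also have "\<dots> \<le> (\<Sum>m\<in>A. \<Sum>n\<in>A-{m}. norm (c m) * norm (c n) * (2 / \<bar>ln (real m) - ln (real n)\<bar>))"
  proof (intro sum_norm_le)
    fix m n assume mn: "m \<in> A" "n \<in> A - {m}"
    have "m > 0" "n > 0" using assms mn by auto
    hence "ln (real n) - ln (real m) \<noteq> 0" using mn by auto
    from norm_integral_cis_le[OF this assms(3)]
    have "norm (?I m n) \<le> 2 / \<bar>ln (real m) - ln (real n)\<bar>"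
      by (simp add: abs_minus_commute)
    thus "norm (c m * cnj (c n) * ?I m n) \<le> norm (c m) * norm (c n) * (2 / \<bar>ln (real m) - ln (real n)\<bar>)"
      unfolding norm_mult complex_mod_cnj by (intro mult_left_mono mult_nonneg_nonneg norm_ge_zero)
  qed
  finally show ?thesis .
qed

lemma sum_powr_neg_le:
  assumes "0 < a" "a < 1"
  shows "(\<Sum>k=1..X. real k powr -a) \<le> real X powr (1 - a) / (1 - a)"
proof (induction X)
  case (Suc X)
  have "(1 - a) * real (Suc X) powr -a \<le> real (Suc X) powr (1 - a) - real X powr (1 - a)"
  proof (cases "X = 0")
    case False
    have "\<exists>z. z > real X \<and> z < real (Suc X) \<and>
        real (Suc X) powr (1 - a) - real X powr (1 - a) = (real (Suc X) - real X) * ((1 - a) * z powr (1 - a - 1))"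
      using False by (intro MVT2) (auto intro!: derivative_eq_intros)
    then obtain z where z: "z > real X" "z < real (Suc X)"
       "real (Suc X) powr (1 - a) - real X powr (1 - a) = (1 - a) * z powr (- a)" by auto
    show ?thesis unfolding z(3) using assms z False
      by (intro mult_left_mono powr_mono2') auto
  qed (use assms in auto)
  hence "real (Suc X) powr -a \<le> real (Suc X) powr (1 - a) / (1 - a) - real X powr (1 - a) / (1 - a)"
    using assms by (simp add: diff_divide_distrib[symmetric] pos_le_divide_eq mult.commute)
  thus ?case using Suc by simp
qed (use assms in auto)

text \<open>For m < n one has ln (n / m) \<ge> (n - m) / n. The bound is written symmetrically in m
  and n, so that in the double sum the two halves can be interchanged.\<close>

lemma inverse_abs_diff_ln_le:
  assumes "0 < m" "0 < n" "m \<noteq> n" "m \<le> X" "n \<le> X" "0 < a" "a < 1"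
  shows "real m powr -a * real n powr -a / \<bar>ln (real m) - ln (real n)\<bar>
     \<le> real X powr (1 - a) * ((real m powr -a + real n powr -a) / \<bar>real m - real n\<bar>)"
proof -
  have main: "real m powr -a * real n powr -a / \<bar>ln (real m) - ln (real n)\<bar>
     \<le> real X powr (1 - a) * ((real m powr -a + real n powr -a) / \<bar>real m - real n\<bar>)"
    if mn: "0 < m" "m < n" "n \<le> X" for m n :: nat
  proof -
    have "ln (real m / real n) \<le> real m / real n - 1"
      using mn by (intro ln_le_minus_one) auto
    hence l: "ln (real n) - ln (real m) \<ge> (real n - real m) / real n"
      using mn by (simp add: ln_div field_simps)
    have "real m powr -a * real n powr -a / \<bar>ln (real m) - ln (real n)\<bar>
        = real m powr -a * real n powr -a / (ln (real n) - ln (real m))"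
      using mn by simp
    also have "\<dots> \<le> real m powr -a * real n powr -a / ((real n - real m) / real n)"
      using l mn by (intro divide_left_mono mult_nonneg_nonneg mult_pos_pos) auto
    also have "\<dots> = real m powr -a * (real n powr (1-a) / (real n - real m))"
      using mn by (simp add: powr_diff powr_minus field_simps)
    also have "\<dots> \<le> (real m powr -a + real n powr -a) * (real X powr (1-a) / (real n - real m))"
      using mn assms by (intro mult_mono divide_right_mono powr_mono2) auto
    finally show ?thesis using mn by (simp add: mult_ac)
  qed
  show ?thesis
  proof (cases "m < n")
    case True
    with main[of m n] assms show ?thesis by simp
  next
    case False
    with main[of n m] assms show ?thesis by (simp add: abs_minus_commute add.commute mult.commute)
  qed
qed

text \<open>The true order is ln X. Majorising 1 / k by k^(th-1) trades the logarithm for a small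
  power, so that later only exponents have to be compared.\<close>

lemma sum_inverse_abs_diff_le:
  assumes "0 < th" "th < 1" "m \<le> X"
  shows "(\<Sum>n\<in>{1..X}-{m}. 1 / \<bar>real m - real n\<bar>) \<le> 2 * real X powr th / th"
proof -
  let ?g = "\<lambda>k. real k powr -(1 - th)"
  have le: "1 / real k \<le> ?g k" if "k > 0" for k
  proof -
    have "real k powr (-1) \<le> ?g k" using that assms by (intro powr_mono) auto
    thus ?thesis using that by (simp add: powr_minus_divide)
  qed
  have split: "{1..X} - {m} = {1..<m} \<union> {m+1..X}" using assms by auto
  have "(\<Sum>n\<in>{1..X}-{m}. 1 / \<bar>real m - real n\<bar>) = (\<Sum>n\<in>{1..<m}. 1 / \<bar>real m - real n\<bar>) + (\<Sum>n\<in>{m+1..X}. 1 / \<bar>real m - real n\<bar>)"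
    unfolding split by (rule sum.union_disjoint) auto
  also have "(\<Sum>n\<in>{1..<m}. 1 / \<bar>real m - real n\<bar>) \<le> (\<Sum>n\<in>{1..<m}. ?g (m - n))"
  proof (rule sum_mono)
    fix n assume "n \<in> {1..<m}"
    thus "1 / \<bar>real m - real n\<bar> \<le> ?g (m - n)" using le[of "m - n"] by (auto simp: of_nat_diff)
  qed
  also have "\<dots> = (\<Sum>k\<in>{1..<m}. ?g k)"
    by (rule sum.reindex_bij_witness[of _ "\<lambda>k. m - k" "\<lambda>k. m - k"]) auto
  also have "\<dots> \<le> (\<Sum>k=1..X. ?g k)"
    using assms by (intro sum_mono2) auto
  also have "(\<Sum>n\<in>{m+1..X}. 1 / \<bar>real m - real n\<bar>) \<le> (\<Sum>n\<in>{m+1..X}. ?g (n - m))"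
  proof (rule sum_mono)
    fix n assume "n \<in> {m+1..X}"
    thus "1 / \<bar>real m - real n\<bar> \<le> ?g (n - m)" using le[of "n - m"] by (auto simp: of_nat_diff)
  qed
  also have "\<dots> = (\<Sum>k\<in>{1..X-m}. ?g k)"
    by (rule sum.reindex_bij_witness[of _ "\<lambda>k. k + m" "\<lambda>k. k - m"]) auto
  also have "\<dots> \<le> (\<Sum>k=1..X. ?g k)"
    by (intro sum_mono2) auto
  finally have "(\<Sum>n\<in>{1..X}-{m}. 1 / \<bar>real m - real n\<bar>) \<le> 2 * (\<Sum>k=1..X. ?g k)" by simp
  also have "(\<Sum>k=1..X. ?g k) \<le> real X powr th / th"
    using sum_powr_neg_le[of "1 - th" X] assms by simp
  finally show ?thesis by simp
qed

text \<open>What matters is the exponent of the length X in the off-diagonal part. For a > 1/2 and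
  small th it is below 1, which leaves room for X to be somewhat longer than T.\<close>

lemma mean_square_dirichlet_poly_powr:
  assumes a: "0 < a" "a < 1" and th: "0 < th" "th < 1" and T: "T \<ge> 0"
    and c: "\<And>m. m \<in> {1..X} \<Longrightarrow> norm (c m) \<le> C * real m powr -a"
  shows "\<bar>integral {0..T} (\<lambda>t. norm (\<Sum>m\<in>{1..X}. c m * nit m t)^2) - T * (\<Sum>m\<in>{1..X}. norm (c m)^2)\<bar>
     \<le> 8 * C^2 / (th * (1 - a)) * real X powr (2 - 2 * a + th)"
proof -
  let ?A = "{1..X}"
  let ?p = "\<lambda>m. real m powr -a"
  have "\<bar>integral {0..T} (\<lambda>t. norm (\<Sum>m\<in>{1..X}. c m * nit m t)^2) - T * (\<Sum>m\<in>{1..X}. norm (c m)^2)\<bar>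
     \<le> (\<Sum>m\<in>?A. \<Sum>n\<in>?A-{m}. norm (c m) * norm (c n) * (2 / \<bar>ln (real m) - ln (real n)\<bar>))"
    using T by (intro mean_square_dirichlet_poly) auto
  also have "\<dots> \<le> (\<Sum>m\<in>?A. \<Sum>n\<in>?A-{m}. 2 * C^2 * real X powr (1 - a) * ((?p m + ?p n) / \<bar>real m - real n\<bar>))"
  proof (intro sum_mono)
    fix m n assume mn: "m \<in> ?A" "n \<in> ?A - {m}"
    have "norm (c m) * norm (c n) * (2 / \<bar>ln (real m) - ln (real n)\<bar>)
       \<le> (C * ?p m) * (C * ?p n) * (2 / \<bar>ln (real m) - ln (real n)\<bar>)"
      using mn c by (intro mult_right_mono mult_mono c order_trans[OF norm_ge_zero c]) auto
    also have "\<dots> = 2 * C^2 * (?p m * ?p n / \<bar>ln (real m) - ln (real n)\<bar>)"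
      by (simp add: power2_eq_square)
    also have "\<dots> \<le> 2 * C^2 * (real X powr (1 - a) * ((?p m + ?p n) / \<bar>real m - real n\<bar>))"
      using mn a by (intro mult_left_mono inverse_abs_diff_ln_le) auto
    finally show "norm (c m) * norm (c n) * (2 / \<bar>ln (real m) - ln (real n)\<bar>)
       \<le> 2 * C^2 * real X powr (1 - a) * ((?p m + ?p n) / \<bar>real m - real n\<bar>)"
      by (simp add: mult_ac)
  qed
  also have "\<dots> = 2 * C^2 * real X powr (1 - a) * (\<Sum>m\<in>?A. \<Sum>n\<in>?A-{m}. (?p m + ?p n) / \<bar>real m - real n\<bar>)"
    by (simp add: sum_distrib_left)
  also have "(\<Sum>m\<in>?A. \<Sum>n\<in>?A-{m}. (?p m + ?p n) / \<bar>real m - real n\<bar>)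
      = 2 * (\<Sum>m\<in>?A. \<Sum>n\<in>?A-{m}. ?p m / \<bar>real m - real n\<bar>)"
  proof -
    have swap: "(\<Sum>m\<in>?A. \<Sum>n\<in>?A-{m}. ?p n / \<bar>real m - real n\<bar>) = (\<Sum>m\<in>?A. \<Sum>n\<in>?A-{m}. ?p m / \<bar>real m - real n\<bar>)"
    proof -
      have e: "(\<Sum>n\<in>?A-{m}. h n) = (\<Sum>n\<in>?A. if n = m then 0 else h n)" if "m \<in> ?A" for m and h :: "nat \<Rightarrow> real"
        using that by (subst sum.remove[of ?A m "\<lambda>n. if n = m then 0 else h n"]) (auto intro!: sum.cong)
      have "(\<Sum>m\<in>?A. \<Sum>n\<in>?A-{m}. ?p n / \<bar>real m - real n\<bar>) = (\<Sum>m\<in>?A. \<Sum>n\<in>?A. if n = m then 0 else ?p n / \<bar>real m - real n\<bar>)"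
        by (intro sum.cong refl e)
      also have "\<dots> = (\<Sum>n\<in>?A. \<Sum>m\<in>?A. if n = m then 0 else ?p n / \<bar>real m - real n\<bar>)"
        by (rule sum.swap)
      also have "\<dots> = (\<Sum>m\<in>?A. \<Sum>n\<in>?A. if n = m then 0 else ?p m / \<bar>real m - real n\<bar>)"
        by (intro sum.cong refl) (auto simp: abs_minus_commute)
      also have "\<dots> = (\<Sum>m\<in>?A. \<Sum>n\<in>?A-{m}. ?p m / \<bar>real m - real n\<bar>)"
        by (intro sum.cong refl e [symmetric])
      finally show ?thesis .
    qed
    have "(\<Sum>m\<in>?A. \<Sum>n\<in>?A-{m}. (?p m + ?p n) / \<bar>real m - real n\<bar>)
       = (\<Sum>m\<in>?A. \<Sum>n\<in>?A-{m}. ?p m / \<bar>real m - real n\<bar>) + (\<Sum>m\<in>?A. \<Sum>n\<in>?A-{m}. ?p n / \<bar>real m - real n\<bar>)"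
      by (simp only: add_divide_distrib sum.distrib)
    thus ?thesis unfolding swap by simp
  qed
  also have "(\<Sum>m\<in>?A. \<Sum>n\<in>?A-{m}. ?p m / \<bar>real m - real n\<bar>) = (\<Sum>m\<in>?A. ?p m * (\<Sum>n\<in>?A-{m}. 1 / \<bar>real m - real n\<bar>))"
    by (simp add: sum_distrib_left)
  also have "\<dots> \<le> (\<Sum>m\<in>?A. ?p m * (2 * real X powr th / th))"
    using th by (intro sum_mono mult_left_mono sum_inverse_abs_diff_le) auto
  also have "\<dots> = (\<Sum>m=1..X. ?p m) * (2 * real X powr th / th)"
    by (rule sum_distrib_right [symmetric])
  also have "\<dots> \<le> (real X powr (1 - a) / (1 - a)) * (2 * real X powr th / th)"
    using a th by (intro mult_right_mono sum_powr_neg_le) auto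
  finally have "\<bar>integral {0..T} (\<lambda>t. norm (\<Sum>m\<in>{1..X}. c m * nit m t)^2) - T * (\<Sum>m\<in>{1..X}. norm (c m)^2)\<bar>
     \<le> 2 * C^2 * real X powr (1 - a) * (2 * ((real X powr (1 - a) / (1 - a)) * (2 * real X powr th / th)))"
    by (simp add: mult_left_mono)
  also have "\<dots> = 8 * C^2 / (th * (1 - a)) * (real X powr (1 - a) * real X powr (1 - a) * real X powr th)"
    by (simp add: field_simps)
  also have "real X powr (1 - a) * real X powr (1 - a) * real X powr th = real X powr (2 - 2 * a + th)"
    by (simp add: algebra_simps flip: powr_add)
  finally show ?thesis .
qed

section \<open>Functions of height approximated by Dirichlet polynomials of length a power of
  T\<close>

text \<open>The approximation is demanded for every \<open>\<kappa>\<close>, which makes the notion stable under multiplication by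
  \<open>n\<^sup>-\<^sup>i\<^sup>t\<close>: this replaces the length \<open>M\<close> by \<open>M div n\<close>.\<close>

definition dirichlet_approx :: "real \<Rightarrow> real \<Rightarrow> 'i set \<Rightarrow> ('i \<Rightarrow> real \<Rightarrow> complex) \<Rightarrow> ('i \<Rightarrow> nat \<Rightarrow> complex) \<Rightarrow> bool" where
  "dirichlet_approx \<alpha> \<beta> I f c \<longleftrightarrow>
     (\<exists>C\<ge>0. \<forall>i\<in>I. \<forall>m>0. norm (c i m) \<le> C * real m powr -\<alpha>) \<and>
     (\<forall>\<kappa>>0. \<forall>\<delta>>0. \<forall>\<^sub>F T in at_top. \<forall>i\<in>I. \<forall>t\<in>{0..T}. \<forall>M. \<kappa> * T powr \<beta> \<le> real M \<longrightarrow>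
        norm (f i t - (\<Sum>m\<in>{1..M}. c i m * nit m t)) \<le> \<delta>)"

lemma dirichlet_approxI:
  assumes "C \<ge> 0" "\<And>i m. i \<in> I \<Longrightarrow> m > 0 \<Longrightarrow> norm (c i m) \<le> C * real m powr -\<alpha>"
  assumes "\<And>\<kappa> \<delta>. \<kappa> > 0 \<Longrightarrow> \<delta> > 0 \<Longrightarrow> \<forall>\<^sub>F T in at_top. \<forall>i\<in>I. \<forall>t\<in>{0..T}. \<forall>M. \<kappa> * T powr \<beta> \<le> real M \<longrightarrow>
        norm (f i t - (\<Sum>m\<in>{1..M}. c i m * nit m t)) \<le> \<delta>"
  shows "dirichlet_approx \<alpha> \<beta> I f c"
  using assms unfolding dirichlet_approx_def by blast

lemma dirichlet_approxD:
  assumes "dirichlet_approx \<alpha> \<beta> I f c" "\<kappa> > 0" "\<delta> > 0"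
  shows "\<forall>\<^sub>F T in at_top. \<forall>i\<in>I. \<forall>t\<in>{0..T}. \<forall>M. \<kappa> * T powr \<beta> \<le> real M \<longrightarrow>
        norm (f i t - (\<Sum>m\<in>{1..M}. c i m * nit m t)) \<le> \<delta>"
  using assms unfolding dirichlet_approx_def by blast

lemma dirichlet_approx_coeffE:
  assumes "dirichlet_approx \<alpha> \<beta> I f c"
  obtains C where "C \<ge> 0" "\<And>i m. i \<in> I \<Longrightarrow> m > 0 \<Longrightarrow> norm (c i m) \<le> C * real m powr -\<alpha>"
  using assms unfolding dirichlet_approx_def by blast

lemma dirichlet_approx_add:
  assumes "dirichlet_approx \<alpha> \<beta> I f c" "dirichlet_approx \<alpha> \<beta> I g d"
  shows "dirichlet_approx \<alpha> \<beta> I (\<lambda>i t. f i t + g i t) (\<lambda>i m. c i m + d i m)"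
proof -
  obtain C where C: "C \<ge> 0" "\<And>i m. i \<in> I \<Longrightarrow> m > 0 \<Longrightarrow> norm (c i m) \<le> C * real m powr -\<alpha>"
    by (rule dirichlet_approx_coeffE[OF assms(1)]) blast
  obtain D where D: "D \<ge> 0" "\<And>i m. i \<in> I \<Longrightarrow> m > 0 \<Longrightarrow> norm (d i m) \<le> D * real m powr -\<alpha>"
    by (rule dirichlet_approx_coeffE[OF assms(2)]) blast
  show ?thesis
  proof (rule dirichlet_approxI[of "C + D"])
    fix i m assume "i \<in> I" "m > (0::nat)"
    thus "norm (c i m + d i m) \<le> (C + D) * real m powr -\<alpha>"
      using norm_triangle_mono[OF C(2) D(2), of i m i m] by (simp add: algebra_simps)
  next
    fix \<kappa> \<delta> :: real assume k: "\<kappa> > 0" "\<delta> > 0"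
    hence d2: "\<delta> / 2 > 0" by simp
    show "\<forall>\<^sub>F T in at_top. \<forall>i\<in>I. \<forall>t\<in>{0..T}. \<forall>M. \<kappa> * T powr \<beta> \<le> real M \<longrightarrow>
        norm (f i t + g i t - (\<Sum>m\<in>{1..M}. (c i m + d i m) * nit m t)) \<le> \<delta>"
      using dirichlet_approxD[OF assms(1) k(1) d2] dirichlet_approxD[OF assms(2) k(1) d2]
    proof eventually_elim
      case (elim T)
      show ?case
      proof (intro ballI allI impI)
        fix i t M assume *: "i \<in> I" "t \<in> {0..T}" "\<kappa> * T powr \<beta> \<le> real M"
        have "norm ((f i t - (\<Sum>m\<in>{1..M}. c i m * nit m t)) + (g i t - (\<Sum>m\<in>{1..M}. d i m * nit m t))) \<le> \<delta>/2 + \<delta>/2"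
          using elim * by (intro norm_triangle_mono) blast+
        thus "norm (f i t + g i t - (\<Sum>m\<in>{1..M}. (c i m + d i m) * nit m t)) \<le> \<delta>"
          by (simp add: algebra_simps sum.distrib)
      qed
    qed
  qed (use C D in auto)
qed

lemma dirichlet_approx_cmult:
  assumes "dirichlet_approx \<alpha> \<beta> I f c" "\<And>i. i \<in> I \<Longrightarrow> norm (u i) \<le> B"
  shows "dirichlet_approx \<alpha> \<beta> I (\<lambda>i t. u i * f i t) (\<lambda>i m. u i * c i m)"
proof -
  obtain C where C: "C \<ge> 0" "\<And>i m. i \<in> I \<Longrightarrow> m > 0 \<Longrightarrow> norm (c i m) \<le> C * real m powr -\<alpha>"
    by (rule dirichlet_approx_coeffE[OF assms(1)]) blast
  define B' where "B' = max B 1"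
  have B': "B' > 0" "\<And>i. i \<in> I \<Longrightarrow> norm (u i) \<le> B'" using assms(2) by (force simp: B'_def)+
  show ?thesis
  proof (rule dirichlet_approxI[of "B' * C"])
    fix i m assume "i \<in> I" "m > (0::nat)"
    thus "norm (u i * c i m) \<le> (B' * C) * real m powr -\<alpha>"
      unfolding norm_mult mult.assoc using B' C by (intro mult_mono) auto
  next
    fix \<kappa> \<delta> :: real assume k: "\<kappa> > 0" "\<delta> > 0"
    hence d2: "\<delta> / B' > 0" using B' by simp
    show "\<forall>\<^sub>F T in at_top. \<forall>i\<in>I. \<forall>t\<in>{0..T}. \<forall>M. \<kappa> * T powr \<beta> \<le> real M \<longrightarrow>
        norm (u i * f i t - (\<Sum>m\<in>{1..M}. u i * c i m * nit m t)) \<le> \<delta>"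
      using dirichlet_approxD[OF assms(1) k(1) d2]
    proof eventually_elim
      case (elim T)
      show ?case
      proof (intro ballI allI impI)
        fix i t M assume *: "i \<in> I" "t \<in> {0..T}" "\<kappa> * T powr \<beta> \<le> real M"
        have "norm (u i * (f i t - (\<Sum>m\<in>{1..M}. c i m * nit m t))) \<le> B' * (\<delta> / B')"
          unfolding norm_mult using elim * B' by (intro mult_mono) auto
        thus "norm (u i * f i t - (\<Sum>m\<in>{1..M}. u i * c i m * nit m t)) \<le> \<delta>"
          using B' by (simp add: algebra_simps sum_distrib_left)
      qed
    qed
  qed (use C B' in auto)
qed

lemma dirichlet_approx_diff:
  assumes "dirichlet_approx \<alpha> \<beta> I f c" "dirichlet_approx \<alpha> \<beta> I g d"
  shows "dirichlet_approx \<alpha> \<beta> I (\<lambda>i t. f i t - g i t) (\<lambda>i m. c i m - d i m)"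
  using dirichlet_approx_add[OF assms(1) dirichlet_approx_cmult[OF assms(2), of "\<lambda>_. -1" 1]] by simp

lemma dirichlet_approx_const:
  assumes "\<And>i. i \<in> I \<Longrightarrow> norm (u i) \<le> B" "\<beta> > 0"
  shows "dirichlet_approx \<alpha> \<beta> I (\<lambda>i t. u i) (\<lambda>i m. if m = 1 then u i else 0)"
proof (rule dirichlet_approxI[of "max B 0"])
  fix \<kappa> \<delta> :: real assume k: "\<kappa> > 0" "\<delta> > 0"
  have "filterlim (\<lambda>T. \<kappa> * T powr \<beta>) at_top at_top"
    using k assms by real_asymp
  hence "\<forall>\<^sub>F T in at_top. \<kappa> * T powr \<beta> \<ge> 1" by (simp add: filterlim_at_top)
  thus "\<forall>\<^sub>F T in at_top. \<forall>i\<in>I. \<forall>t\<in>{0..T}. \<forall>M. \<kappa> * T powr \<beta> \<le> real M \<longrightarrow>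
        norm (u i - (\<Sum>m\<in>{1..M}. (if m = 1 then u i else 0) * nit m t)) \<le> \<delta>"
  proof eventually_elim
    case (elim T)
    show ?case
    proof (intro ballI allI impI)
      fix i t M assume *: "i \<in> I" "t \<in> {0..T}" "\<kappa> * T powr \<beta> \<le> real M"
      hence "M \<ge> 1" using elim by linarith
      have "(\<Sum>m\<in>{1..M}. (if m = 1 then u i else 0) * nit m t) = (\<Sum>m\<in>{1..M}. if m = 1 then u i else 0)"
        by (intro sum.cong) auto
      also have "\<dots> = u i" using \<open>M \<ge> 1\<close> by (subst sum.delta) auto
      finally show "norm (u i - (\<Sum>m\<in>{1..M}. (if m = 1 then u i else 0) * nit m t)) \<le> \<delta>" using k by simp
    qed
  qed
qed (use assms in \<open>force+\<close>)

lemma dirichlet_approx_dilate: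
  assumes "dirichlet_approx \<alpha> \<beta> I f c" "n > 0" "\<alpha> > 0" "\<beta> > 0"
  shows "dirichlet_approx \<alpha> \<beta> I (\<lambda>i t. nit n t * f i t) (\<lambda>i m. if n dvd m then c i (m div n) else 0)"
proof -
  obtain C where C: "C \<ge> 0" "\<And>i m. i \<in> I \<Longrightarrow> m > 0 \<Longrightarrow> norm (c i m) \<le> C * real m powr -\<alpha>"
    by (rule dirichlet_approx_coeffE[OF assms(1)]) blast
  show ?thesis
  proof (rule dirichlet_approxI[of "C * real n powr \<alpha>"])
    fix i m assume im: "i \<in> I" "m > (0::nat)"
    show "norm (if n dvd m then c i (m div n) else 0) \<le> C * real n powr \<alpha> * real m powr -\<alpha>"
    proof (cases "n dvd m")
      case True
      then obtain k where k: "m = n * k" by auto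
      have "k > 0" using im k by (cases k) auto
      hence "norm (c i k) \<le> C * real k powr -\<alpha>" using C im by auto
      thus ?thesis using k \<open>n > 0\<close> \<open>k > 0\<close>
        by (simp add: powr_mult powr_minus field_simps)
    qed (use C in auto)
  next
    fix \<kappa> \<delta> :: real assume k: "\<kappa> > 0" "\<delta> > 0"
    \<comment> \<open>The dilated sum has length \<open>M div n\<close>, which exceeds M / n - 1.
      Halving the constant absorbs the 1 once \<kappa> times the power of T is at least 2 n.\<close>
    define \<kappa>' where "\<kappa>' = \<kappa> / (2 * real n)"
    have k': "\<kappa>' > 0" using k \<open>n > 0\<close> by (simp add: \<kappa>'_def)
    have "filterlim (\<lambda>T. \<kappa> * T powr \<beta>) at_top at_top"
      using k assms by real_asymp
    hence "\<forall>\<^sub>F T in at_top. \<kappa> * T powr \<beta> \<ge> 2 * real n" by (simp add: filterlim_at_top)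
    with dirichlet_approxD[OF assms(1) k' k(2)]
    show "\<forall>\<^sub>F T in at_top. \<forall>i\<in>I. \<forall>t\<in>{0..T}. \<forall>M. \<kappa> * T powr \<beta> \<le> real M \<longrightarrow>
        norm (nit n t * f i t - (\<Sum>m\<in>{1..M}. (if n dvd m then c i (m div n) else 0) * nit m t)) \<le> \<delta>"
    proof eventually_elim
      case (elim T)
      show ?case
      proof (intro ballI allI impI)
        fix i t M assume *: "i \<in> I" "t \<in> {0..T}" "\<kappa> * T powr \<beta> \<le> real M"
        define K where "K = M div n"
        have "real M / real n - 1 \<le> real K"
        proof -
          have "M < K * n + n" unfolding K_def using dividend_less_times_div[OF \<open>n > 0\<close>, of M] by (simp add: mult.commute)
          hence "real M < real (K * n + n)" by (simp only: of_nat_less_iff)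
          thus ?thesis using \<open>n > 0\<close> by (simp add: field_simps)
        qed
        moreover have "\<kappa>' * T powr \<beta> \<le> real M / real n - 1"
          using *(3) elim(2) \<open>n > 0\<close> by (simp add: \<kappa>'_def field_simps)
        ultimately have "norm (f i t - (\<Sum>m\<in>{1..K}. c i m * nit m t)) \<le> \<delta>"
          using elim(1) * by (meson order_trans)
        hence "norm (nit n t * (f i t - (\<Sum>m\<in>{1..K}. c i m * nit m t))) \<le> \<delta>"
          by (simp add: norm_mult)
        also have "nit n t * (f i t - (\<Sum>m\<in>{1..K}. c i m * nit m t))
           = nit n t * f i t - (\<Sum>k\<in>{1..K}. c i k * nit (n * k) t)"
          using \<open>n > 0\<close> by (simp add: right_diff_distrib sum_distrib_left nit_mult mult_ac)
        also have "(\<Sum>k\<in>{1..K}. c i k * nit (n * k) t) = (\<Sum>m\<in>{m\<in>{1..M}. n dvd m}. c i (m div n) * nit m t)"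
        proof (rule sum.reindex_bij_witness[of _ "\<lambda>m. m div n" "\<lambda>k. n * k"])
          fix k assume "k \<in> {1..K}"
          thus "n * k \<in> {m\<in>{1..M}. n dvd m}"
            using \<open>n > 0\<close> by (auto simp: K_def less_eq_div_iff_mult_less_eq mult.commute)
        next
          fix m assume "m \<in> {m\<in>{1..M}. n dvd m}"
          thus "m div n \<in> {1..K}"
            using \<open>n > 0\<close> by (auto simp: K_def intro!: div_le_mono)
        qed (use \<open>n > 0\<close> in auto)
        also have "\<dots> = (\<Sum>m\<in>{1..M}. if n dvd m then c i (m div n) * nit m t else 0)"
          by (rule sum.inter_filter) auto
        also have "\<dots> = (\<Sum>m\<in>{1..M}. (if n dvd m then c i (m div n) else 0) * nit m t)"
          by (intro sum.cong) auto
        finally show "norm (nit n t * f i t - (\<Sum>m\<in>{1..M}. (if n dvd m then c i (m div n) else 0) * nit m t)) \<le> \<delta>" .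
      qed
    qed
  qed (use C in auto)
qed

lemma dirichlet_approx_sum:
  assumes "finite A" "\<And>n. n \<in> A \<Longrightarrow> dirichlet_approx \<alpha> \<beta> I (f n) (c n)" "\<beta> > 0"
  shows "dirichlet_approx \<alpha> \<beta> I (\<lambda>i t. \<Sum>n\<in>A. f n i t) (\<lambda>i m. \<Sum>n\<in>A. c n i m)"
  using assms(1,2)
proof (induction A)
  case empty
  show ?case using dirichlet_approx_const[of I "\<lambda>_. 0" 0 \<beta> \<alpha>] assms(3) by simp
next
  case (insert x A)
  have "dirichlet_approx \<alpha> \<beta> I (\<lambda>i t. f x i t + (\<Sum>n\<in>A. f n i t)) (\<lambda>i m. c x i m + (\<Sum>n\<in>A. c n i m))"
    using insert by (intro dirichlet_approx_add) auto
  thus ?case using insert by simp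
qed

text \<open>The approximation error is uniformly small, hence negligible in mean square. For the
  Dirichlet polynomial the diagonal contributes at most V T, and the other terms a power of T with
  exponent below 1 by the condition on \<alpha> and \<beta>.\<close>

lemma mean_square_le:
  assumes da: "dirichlet_approx \<alpha> \<beta> I f c"
    and ab: "1/2 < \<alpha>" "\<alpha> < 1" "0 < \<beta>" "(2 - 2 * \<alpha>) * \<beta> < 1"
    and cont: "\<And>i. i \<in> I \<Longrightarrow> continuous_on UNIV (f i)"
    and V: "\<And>i M. i \<in> I \<Longrightarrow> (\<Sum>m\<in>{1..M}. norm (c i m)^2) \<le> V" "V \<ge> 0"
    and "\<delta> > 0"
  shows "\<forall>\<^sub>F T in at_top. \<forall>i\<in>I. integral {0..T} (\<lambda>t. norm (f i t)^2) \<le> (V + \<delta>) * T"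
proof -
  obtain C where C: "C \<ge> 0" "\<And>i m. i \<in> I \<Longrightarrow> m > 0 \<Longrightarrow> norm (c i m) \<le> C * real m powr -\<alpha>"
    by (rule dirichlet_approx_coeffE[OF da]) blast
  \<comment> \<open>A third of \<open>\<delta>\<close> each is spent on the factor 1 + \<eta> in
    front of V, on the approximation error \<open>\<delta>1\<close>, and on the off-diagonal
    terms.\<close>
  define \<eta> where "\<eta> = \<delta> / (3 * (V + 1))"
  have eta: "\<eta> > 0" "\<eta> * V \<le> \<delta> / 3"
    using V assms by (auto simp: \<eta>_def field_simps)
  define \<delta>1 where "\<delta>1 = sqrt (\<delta> / (3 * (1 + 1 / \<eta>)))"
  have d1: "\<delta>1 > 0" using eta assms by (simp add: \<delta>1_def add_pos_pos)
  have d1': "(1 + 1 / \<eta>) * \<delta>1 ^ 2 = \<delta> / 3"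
  proof -
    have "1 + 1 / \<eta> > 0" using eta by (simp add: add_pos_pos)
    hence "\<delta>1 ^ 2 = \<delta> / (3 * (1 + 1 / \<eta>))" using \<open>\<delta> > 0\<close> by (simp add: \<delta>1_def)
    moreover have "x * (\<delta> / (3 * x)) = \<delta> / 3" if "x > 0" for x :: real using that by simp
    ultimately show ?thesis using \<open>1 + 1 / \<eta> > 0\<close> by metis
  qed
  \<comment> \<open>Uses half of the room that the assumption (2 - 2\<alpha>) \<beta> < 1
    leaves.\<close>
  define th where "th = min (1/2) ((1 / \<beta> - (2 - 2 * \<alpha>)) / 2)"
  have "(2 - 2 * \<alpha>) < 1 / \<beta>" using ab by (simp add: field_simps)
  hence th: "0 < th" "th < 1" and th2: "2 - 2 * \<alpha> + th < 1 / \<beta>"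
    by (auto simp: th_def min_def field_simps)
  hence ex: "(2 - 2 * \<alpha> + th) * \<beta> < 1" using ab by (simp add: field_simps)
  define K where "K = 8 * C^2 / (th * (1 - \<alpha>)) * 2 powr (2 - 2 * \<alpha> + th)"
  have K: "K \<ge> 0" using th ab by (simp add: K_def)
  have "((\<lambda>T. (1 + \<eta>) * (K * T powr ((2 - 2 * \<alpha> + th) * \<beta> - 1))) \<longlongrightarrow> (1 + \<eta>) * (K * 0)) at_top"
    using ex by (intro tendsto_intros tendsto_neg_powr filterlim_ident) auto
  hence ev: "\<forall>\<^sub>F T in at_top. (1 + \<eta>) * (K * T powr ((2 - 2 * \<alpha> + th) * \<beta> - 1)) < \<delta> / 3"
    by (rule order_tendstoD) (use assms in auto)
  have ev1: "\<forall>\<^sub>F T in at_top. T powr \<beta> \<ge> 1"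
    using eventually_ge_at_top[of "1::real"] by eventually_elim (use ab in \<open>auto intro: ge_one_powr_ge_zero\<close>)
  show ?thesis
    using dirichlet_approxD[OF da zero_less_one d1] ev ev1 eventually_gt_at_top[of "0::real"]
  proof eventually_elim
    case (elim T)
    show ?case
    proof
      fix i assume i: "i \<in> I"
      define M where "M = nat \<lceil>T powr \<beta>\<rceil>"
      have M: "real M \<ge> T powr \<beta>" "real M \<le> 2 * T powr \<beta>"
        using elim(3) unfolding M_def by linarith+
      define S where "S = (\<lambda>t. \<Sum>m\<in>{1..M}. c i m * nit m t)"
      have contS: "continuous_on A S" for A unfolding S_def by (intro continuous_intros)
      have contf: "continuous_on A (f i)" for A using cont[OF i] continuous_on_subset by blast
      have le: "norm (f i t)^2 \<le> (1 + \<eta>) * norm (S t)^2 + \<delta> / 3" if "t \<in> {0..T}" for t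
      proof -
        have e: "norm (f i t - S t) \<le> \<delta>1"
          using elim(1) i that M unfolding S_def by auto
        have "norm (f i t) \<le> norm (S t) + norm (f i t - S t)" by (rule norm_triangle_sub)
        also have "\<dots> \<le> norm (S t) + \<delta>1" using e by simp
        finally have "norm (f i t)^2 \<le> (norm (S t) + \<delta>1)^2" by (intro power_mono) auto
        \<comment> \<open>The square of a sum with unequal weights, so that the constant in front of
          the main part stays close to 1.\<close>
        also have "\<dots> \<le> (1 + \<eta>) * norm (S t)^2 + (1 + 1 / \<eta>) * \<delta>1^2"
        proof -
          have "0 \<le> (\<eta> * norm (S t) - \<delta>1)^2 / \<eta>" using eta by simp
          also have "\<dots> = \<eta> * norm (S t)^2 - 2 * norm (S t) * \<delta>1 + \<delta>1^2 / \<eta>"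
            using eta by (simp add: power2_eq_square field_simps)
          finally show ?thesis by (simp add: power2_eq_square algebra_simps)
        qed
        finally show ?thesis unfolding d1' .
      qed
      have "integral {0..T} (\<lambda>t. norm (f i t)^2) \<le> integral {0..T} (\<lambda>t. (1 + \<eta>) * norm (S t)^2 + \<delta> / 3)"
        using le by (intro integral_le integrable_continuous_interval continuous_intros contS contf) auto
      also have "\<dots> = (1 + \<eta>) * integral {0..T} (\<lambda>t. norm (S t)^2) + \<delta> / 3 * T"
      proof -
        have "((\<lambda>t. (1 + \<eta>) * norm (S t)^2 + \<delta> / 3) has_integral
           (1 + \<eta>) * integral {0..T} (\<lambda>t. norm (S t)^2) + (T - 0) *\<^sub>R (\<delta> / 3)) {0..T}"
          using elim by (intro has_integral_add has_integral_mult_right integrable_integral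
             integrable_continuous_interval continuous_intros contS has_integral_const_real) 
             (use has_integral_const_real[of "\<delta> / 3" 0 T] in simp)
        thus ?thesis by (simp add: integral_unique mult.commute)
      qed
      also have "integral {0..T} (\<lambda>t. norm (S t)^2) \<le> V * T + K * T powr ((2 - 2 * \<alpha> + th) * \<beta>)"
      proof -
        have "\<bar>integral {0..T} (\<lambda>t. norm (S t)^2) - T * (\<Sum>m\<in>{1..M}. norm (c i m)^2)\<bar>
           \<le> 8 * C^2 / (th * (1 - \<alpha>)) * real M powr (2 - 2 * \<alpha> + th)"
          unfolding S_def using i C ab th elim by (intro mean_square_dirichlet_poly_powr) auto
        also have "real M powr (2 - 2 * \<alpha> + th) \<le> (2 * T powr \<beta>) powr (2 - 2 * \<alpha> + th)"
          using M ab th by (intro powr_mono2) auto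
        also have "\<dots> = 2 powr (2 - 2 * \<alpha> + th) * T powr ((2 - 2 * \<alpha> + th) * \<beta>)"
          by (simp add: powr_mult powr_powr mult.commute)
        finally have "\<bar>integral {0..T} (\<lambda>t. norm (S t)^2) - T * (\<Sum>m\<in>{1..M}. norm (c i m)^2)\<bar>
           \<le> K * T powr ((2 - 2 * \<alpha> + th) * \<beta>)"
          unfolding K_def using th ab by (simp add: mult_left_mono mult.assoc divide_right_mono)
        moreover have "T * (\<Sum>m\<in>{1..M}. norm (c i m)^2) \<le> T * V"
          using V(1)[OF i, of M] elim by (intro mult_left_mono) auto
        ultimately show ?thesis by (simp add: mult.commute abs_le_iff)
      qed
      also have "T powr ((2 - 2 * \<alpha> + th) * \<beta>) = T * T powr ((2 - 2 * \<alpha> + th) * \<beta> - 1)"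
        using elim by (simp add: powr_diff)
      also have "(1 + \<eta>) * (V * T + K * (T * T powr ((2 - 2 * \<alpha> + th) * \<beta> - 1))) + \<delta> / 3 * T
         = T * (V + \<eta> * V + (1 + \<eta>) * (K * T powr ((2 - 2 * \<alpha> + th) * \<beta> - 1)) + \<delta> / 3)"
        by (simp add: algebra_simps)
      also have "\<dots> \<le> T * (V + \<delta> / 3 + \<delta> / 3 + \<delta> / 3)"
        using eta elim by (intro mult_left_mono add_mono) auto
      finally show "integral {0..T} (\<lambda>t. norm (f i t)^2) \<le> (V + \<delta>) * T"
        using eta by (simp add: mult_left_mono mult_ac add.commute)
    qed
  qed
qed

lemma dirichlet_approx_eta:
  assumes a: "0 < \<alpha>" and b: "\<beta> > 1"
    and I: "\<And>s. s \<in> I \<Longrightarrow> Re s \<ge> \<alpha>" "\<And>s. s \<in> I \<Longrightarrow> norm s \<le> B"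
  shows "dirichlet_approx \<alpha> \<beta> I (\<lambda>s t. eta (s + \<i> * of_real t)) (\<lambda>s m. alt m * of_nat m powr (- s))"
proof (rule dirichlet_approxI[of 1])
  fix s m assume "s \<in> I" "m > (0::nat)"
  thus "norm (alt m * of_nat m powr (- s)) \<le> 1 * real m powr -\<alpha>"
    using I by (auto simp: norm_mult norm_powr_real_powr intro!: powr_mono)
next
  fix \<kappa> \<delta> :: real assume k: "\<kappa> > 0" "\<delta> > 0"
  \<comment> \<open>Chosen so that k + \<beta>(2 - k) < 0: this is the exponent of T in the
    remainder of Euler's transformation when M is about T^\<beta>.\<close>
  define k where "k = nat \<lceil>2 * \<beta> / (\<beta> - 1)\<rceil> + 2"
  have k2: "k \<ge> 2" by (simp add: k_def)
  have "real k > 2 * \<beta> / (\<beta> - 1)" unfolding k_def by linarith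
  hence kb: "real k - \<beta> * (real k - 2) < 0" using b by (simp add: field_simps)
  define Q where "Q = (\<Sum>n. 1 / real (Suc n)^2)"
  have Q: "Q \<ge> 0" unfolding Q_def 
    by (intro suminf_nonneg) (use inverse_squares_sums in \<open>auto simp: sums_iff add.commute\<close>)
  define R where "R = Q * 2 ^ k * \<kappa> powr (2 - real k)"
  have "((\<lambda>T. real k * (\<kappa> powr -\<alpha> * T powr (-(\<beta> * \<alpha>))) + R * T powr (real k - \<beta> * (real k - 2))) \<longlongrightarrow> real k * (\<kappa> powr -\<alpha> * 0) + R * 0) at_top"
    using kb a b by (intro tendsto_intros tendsto_neg_powr filterlim_ident) auto
  hence ev1: "\<forall>\<^sub>F T in at_top. real k * (\<kappa> powr -\<alpha> * T powr (-(\<beta> * \<alpha>))) + R * T powr (real k - \<beta> * (real k - 2)) < \<delta>"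
    by (rule order_tendstoD) (use k in auto)
  have "filterlim (\<lambda>T. \<kappa> * T powr (\<beta> - 1)) at_top at_top"
    using k b by real_asymp
  hence ev2: "\<forall>\<^sub>F T in at_top. \<kappa> * T powr (\<beta> - 1) \<ge> 2" by (simp add: filterlim_at_top)
  show "\<forall>\<^sub>F T in at_top. \<forall>s\<in>I. \<forall>t\<in>{0..T}. \<forall>M. \<kappa> * T powr \<beta> \<le> real M \<longrightarrow>
        norm (eta (s + \<i> * of_real t) - (\<Sum>m\<in>{1..M}. alt m * of_nat m powr (- s) * nit m t)) \<le> \<delta>"
    using ev1 ev2 eventually_ge_at_top[of "B + real k"] eventually_ge_at_top[of 1]
  proof eventually_elim
    case (elim T)
    show ?case
    proof (intro ballI allI impI)
      fix s t M assume *: "s \<in> I" "t \<in> {0..T}" "\<kappa> * T powr \<beta> \<le> real M"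
      have TT: "\<kappa> * T powr \<beta> \<ge> 2 * T"
        using elim mult_right_mono[OF elim(2), of T] by (simp add: powr_diff)
      define s' where "s' = s + \<i> * of_real t"
      \<comment> \<open>The approximation is applied with \<open>Y = 2 * T\<close>, which bounds |s
        + it| + k once T \<ge> B + k. Its sum omits the upper end, hence the successor.\<close>
      define M' where "M' = Suc M"
      have M': "real M' \<ge> \<kappa> * T powr \<beta>" "M' > 0" using * by (auto simp: M'_def)
      have "norm (eta s' - (\<Sum>n\<in>{1..<M'}. alt n * of_nat n powr (- s')))
           \<le> k * M' powr (-\<alpha>) + (\<Sum>n. 1 / real (Suc n)^2) * (2 * T) ^ k * M' powr (2 - real k)"
      proof (rule norm_eta_minus_sum_le)
        have "norm s' \<le> norm s + norm (\<i> * of_real t)" unfolding s'_def by (rule norm_triangle_ineq)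
        also have "\<dots> \<le> B + T" using * I by (intro add_mono) (auto simp: norm_mult)
        finally show "norm s' + real k \<le> 2 * T" using elim by simp
      qed (use * I a k2 M' TT elim in \<open>auto simp: s'_def\<close>)
      also have "\<dots> \<le> real k * (\<kappa> * T powr \<beta>) powr (-\<alpha>) + Q * (2 * T) ^ k * (\<kappa> * T powr \<beta>) powr (2 - real k)"
        unfolding Q_def[symmetric] using M' a k2 Q elim k
        by (intro add_mono mult_left_mono powr_mono2') auto
      also have "\<dots> = real k * (\<kappa> powr -\<alpha> * T powr (-(\<beta> * \<alpha>))) + R * (T powr real k * T powr (\<beta> * (2 - real k)))"
        using elim k by (simp add: powr_mult powr_powr R_def power_mult_distrib powr_realpow mult_ac)
      also have "T powr real k * T powr (\<beta> * (2 - real k)) = T powr (real k - \<beta> * (real k - 2))"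
        by (simp add: algebra_simps flip: powr_add)
      also have "real k * (\<kappa> powr -\<alpha> * T powr (-(\<beta> * \<alpha>))) + R * T powr (real k - \<beta> * (real k - 2)) \<le> \<delta>"
        using elim by simp
      finally have "norm (eta s' - (\<Sum>n\<in>{1..<M'}. alt n * of_nat n powr (- s'))) \<le> \<delta>" .
      moreover have "(\<Sum>n\<in>{1..<M'}. alt n * of_nat n powr (- s')) = (\<Sum>m\<in>{1..M}. alt m * of_nat m powr (- s) * nit m t)"
        unfolding s'_def M'_def
      proof (rule sum.cong)
        fix m assume "m \<in> {1..M}"
        hence "m > 0" by simp
        thus "alt m * of_nat m powr (- (s + \<i> * of_real t)) = alt m * of_nat m powr (- s) * nit m t"
          by (simp only: powr_shift_eq_nit mult.assoc)
      qed auto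
      ultimately show "norm (eta (s + \<i> * of_real t) - (\<Sum>m\<in>{1..M}. alt m * of_nat m powr (- s) * nit m t)) \<le> \<delta>"
        by (simp add: s'_def)
    qed
  qed
qed simp

section \<open>Elementary symmetric functions and power sums\<close>

text \<open>Newton's identities, solved for the elementary symmetric function of index n, serve as
  the definition. The argument is the sequence of power sums, so that values of \<zeta> can be
  inserted without any underlying variables.\<close>

function esym :: "nat \<Rightarrow> (nat \<Rightarrow> 'a :: field_char_0) \<Rightarrow> 'a" where
  "esym 0 p = 1"
| "esym (Suc n) p = (\<Sum>i\<le>n. (-1) ^ i * p (Suc i) * esym (n - i) p) / of_nat (Suc n)"
  by pat_completeness auto
termination by (relation "Wellfounded.measure fst") auto

declare esym.simps(2) [simp del]

lemma esym_cong:
  "(\<And>i. 1 \<le> i \<Longrightarrow> i \<le> n \<Longrightarrow> p i = q i) \<Longrightarrow> esym n p = esym n q"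
proof (induction n rule: less_induct)
  case (less n)
  show ?case
  proof (cases n)
    case (Suc m)
    have "(\<Sum>i\<le>m. (-1) ^ i * p (Suc i) * esym (m - i) p) = (\<Sum>i\<le>m. (-1) ^ i * q (Suc i) * esym (m - i) q)"
    proof (intro sum.cong refl arg_cong2[of _ _ _ _ "(*)"])
      fix i assume "i \<in> {..m}"
      thus "p (Suc i) = q (Suc i)" using Suc by (intro less.prems) auto
      show "esym (m - i) p = esym (m - i) q"
        using Suc by (intro less.IH less.prems) auto
    qed
    thus ?thesis using Suc by (simp add: esym.simps)
  qed auto
qed

text \<open>Homogeneity of weight n when the k-th power sum has weight k. With c = 1 - 2^(1-s) this
  will clear the pole that \<zeta>(s) brings in.\<close>

lemma esym_scale: "esym n (\<lambda>i. c ^ i * p i) = c ^ n * esym n p"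
proof (induction n rule: less_induct)
  case (less n)
  show ?case
  proof (cases n)
    case (Suc m)
    have "(\<Sum>i\<le>m. (-1) ^ i * (c ^ Suc i * p (Suc i)) * esym (m - i) (\<lambda>i. c ^ i * p i))
       = (\<Sum>i\<le>m. c ^ Suc m * ((-1) ^ i * p (Suc i) * esym (m - i) p))"
    proof (intro sum.cong refl)
      fix i assume i: "i \<in> {..m}"
      have "esym (m - i) (\<lambda>i. c ^ i * p i) = c ^ (m - i) * esym (m - i) p"
        using Suc by (intro less.IH) auto
      moreover have "c ^ Suc m = c ^ Suc i * c ^ (m - i)" using i by (simp flip: power_add)
      ultimately have "(-1) ^ i * (c ^ Suc i * p (Suc i)) * esym (m - i) (\<lambda>i. c ^ i * p i) = (c ^ Suc i * c ^ (m - i)) * ((-1) ^ i * p (Suc i) * esym (m - i) p)"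
        by (simp only: mult_ac)
      thus "(-1) ^ i * (c ^ Suc i * p (Suc i)) * esym (m - i) (\<lambda>i. c ^ i * p i) = c ^ Suc m * ((-1) ^ i * p (Suc i) * esym (m - i) p)"
        using \<open>c ^ Suc m = c ^ Suc i * c ^ (m - i)\<close> by (simp only:)
    qed
    thus ?thesis using Suc by (simp add: esym.simps sum_distrib_left del: power_Suc)
  qed auto
qed

lemma esym_holomorphic:
  assumes "\<And>i. 1 \<le> i \<Longrightarrow> i \<le> n \<Longrightarrow> p i holomorphic_on A"
  shows "(\<lambda>z. esym n (\<lambda>i. p i z)) holomorphic_on A"
  using assms
proof (induction n rule: less_induct)
  case (less n)
  show ?case
  proof (cases n)
    case (Suc m)
    show ?thesis unfolding Suc esym.simps
      by (intro holomorphic_intros less.prems less.IH) (use Suc in \<open>auto simp del: of_nat_Suc\<close>)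
  qed auto
qed

lemma esym_meromorphic:
  assumes "\<And>i. 1 \<le> i \<Longrightarrow> i \<le> n \<Longrightarrow> p i meromorphic_on A"
  shows "(\<lambda>z. esym n (\<lambda>i. p i z)) meromorphic_on A"
  using assms
proof (induction n rule: less_induct)
  case (less n)
  show ?case
  proof (cases n)
    case (Suc m)
    show ?thesis unfolding Suc esym.simps
      by (intro meromorphic_intros less.prems less.IH) (use Suc in auto)
  qed auto
qed

lemma esym_tendsto:
  fixes p :: "'a \<Rightarrow> nat \<Rightarrow> complex"
  assumes "\<And>i. 1 \<le> i \<Longrightarrow> i \<le> n \<Longrightarrow> ((\<lambda>x. p x i) \<longlongrightarrow> q i) F"
  shows "((\<lambda>x. esym n (p x)) \<longlongrightarrow> esym n q) F"
  using assms
proof (induction n rule: less_induct)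
  case (less n)
  show ?case
  proof (cases n)
    case (Suc m)
    show ?thesis unfolding Suc esym.simps
      by (intro tendsto_intros less.prems less.IH) (use Suc in \<open>auto simp del: of_nat_Suc\<close>)
  qed auto
qed

text \<open>The first power sum is kept apart from the others because in the application it is the
  only one without an a priori bound.\<close>

lemma norm_esym_le:
  fixes p :: "nat \<Rightarrow> complex"
  assumes "B \<ge> 1" "\<And>i. 2 \<le> i \<Longrightarrow> i \<le> n \<Longrightarrow> norm (p i) \<le> B"
  shows "norm (esym n p) \<le> (B * (1 + norm (p 1))) ^ n"
  using assms(2)
proof (induction n rule: less_induct)
  case (less n)
  define X where "X = B * (1 + norm (p 1))"
  have "1 * 1 \<le> X" unfolding X_def using assms by (intro mult_mono) auto
  hence X: "X \<ge> 1" by simp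
  have BX: "B \<le> X" using assms by (simp add: X_def mult_le_cancel_left1)
  have pX: "norm (p 1) \<le> X"
  proof -
    have "norm (p 1) \<le> 1 * (1 + norm (p 1))" by simp
    also have "\<dots> \<le> X" unfolding X_def using assms by (intro mult_right_mono) auto
    finally show ?thesis .
  qed
  show ?case
  proof (cases n)
    case (Suc m)
    have "norm (\<Sum>i\<le>m. (-1) ^ i * p (Suc i) * esym (m - i) p) \<le> (\<Sum>i\<le>m. X ^ Suc m)"
    proof (intro sum_norm_le)
      fix i assume i: "i \<in> {..m}"
      have "norm (p (Suc i)) \<le> X"
        using less.prems[of "Suc i"] i Suc pX BX by (cases "i = 0") force+
      moreover have "norm (esym (m - i) p) \<le> X ^ (m - i)"
        unfolding X_def using i Suc by (intro less.IH less.prems) auto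
      moreover have "X ^ (m - i) \<le> X ^ m" using X by (intro power_increasing) auto
      ultimately have "norm (p (Suc i)) * norm (esym (m - i) p) \<le> X * X ^ m"
        using X by (intro mult_mono) auto
      thus "norm ((-1) ^ i * p (Suc i) * esym (m - i) p) \<le> X ^ Suc m"
        by (simp add: norm_mult norm_power)
    qed
    also have "\<dots> = real (Suc m) * X ^ Suc m" by simp
    finally show ?thesis unfolding X_def[symmetric] Suc esym.simps norm_divide norm_of_nat
      by (simp add: pos_divide_le_eq mult.commute del: power_Suc)
  qed auto
qed

section \<open>Elementary symmetric functions as polynomials in the first power sum\<close>

function esym_poly :: "nat \<Rightarrow> (nat \<Rightarrow> complex) \<Rightarrow> complex poly" where
  "esym_poly 0 p = 1"
| "esym_poly (Suc n) p = smult (1 / of_nat (Suc n))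
     (\<Sum>i\<le>n. smult ((-1) ^ i) ((if i = 0 then [:0, 1:] else [:p (Suc i):]) * esym_poly (n - i) p))"
  by pat_completeness auto
termination by (relation "Wellfounded.measure fst") auto

declare esym_poly.simps(2) [simp del]

lemma poly_esym_poly: "poly (esym_poly n p) x = esym n (p(1 := x))"
proof (induction n rule: less_induct)
  case (less n)
  show ?case
  proof (cases n)
    case (Suc m)
    define q where "q = p(1 := x)"
    have IH: "poly (esym_poly (m - i) p) x = esym (m - i) q" for i
      unfolding q_def using Suc by (intro less.IH) auto
    have "poly (esym_poly (Suc m) p) x = 1 / of_nat (Suc m) * (\<Sum>i\<le>m. (-1) ^ i * (poly (if i = 0 then [:0, 1:] else [:p (Suc i):]) x * esym (m - i) q))"
      unfolding esym_poly.simps by (simp add: poly_sum IH)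
    also have "\<dots> = 1 / of_nat (Suc m) * (\<Sum>i\<le>m. (-1) ^ i * q (Suc i) * esym (m - i) q)"
      by (rule arg_cong[where f = "\<lambda>S. 1 / of_nat (Suc m) * S"], intro sum.cong refl) (auto simp: q_def)
    also have "\<dots> = esym (Suc m) q" by (simp add: esym.simps)
    also have "q = p(1 := x)" by (simp add: q_def)
    finally show ?thesis using Suc by simp
  qed auto
qed

text \<open>The generating function is exp of the sum of (-1)^(k-1) p_k z^k / k, so differentiation
  in p_1 multiplies it by z and lowers the index by one. The induction verifies this from Newton's
  recursion.\<close>

lemma pderiv_esym_poly:
  "pderiv (esym_poly (Suc n) p) = esym_poly n p"
proof (induction n rule: less_induct)
  case (less n)
  have d: "pderiv (esym_poly (n - i) p) = (if i < n then esym_poly (n - Suc i) p else 0)" if "i \<le> n" for i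
  proof (cases "i < n")
    case True
    hence "n - i = Suc (n - Suc i)" by simp
    thus ?thesis using True less.IH[of "n - Suc i"] by (simp only: if_True)
  qed (use that in auto)
  have "smult (of_nat (Suc n)) (pderiv (esym_poly (Suc n) p)) =
     (\<Sum>i\<le>n. smult ((-1) ^ i) (pderiv ((if i = 0 then [:0, 1:] else [:p (Suc i):]) * esym_poly (n - i) p)))"
    unfolding esym_poly.simps pderiv_smult higher_pderiv_sum[of 1, simplified] smult_smult by (simp only: nonzero_mult_div_cancel_left of_nat_neq_0 times_divide_eq_right mult_1_right div_self smult_1_left not_False_eq_True)
  also have "\<dots> = (\<Sum>i\<le>n. (if i = 0 then esym_poly n p else 0) + (if i < n then
      smult ((-1) ^ i) ((if i = 0 then [:0, 1:] else [:p (Suc i):]) * esym_poly (n - Suc i) p) else 0))"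
    by (intro sum.cong refl) (auto simp: pderiv_mult d pderiv_pCons)
  also have "\<dots> = esym_poly n p + (\<Sum>i\<in>{..n}. if i < n then
      smult ((-1) ^ i) ((if i = 0 then [:0, 1:] else [:p (Suc i):]) * esym_poly (n - Suc i) p) else 0)"
    by (simp add: sum.distrib)
  also have "(\<Sum>i\<in>{..n}. if i < n then
      smult ((-1) ^ i) ((if i = 0 then [:0, 1:] else [:p (Suc i):]) * esym_poly (n - Suc i) p) else 0)
     = smult (of_nat n) (esym_poly n p)"
  proof (cases n)
    case (Suc m)
    have "(\<Sum>i\<in>{..n}. if i < n then
      smult ((-1) ^ i) ((if i = 0 then [:0, 1:] else [:p (Suc i):]) * esym_poly (n - Suc i) p) else 0)
      = (\<Sum>i\<in>{..m}. smult ((-1) ^ i) ((if i = 0 then [:0, 1:] else [:p (Suc i):]) * esym_poly (m - i) p))"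
      unfolding Suc by (intro sum.mono_neutral_cong_right) auto
    thus ?thesis unfolding Suc esym_poly.simps smult_smult by (simp only: nonzero_mult_div_cancel_left of_nat_neq_0 times_divide_eq_right mult_1_right div_self smult_1_left not_False_eq_True)
  qed auto
  also have "esym_poly n p + smult (of_nat n) (esym_poly n p) = smult (of_nat (Suc n)) (esym_poly n p)"
    by (simp add: smult_add_left)
  finally show ?case by (metis smult_cancel of_nat_neq_0)
qed

lemma coeff_esym_poly:
  "coeff (esym_poly n p) k = (if k \<le> n then esym (n - k) (p(1 := 0)) / fact k else 0)"
proof (induction k arbitrary: n)
  case 0
  show ?case using poly_esym_poly[of n p 0] by (simp add: poly_0_coeff_0)
next
  case (Suc k)
  show ?case
  proof (cases n)
    case (Suc m)
    have "of_nat (Suc k) * coeff (esym_poly (Suc m) p) (Suc k) = coeff (esym_poly m p) k"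
      by (simp only: coeff_pderiv [symmetric] pderiv_esym_poly)
    hence "coeff (esym_poly (Suc m) p) (Suc k) = coeff (esym_poly m p) k / of_nat (Suc k)"
      by (simp add: field_simps del: of_nat_Suc)
    moreover define q where "q = p(1 := 0)"
    ultimately show ?thesis using Suc.IH[of m] unfolding Suc q_def[symmetric] by (simp add: mult.commute)
  qed auto
qed

lemma degree_esym_poly: "degree (esym_poly n p) = n"
proof (rule antisym)
  show "degree (esym_poly n p) \<le> n" by (rule degree_le) (auto simp: coeff_esym_poly)
  show "n \<le> degree (esym_poly n p)" by (rule le_degree) (simp add: coeff_esym_poly)
qed

text \<open>If 0 were the only root, the polynomial would be a monomial of degree n; but its
  coefficient of index n - 2 is -p_2 / 2 divided by (n - 2)!, which is not 0. The root must differ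
  from 0 because later it has to be a value of the exponential function.\<close>

lemma esym_nonzero_root:
  fixes p :: "nat \<Rightarrow> complex"
  assumes "n \<ge> 2" "p 2 \<noteq> 0"
  obtains x where "x \<noteq> 0" "esym n (p(1 := x)) = 0"
proof -
  let ?P = "esym_poly n p"
  have nz: "?P \<noteq> 0" using degree_esym_poly[of n p] assms by force
  have c: "coeff ?P (n - 2) \<noteq> 0"
  proof -
    have "esym 2 (p(1 := 0)) = - p 2 / 2"
      by (simp add: numeral_2_eq_2 esym.simps)
    thus ?thesis using assms by (simp add: coeff_esym_poly)
  qed
  from order_decomp[OF nz, of 0] obtain Q where Q: "?P = [:-0, 1:] ^ order 0 ?P * Q" "\<not> [:-0, 1:] dvd Q" by blast
  have "degree Q \<noteq> 0"
  proof
    assume "degree Q = 0"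
    then obtain q where q: "Q = [:q:]" by (rule degree_eq_zeroE)
    have m: "?P = monom q (order 0 ?P)" using Q(1) q by (simp add: monom_altdef)
    hence "order 0 ?P = n" using nz degree_esym_poly[of n p] by (metis degree_monom_eq monom_eq_0)
    hence "coeff ?P (n - 2) = 0" using m assms by (metis coeff_monom diff_less less_irrefl_nat pos2 zero_less_numeral order_less_le_trans)
    thus False using c by simp
  qed
  hence "\<not> constant (poly Q)" by (simp add: constant_degree)
  from Fundamental_Theorem_Algebra.fundamental_theorem_of_algebra[OF this] obtain x where x: "poly Q x = 0" by blast
  have "x \<noteq> 0" using x Q(2) by (auto simp: poly_eq_0_iff_dvd)
  moreover have "poly ?P x = 0" using x Q(1) by (metis mult_zero_right poly_mult)
  ultimately show ?thesis using that by (simp add: poly_esym_poly)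
qed

lemma esym_finite_roots:
  "n \<ge> 1 \<Longrightarrow> finite {x. esym n (p(1 := x)) = (0::complex)}"
  using poly_roots_finite[of "esym_poly n p"] degree_esym_poly[of n p]
  by (force simp: poly_esym_poly)

section \<open>Newton's identities for finitely many variables\<close>

fun fsym :: "nat \<Rightarrow> nat \<Rightarrow> (nat \<Rightarrow> 'a :: comm_ring_1) \<Rightarrow> 'a" where
  "fsym 0 N x = 1"
| "fsym (Suc r) 0 x = 0"
| "fsym (Suc r) (Suc N) x = fsym (Suc r) N x + x (Suc N) * fsym r N x"

text \<open>A new variable q changes e_r into e_r + q e_(r-1) and p_i into p_i + q^i. The powers of
  q contribute an alternating sum that collapses to q e_r (\<open>tel\<close>); the old power sums
  are covered by the induction hypothesis for two consecutive indices (\<open>old\<close>).\<close>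

lemma newton_fsym:
  "of_nat (Suc r) * fsym (Suc r) N x = (\<Sum>i\<le>r. (-1) ^ i * (\<Sum>n=1..N. x n ^ Suc i) * fsym (r - i) N x)"
proof (induction N arbitrary: r)
  case (Suc N)
  define q where "q = x (Suc N)"
  define e where "e = (\<lambda>r. fsym r N x)"
  define e' where "e' = (\<lambda>r. fsym r (Suc N) x)"
  define P where "P = (\<lambda>i. \<Sum>n=1..N. x n ^ Suc i)"
  have e'0: "e' 0 = e 0" and e'S: "e' (Suc r) = e (Suc r) + q * e r" for r
    by (simp_all add: e_def e'_def q_def)
  have e0: "e 0 = 1" by (simp add: e_def)
  have IH: "(\<Sum>i\<le>r. (-1) ^ i * P i * e (r - i)) = of_nat (Suc r) * e (Suc r)" for r
    using Suc.IH[of r] by (simp add: e_def P_def)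
  have tel: "(\<Sum>i\<le>r. (-1) ^ i * q ^ Suc i * e' (r - i)) = q * e r" for r
  proof (induction r)
    case (Suc r)
    have "(\<Sum>i\<le>Suc r. (-1) ^ i * q ^ Suc i * e' (Suc r - i)) = q * e' (Suc r) - q * (\<Sum>i\<le>r. (-1) ^ i * q ^ Suc i * e' (r - i))"
      by (subst sum.atMost_Suc_shift) (simp add: sum_distrib_left sum_negf mult_ac)
    thus ?case unfolding Suc e'S by (simp add: algebra_simps)
  qed (simp add: e'0 e0)
  have old: "(\<Sum>i\<le>r. (-1) ^ i * P i * e' (r - i)) = of_nat (Suc r) * e (Suc r) + q * (of_nat r * e r)"
  proof (cases r)
    case 0
    thus ?thesis using IH[of 0] by (simp add: e'0)
  next
    case (Suc m)
    have "(\<Sum>i\<le>r. (-1) ^ i * P i * e' (r - i)) = (\<Sum>i\<le>m. (-1) ^ i * P i * e' (r - i)) + (-1) ^ r * P r * e' 0"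
      unfolding Suc by simp
    also have "(\<Sum>i\<le>m. (-1) ^ i * P i * e' (r - i)) = (\<Sum>i\<le>m. (-1) ^ i * P i * e (r - i)) + q * (\<Sum>i\<le>m. (-1) ^ i * P i * e (m - i))"
      unfolding Suc sum_distrib_left sum.distrib [symmetric]
      by (intro sum.cong refl) (auto simp: Suc_diff_le e'S algebra_simps)
    also have "(\<Sum>i\<le>m. (-1) ^ i * P i * e (r - i)) = of_nat (Suc r) * e (Suc r) - (-1) ^ r * P r * e 0"
      using IH[of r] unfolding Suc by (simp add: algebra_simps)
    finally show ?thesis using IH[of m] by (simp add: e'0 Suc)
  qed
  have "(\<Sum>i\<le>r. (-1) ^ i * (\<Sum>n=1..Suc N. x n ^ Suc i) * fsym (r - i) (Suc N) x)
     = (\<Sum>i\<le>r. (-1) ^ i * P i * e' (r - i)) + (\<Sum>i\<le>r. (-1) ^ i * q ^ Suc i * e' (r - i))"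
    unfolding sum.distrib [symmetric] by (intro sum.cong refl) (simp add: P_def q_def e'_def algebra_simps)
  also have "\<dots> = of_nat (Suc r) * e' (Suc r)"
    unfolding tel old e'S by (simp add: algebra_simps)
  finally show ?case by (simp add: e'_def)
qed auto

lemma fsym_eq_esym:
  fixes x :: "nat \<Rightarrow> 'a :: field_char_0"
  shows "fsym r N x = esym r (\<lambda>k. \<Sum>n=1..N. x n ^ k)"
proof (induction r rule: less_induct)
  case (less r)
  show ?case
  proof (cases r)
    case (Suc m)
    have "of_nat (Suc m) * fsym (Suc m) N x = (\<Sum>i\<le>m. (-1) ^ i * (\<Sum>n=1..N. x n ^ Suc i) * fsym (m - i) N x)"
      by (rule newton_fsym)
    also have "\<dots> = (\<Sum>i\<le>m. (-1) ^ i * (\<Sum>n=1..N. x n ^ Suc i) * esym (m - i) (\<lambda>k. \<Sum>n=1..N. x n ^ k))"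
      using less Suc by (intro sum.cong refl) auto
    finally show ?thesis unfolding Suc esym.simps by (simp add: field_simps del: of_nat_Suc)
  qed auto
qed

text \<open>Every monomial on the left also occurs in the expanded power. This bounds the partial
  sums of the multiple series uniformly in N.\<close>

lemma fsym_le_power:
  assumes "\<And>n. x n \<ge> (0::real)"
  shows "fsym r N x \<le> (\<Sum>n=1..N. x n) ^ r"
proof (induction N arbitrary: r)
  case 0
  show ?case by (cases r) auto
next
  case (Suc N)
  define S where "S = (\<Sum>n=1..N. x n)"
  have S: "S \<ge> 0" unfolding S_def by (intro sum_nonneg assms)
  show ?case
  proof (cases r)
    case (Suc m)
    have "fsym r (Suc N) x = fsym (Suc m) N x + x (Suc N) * fsym m N x" using Suc by simp
    also have "\<dots> \<le> S ^ Suc m + x (Suc N) * S ^ m"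
      unfolding S_def by (intro add_mono mult_left_mono Suc.IH assms)
    also have "\<dots> = S ^ m * (S + x (Suc N))" by (simp add: algebra_simps)
    also have "\<dots> \<le> (S + x (Suc N)) ^ m * (S + x (Suc N))"
      using assms[of "Suc N"] S by (intro mult_right_mono power_mono) auto
    finally show ?thesis using Suc by (simp add: S_def mult.commute)
  qed auto
qed

section \<open>Summation over strictly decreasing tuples\<close>

definition decr_lists :: "nat \<Rightarrow> nat list set" where
  "decr_lists r = {ns. length ns = r \<and> sorted_wrt (>) ns \<and> (\<forall>n\<in>set ns. n > 0)}"

definition decr_lists_upto :: "nat \<Rightarrow> nat \<Rightarrow> nat list set" where
  "decr_lists_upto r N = {ns \<in> decr_lists r. \<forall>n\<in>set ns. n \<le> N}"

lemma decr_lists_upto_0 [simp]: "decr_lists_upto 0 N = {[]}"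
  by (auto simp: decr_lists_upto_def decr_lists_def)

lemma decr_lists_upto_Suc_0 [simp]: "decr_lists_upto (Suc r) 0 = {}"
  by (auto simp: decr_lists_upto_def decr_lists_def) (metis length_0_conv nat.distinct(1) list.set_intros(1) neq_Nil_conv less_irrefl_nat)

lemma Cons_mem_decr_lists_upto:
  "n # ns \<in> decr_lists_upto (Suc r) N \<longleftrightarrow> 0 < n \<and> n \<le> N \<and> ns \<in> decr_lists_upto r (n - 1)"
  by (cases n) (auto simp: decr_lists_upto_def decr_lists_def less_Suc_eq_le)

lemma decr_lists_upto_Suc_Suc:
  "decr_lists_upto (Suc r) (Suc N) = decr_lists_upto (Suc r) N \<union> (#) (Suc N) ` decr_lists_upto r N"
proof (intro set_eqI)
  fix ns
  show "ns \<in> decr_lists_upto (Suc r) (Suc N) \<longleftrightarrow> ns \<in> decr_lists_upto (Suc r) N \<union> (#) (Suc N) ` decr_lists_upto r N"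
  proof (cases ns)
    case Nil
    thus ?thesis by (auto simp: decr_lists_upto_def decr_lists_def)
  next
    case (Cons n ms)
    show ?thesis unfolding Cons Un_iff Cons_mem_decr_lists_upto by (auto simp: le_Suc_eq)
  qed
qed

lemma finite_decr_lists_upto [simp, intro]: "finite (decr_lists_upto r N)"
proof (rule finite_subset)
  show "decr_lists_upto r N \<subseteq> {ns. set ns \<subseteq> {0..N} \<and> length ns = r}"
    by (auto simp: decr_lists_upto_def decr_lists_def)
qed (intro finite_lists_length_eq, simp)

lemma sum_decr_lists_upto:
  fixes x :: "nat \<Rightarrow> 'a :: comm_ring_1"
  shows "(\<Sum>ns\<in>decr_lists_upto r N. prod_list (map x ns)) = fsym r N x"
proof (induction r N x rule: fsym.induct)
  case (3 r N x)
  have "(\<Sum>ns\<in>decr_lists_upto (Suc r) (Suc N). prod_list (map x ns))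
     = (\<Sum>ns\<in>decr_lists_upto (Suc r) N. prod_list (map x ns)) + (\<Sum>ns\<in>(#) (Suc N) ` decr_lists_upto r N. prod_list (map x ns))"
    unfolding decr_lists_upto_Suc_Suc
    by (rule sum.union_disjoint[OF finite_decr_lists_upto finite_imageI[OF finite_decr_lists_upto]])
       (auto simp: decr_lists_upto_def)
  also have "(\<Sum>ns\<in>(#) (Suc N) ` decr_lists_upto r N. prod_list (map x ns)) = x (Suc N) * (\<Sum>ns\<in>decr_lists_upto r N. prod_list (map x ns))"
    by (subst sum.reindex) (auto simp: sum_distrib_left)
  finally show ?case using 3 by simp
qed auto

lemma finite_subset_decr_lists:
  assumes "finite F" "F \<subseteq> decr_lists r"
  obtains N where "\<And>M. M \<ge> N \<Longrightarrow> F \<subseteq> decr_lists_upto r M"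
proof -
  have fin: "finite (\<Union>ns\<in>F. set ns)" using assms by auto
  show ?thesis
  proof (rule that[of "Max (insert 0 (\<Union>ns\<in>F. set ns))"])
    fix M assume M: "M \<ge> Max (insert 0 (\<Union>ns\<in>F. set ns))"
    have "n \<le> M" if "ns \<in> F" "n \<in> set ns" for ns n
      using Max_ge[of "insert 0 (\<Union>ns\<in>F. set ns)" n] fin that M by fastforce
    thus "F \<subseteq> decr_lists_upto r M" using assms by (auto simp: decr_lists_upto_def)
  qed
qed

lemma summable_on_decr_lists:
  fixes x :: "nat \<Rightarrow> real"
  assumes "\<And>n. x n \<ge> 0" "summable (\<lambda>n. x (Suc n))"
  shows "(\<lambda>ns. prod_list (map x ns)) summable_on decr_lists r"
proof (rule nonneg_bdd_above_summable_on)
  show "prod_list (map x ns) \<ge> 0" for ns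
    by (induction ns) (use assms in auto)
  define S where "S = (\<Sum>n. x (Suc n))"
  show "bdd_above (sum (\<lambda>ns. prod_list (map x ns)) ` {F. F \<subseteq> decr_lists r \<and> finite F})"
  proof (rule bdd_aboveI[of _ "S ^ r"])
    fix y assume "y \<in> sum (\<lambda>ns. prod_list (map x ns)) ` {F. F \<subseteq> decr_lists r \<and> finite F}"
    then obtain F where F: "F \<subseteq> decr_lists r" "finite F" and y: "y = (\<Sum>ns\<in>F. prod_list (map x ns))" by auto
    obtain N where N: "\<And>M. M \<ge> N \<Longrightarrow> F \<subseteq> decr_lists_upto r M"
      by (rule finite_subset_decr_lists[OF F(2,1)]) blast
    have "y \<le> (\<Sum>ns\<in>decr_lists_upto r N. prod_list (map x ns))"
      unfolding y using N[of N] by (intro sum_mono2) (auto intro: \<open>\<And>ns. prod_list (map x ns) \<ge> 0\<close>)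
    also have "\<dots> \<le> (\<Sum>n=1..N. x n) ^ r"
      unfolding sum_decr_lists_upto by (rule fsym_le_power) (use assms in auto)
    also have "(\<Sum>n=1..N. x n) = (\<Sum>n<N. x (Suc n))"
      by (rule sum.reindex_bij_witness[of _ Suc "\<lambda>n. n - 1"]) auto
    also have "\<dots> ^ r \<le> S ^ r"
      unfolding S_def using assms by (intro power_mono sum_le_suminf sum_nonneg) auto
    finally show "y \<le> S ^ r" by simp
  qed
qed

text \<open>The tuples with entries up to N form finite sets that eventually contain every finite
  set of tuples. Along this sequence the finite Newton identities hold, and they pass to the limit
  in each power sum.\<close>

lemma infsum_decr_lists:
  fixes x :: "nat \<Rightarrow> complex"
  assumes "summable (\<lambda>n. norm (x (Suc n)))"
  shows "(\<lambda>ns. norm (prod_list (map x ns))) summable_on decr_lists r"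
    and "infsum (\<lambda>ns. prod_list (map x ns)) (decr_lists r) = esym r (\<lambda>k. \<Sum>n. x (Suc n) ^ k)"
proof -
  have nm: "norm (prod_list (map x ns)) = prod_list (map (\<lambda>n. norm (x n)) ns)" for ns
    by (induction ns) (auto simp: norm_mult)
  show abs: "(\<lambda>ns. norm (prod_list (map x ns))) summable_on decr_lists r"
    unfolding nm by (rule summable_on_decr_lists) (use assms in auto)
  let ?f = "\<lambda>ns. prod_list (map x ns)"
  have "(?f has_sum infsum ?f (decr_lists r)) (decr_lists r)"
    using abs_summable_summable[OF abs] by (rule has_sum_infsum)
  hence "(sum ?f \<longlongrightarrow> infsum ?f (decr_lists r)) (finite_subsets_at_top (decr_lists r))"
    by (simp add: has_sum_def)
  moreover have "filterlim (\<lambda>N. decr_lists_upto r N) (finite_subsets_at_top (decr_lists r)) sequentially"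
    unfolding filterlim_finite_subsets_at_top
  proof (intro allI impI)
    fix F assume "finite F \<and> F \<subseteq> decr_lists r"
    then obtain N where N: "\<And>M. M \<ge> N \<Longrightarrow> F \<subseteq> decr_lists_upto r M"
      using finite_subset_decr_lists by metis
    show "\<forall>\<^sub>F N in sequentially. finite (decr_lists_upto r N) \<and> F \<subseteq> decr_lists_upto r N \<and> decr_lists_upto r N \<subseteq> decr_lists r"
      using eventually_ge_at_top[of N] 
    proof eventually_elim
      case (elim M)
      thus ?case using N[of M] finite_decr_lists_upto[of r M] by (auto simp: decr_lists_upto_def)
    qed
  qed
  ultimately have "(\<lambda>N. sum ?f (decr_lists_upto r N)) \<longlonglongrightarrow> infsum ?f (decr_lists r)"
    by (rule filterlim_compose)
  hence 1: "(\<lambda>N. esym r (\<lambda>k. \<Sum>n=1..N. x n ^ k)) \<longlonglongrightarrow> infsum ?f (decr_lists r)"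
    by (simp add: sum_decr_lists_upto fsym_eq_esym)
  have 2: "(\<lambda>N. esym r (\<lambda>k. \<Sum>n=1..N. x n ^ k)) \<longlonglongrightarrow> esym r (\<lambda>k. \<Sum>n. x (Suc n) ^ k)"
  proof (rule esym_tendsto)
    fix k assume k: "1 \<le> k" "k \<le> r"
    have "summable (\<lambda>n. x (Suc n) ^ k)"
    proof (rule summable_norm_cancel, rule summable_comparison_test_ev)
      have "(\<lambda>n. norm (x (Suc n))) \<longlonglongrightarrow> 0" using assms by (rule summable_LIMSEQ_zero)
      hence "\<forall>\<^sub>F n in sequentially. norm (x (Suc n)) < 1" by (rule order_tendstoD) simp
      thus "\<forall>\<^sub>F n in sequentially. norm (norm (x (Suc n) ^ k)) \<le> norm (x (Suc n))"
      proof eventually_elim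
        case (elim n)
        have "norm (x (Suc n)) ^ k \<le> norm (x (Suc n)) ^ 1" using elim k by (intro power_decreasing) auto
        thus ?case by (simp add: norm_power)
      qed
    qed (use assms in simp)
    hence "(\<lambda>N. \<Sum>n<N. x (Suc n) ^ k) \<longlonglongrightarrow> (\<Sum>n. x (Suc n) ^ k)" by (rule summable_LIMSEQ)
    moreover have "(\<Sum>n<N. x (Suc n) ^ k) = (\<Sum>n=1..N. x n ^ k)" for N
      by (rule sum.reindex_bij_witness[of _ "\<lambda>n. n - 1" Suc]) auto
    ultimately show "(\<lambda>N. \<Sum>n=1..N. x n ^ k) \<longlonglongrightarrow> (\<Sum>n. x (Suc n) ^ k)" by simp
  qed
  show "infsum ?f (decr_lists r) = esym r (\<lambda>k. \<Sum>n. x (Suc n) ^ k)"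
    using LIMSEQ_unique[OF 1 2] .
qed

section \<open>The diagonal multiple zeta-function\<close>

definition zeta_series :: "complex \<Rightarrow> complex" where
  "zeta_series w = (\<Sum>n. of_nat (Suc n) powr - w)"

definition lam :: "complex \<Rightarrow> complex" where
  "lam s = 1 - 2 powr (1 - s)"

text \<open>The continuation of \<zeta> through the alternating series. Where \<open>lam\<close>
  vanishes, division yields the value 0; such points lie on Re w = 1.\<close>

definition zetam :: "complex \<Rightarrow> complex" where
  "zetam w = eta w / lam w"

lemma norm_nat_powr: "n > 0 \<Longrightarrow> norm (of_nat n powr - w) = real n powr - Re w"
  by (simp add: norm_powr_real_powr)

lemma summable_powr_Suc: "a > 1 \<Longrightarrow> summable (\<lambda>n. real (Suc n) powr - a)"
  using summable_fdiff_bound[of 1 a] by simp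

lemma summable_norm_zeta: "Re w > 1 \<Longrightarrow> summable (\<lambda>n. norm (of_nat (Suc n) powr - w :: complex))"
  by (simp only: norm_nat_powr zero_less_Suc summable_powr_Suc)

lemma zeta_series_sums: "Re w > 1 \<Longrightarrow> (\<lambda>n. of_nat (Suc n) powr - w) sums zeta_series w"
  unfolding zeta_series_def by (rule summable_sums, rule summable_norm_cancel, rule summable_norm_zeta)

lemma norm_lam_ge: "norm (lam s) \<ge> \<bar>2 powr (1 - Re s) - 1\<bar>"
proof -
  have "norm (2 powr (1 - s)) = 2 powr (1 - Re s)"
    by (simp add: norm_powr_real_powr)
  thus ?thesis unfolding lam_def using norm_triangle_ineq3[of "2 powr (1 - s)" 1]
    by (simp add: norm_minus_commute)
qed

lemma lam_nonzero: "Re s \<noteq> 1 \<Longrightarrow> lam s \<noteq> 0"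
proof
  assume "Re s \<noteq> 1" "lam s = 0"
  hence "(2::real) powr (1 - Re s) = 2 powr 0" using norm_lam_ge[of s] by simp
  thus False using \<open>Re s \<noteq> 1\<close> by (subst (asm) powr_inj) auto
qed

lemma norm_lam_le: "Re s \<ge> 0 \<Longrightarrow> norm (lam s) \<le> 3"
proof -
  assume "Re s \<ge> 0"
  have "norm (2 powr (1 - s)) = 2 powr (1 - Re s)"
    by (simp add: norm_powr_real_powr)
  also have "\<dots> \<le> 2 powr 1" using \<open>Re s \<ge> 0\<close> by (intro powr_mono) auto
  finally show ?thesis unfolding lam_def using norm_triangle_ineq4[of 1 "2 powr (1 - s)"] by simp
qed

lemma lam_holomorphic [holomorphic_intros]:
  "f holomorphic_on A \<Longrightarrow> (\<lambda>s. lam (f s)) holomorphic_on A"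
  unfolding lam_def by (intro holomorphic_intros) auto

lemma eta_compose_holomorphic [holomorphic_intros]:
  "f holomorphic_on A \<Longrightarrow> (\<lambda>s. eta (f s)) holomorphic_on A"
  using holomorphic_on_compose[of f A eta] eta_holomorphic by (simp add: o_def)

text \<open>Subtracting twice the terms of even integers makes the series alternate. Index n stands
  for the integer n + 1, so even integers sit at odd indices.\<close>

lemma eta_eq_zeta_series:
  assumes "Re w > 1"
  shows "eta w = lam w * zeta_series w"
proof -
  let ?f = "\<lambda>n. if odd n then 2 * of_nat (Suc n) powr - w else (0::complex)"
  have "(\<lambda>m. ?f (2 * m + 1)) sums (2 powr (1 - w) * zeta_series w)"
  proof -
    have "of_nat (Suc (2 * m + 1)) powr - w = 2 powr - w * (of_nat (Suc m) powr - w :: complex)" for m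
    proof -
      have "of_nat (Suc (2 * m + 1)) = complex_of_real 2 * complex_of_real (real (Suc m))" by simp
      also have "\<dots> powr - w = complex_of_real 2 powr - w * complex_of_real (real (Suc m)) powr - w"
        by (rule powr_times_real) auto
      finally show ?thesis by simp
    qed
    hence "?f (2 * m + 1) = 2 powr (1 - w) * of_nat (Suc m) powr - w" for m
      by (simp add: powr_diff powr_minus field_simps del: of_nat_Suc)
    thus ?thesis using sums_mult[OF zeta_series_sums[OF assms], of "2 powr (1 - w)"] by (simp del: of_nat_Suc)
  qed
  hence "?f sums (2 powr (1 - w) * zeta_series w)"
  proof (subst (asm) sums_mono_reindex)
    show "strict_mono (\<lambda>m::nat. 2 * m + 1)" by (rule strict_monoI) simp
    show "?f n = 0" if "n \<notin> range (\<lambda>m. 2 * m + 1)" for n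
      using that by (auto elim!: oddE)
  qed
  from sums_diff[OF zeta_series_sums[OF assms] this]
  have "(\<lambda>n. of_nat (Suc n) powr - w - ?f n) sums (lam w * zeta_series w)"
    by (simp add: lam_def algebra_simps)
  also have "(\<lambda>n. of_nat (Suc n) powr - w - ?f n) = (\<lambda>n. alt (Suc n) * of_nat (Suc n) powr - w)"
    by (auto simp: fun_eq_iff alt_def)
  finally show ?thesis using eta_sums[OF assms] sums_unique2 by blast
qed

lemma zetam_eq_zeta_series: "Re w > 1 \<Longrightarrow> zetam w = zeta_series w"
  by (simp add: zetam_def eta_eq_zeta_series lam_nonzero)

lemma zetam_compose_holomorphic:
  "f holomorphic_on A \<Longrightarrow> (\<And>s. s \<in> A \<Longrightarrow> Re (f s) \<noteq> 1) \<Longrightarrow> (\<lambda>s. zetam (f s)) holomorphic_on A"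
  unfolding zetam_def by (intro holomorphic_intros) (auto simp: lam_nonzero)

lemma norm_zeta_series_le:
  assumes "Re w \<ge> a" "a > 1"
  shows "norm (zeta_series w) \<le> (\<Sum>n. real (Suc n) powr - a)"
  unfolding zeta_series_def
proof (rule norm_suminf_le)
  fix n show "norm (of_nat (Suc n) powr - w :: complex) \<le> real (Suc n) powr - a"
    unfolding norm_nat_powr[OF zero_less_Suc] using assms by (intro powr_mono) auto
qed (use assms in \<open>simp add: summable_powr_Suc del: of_nat_Suc\<close>)

definition Fdiag :: "nat \<Rightarrow> complex \<Rightarrow> complex" where
  "Fdiag r s = esym r (\<lambda>k. zetam (of_nat k * s))"

text \<open>F multiplied by (1 - 2^(1-s))^r, distributed over the power sums by weighted
  homogeneity. The entry k = 1 is \<open>eta s\<close> itself, so that the function is right at the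
  zeros of \<open>lam\<close> as well. It is holomorphic on the connected set Re s > 1/2, which the
  line Re s = 1 would otherwise cut in two.\<close>

definition Gdiag :: "nat \<Rightarrow> complex \<Rightarrow> complex" where
  "Gdiag r s = esym r (\<lambda>k. if k = 1 then eta s else lam s ^ k * zetam (of_nat k * s))"

lemma nat_powr_power: "(of_nat n powr - s) ^ k = (of_nat n powr - (of_nat k * s) :: complex)" if "n > 0"
  using that by (simp add: powr_def exp_of_nat_mult [symmetric] mult_ac)

lemma euler_zagier_series_eq_infsum:
  "euler_zagier_series (replicate r s) = (\<Sum>\<^sub>\<infinity>ns\<in>decr_lists r. prod_list (map (\<lambda>n. of_nat n powr - s) ns))"
proof -
  have "(\<Prod>i<length (replicate r s). of_nat (ns ! i) powr - (replicate r s ! i)) = prod_list (map (\<lambda>n. of_nat n powr - s) ns)"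
    if "ns \<in> decr_lists r" for ns
  proof -
    have "length ns = r" using that by (simp add: decr_lists_def)
    thus ?thesis by (simp add: prod.list_conv_set_nth atLeast0LessThan)
  qed
  thus ?thesis unfolding euler_zagier_series_def
    by (intro infsum_cong_neutral) (auto simp: decr_lists_def)
qed

lemma euler_zagier_series_eq_Fdiag:
  assumes "Re s > 1"
  shows "euler_zagier_series (replicate r s) = Fdiag r s"
proof -
  have "euler_zagier_series (replicate r s) = esym r (\<lambda>k. \<Sum>n. (of_nat (Suc n) powr - s) ^ k)"
    unfolding euler_zagier_series_eq_infsum
    by (rule infsum_decr_lists(2)) (rule summable_norm_zeta[OF assms])
  also have "\<dots> = Fdiag r s"
    unfolding Fdiag_def
  proof (rule esym_cong)
    fix k :: nat assume k: "1 \<le> k" "k \<le> r"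
    have "1 * 1 < real k * Re s" using k assms by (intro mult_le_less_imp_less) auto
    hence "Re (of_nat k * s) > 1" by simp
    thus "(\<Sum>n. (of_nat (Suc n) powr - s) ^ k) = zetam (of_nat k * s)"
      by (simp add: zetam_eq_zeta_series zeta_series_def nat_powr_power del: of_nat_Suc)
  qed
  finally show ?thesis .
qed

lemma Fdiag_meromorphic: "Fdiag r meromorphic_on UNIV"
proof -
  have an: "(\<lambda>s. f (of_nat k * s)) meromorphic_on UNIV" if "f holomorphic_on UNIV" for f :: "complex \<Rightarrow> complex" and k :: nat
  proof -
    have "(\<lambda>s. of_nat k * s) holomorphic_on UNIV" by (intro holomorphic_intros)
    hence "(f \<circ> (\<lambda>s. of_nat k * s)) holomorphic_on UNIV"
      using that holomorphic_on_compose holomorphic_on_subset by blast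
    thus ?thesis by (simp add: o_def analytic_on_open analytic_on_imp_meromorphic_on)
  qed
  have "(\<lambda>s. zetam (of_nat k * s)) meromorphic_on UNIV" for k
    unfolding zetam_def using an[of eta k] an[of lam k] eta_holomorphic lam_holomorphic[of "\<lambda>s. s" UNIV]
    by (intro meromorphic_intros) auto
  thus ?thesis unfolding Fdiag_def by (intro esym_meromorphic)
qed

text \<open>The difference vanishes on a half-plane, hence everywhere after removal of
  singularities. It remains to compare single values: both functions have the same poles, where 0 is
  prescribed, and elsewhere each equals its limit.\<close>

lemma nicely_meromorphic_unique:
  assumes f: "f nicely_meromorphic_on UNIV" and g: "g nicely_meromorphic_on UNIV"
    and eq: "\<And>s. Re s > 1 \<Longrightarrow> f s = g s"
  shows "f = g"
proof
  fix z :: complex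
  define h where "h = remove_sings (\<lambda>s. f s - g s)"
  have mero: "(\<lambda>s. f s - g s) meromorphic_on UNIV"
    using f g by (auto simp: nicely_meromorphic_on_def intro!: meromorphic_intros)
  have h: "h nicely_meromorphic_on UNIV" unfolding h_def using mero by (rule remove_sings_nicely_meromorphic)
  have h0: "h s = 0" if "Re s > 1" for s
  proof -
    have "\<forall>\<^sub>F w in at s. f w - g w = 0"
      using eventually_at_in_open'[OF open_halfspace_Re_gt[of 1], of s] that
      by (auto elim!: eventually_mono simp: eq)
    hence "(\<lambda>s. f s - g s) \<midarrow>s\<rightarrow> 0" by (rule tendsto_eventually)
    thus ?thesis unfolding h_def by (rule remove_sings_eqI)
  qed
  have "\<exists>\<^sub>F w in at 2. h w = 0"
  proof (rule eventually_frequently)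
    show "\<forall>\<^sub>F w in at 2. h w = 0"
      using eventually_at_in_open'[OF open_halfspace_Re_gt[of 1], of 2] by (auto elim!: eventually_mono simp: h0)
  qed simp
  from frequently_eq_meromorphic_imp_constant[OF this h open_UNIV connected_UNIV UNIV_I]
  have hz: "h w = 0" for w by simp
  have "isolated_singularity_at (\<lambda>s. f s - g s) z"
    using mero meromorphic_on_isolated_singularity meromorphic_on_subset by blast
  from eventually_remove_sings_eq_at[OF this] have "\<forall>\<^sub>F w in at z. f w - g w = 0"
    unfolding h_def[symmetric] hz by (auto elim!: eventually_mono)
  hence ev: "\<forall>\<^sub>F w in at z. f w = g w" by (auto elim!: eventually_mono)
  have fz: "is_pole f z \<and> f z = 0 \<or> f \<midarrow>z\<rightarrow> f z" using f by (auto simp: nicely_meromorphic_on_def)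
  have gz: "is_pole g z \<and> g z = 0 \<or> g \<midarrow>z\<rightarrow> g z" using g by (auto simp: nicely_meromorphic_on_def)
  have p: "is_pole f z \<longleftrightarrow> is_pole g z" using ev by (intro is_pole_cong) auto
  show "f z = g z"
  proof (cases "is_pole f z")
    case True
    have "\<not> f \<midarrow>z\<rightarrow> f z" "\<not> g \<midarrow>z\<rightarrow> g z" using True p
      by (auto simp: is_pole_def dest: not_tendsto_and_filterlim_at_infinity[of "at z", OF at_neq_bot])
    thus ?thesis using fz gz by auto
  next
    case False
    hence "f \<midarrow>z\<rightarrow> f z" "g \<midarrow>z\<rightarrow> g z" using fz gz p by auto
    moreover have "g \<midarrow>z\<rightarrow> f z" using \<open>f \<midarrow>z\<rightarrow> f z\<close> ev tendsto_cong by fastforce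
    ultimately show ?thesis using LIM_unique by blast
  qed
qed

definition half_strip :: "complex set" where
  "half_strip = {s. Re s > 1/2}"

lemma open_half_strip: "open half_strip" and connected_half_strip: "connected half_strip"
  unfolding half_strip_def by (simp_all only: open_halfspace_Re_gt convex_connected convex_halfspace_Re_gt)

lemma Fdiag_holomorphic: "Fdiag r holomorphic_on {s \<in> half_strip. Re s \<noteq> 1}"
  unfolding Fdiag_def
proof (intro esym_holomorphic zetam_compose_holomorphic holomorphic_intros)
  fix i :: nat and s assume i: "1 \<le> i" and s: "s \<in> {s \<in> half_strip. Re s \<noteq> 1}"
  show "Re (of_nat i * s) \<noteq> 1"
  proof (cases "i = 1")
    case False
    hence "real i * Re s > 2 * (1/2)" using i s unfolding half_strip_def by (intro mult_le_less_imp_less) auto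
    thus ?thesis by simp
  qed (use s in auto)
qed

lemma open_strip: "open {s \<in> half_strip. Re s \<noteq> 1}"
proof -
  have "{s \<in> half_strip. Re s \<noteq> 1} = half_strip \<inter> ({s. Re s < 1} \<union> {s. Re s > 1})"
    by auto
  thus ?thesis by (simp only: open_Int open_half_strip open_Un open_halfspace_Re_gt open_halfspace_Re_lt)
qed

lemma Fdiag_analytic: "Re s > 1/2 \<Longrightarrow> Re s \<noteq> 1 \<Longrightarrow> Fdiag r analytic_on {s}"
  using Fdiag_holomorphic open_strip analytic_at by (force simp: half_strip_def)

lemma euler_zagier_diag_eq: "euler_zagier_diag r = remove_sings (Fdiag r)"
proof -
  have 1: "remove_sings (Fdiag r) nicely_meromorphic_on UNIV"
    using Fdiag_meromorphic by (rule remove_sings_nicely_meromorphic)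
  have 2: "remove_sings (Fdiag r) s = euler_zagier_series (replicate r s)" if "Re s > 1" for s
    using that Fdiag_analytic[of s r] by (simp add: euler_zagier_series_eq_Fdiag)
  show ?thesis unfolding euler_zagier_diag_def
    using 1 2 by (intro the_equality) (auto intro!: nicely_meromorphic_unique)
qed

lemma Gdiag_holomorphic: "Gdiag r holomorphic_on half_strip"
proof -
  have "(\<lambda>s. if i = 1 then eta s else lam s ^ i * zetam (of_nat i * s)) holomorphic_on half_strip" if "i \<ge> 1" for i :: nat
  proof (cases "i = 1")
    case False
    have "(\<lambda>s. lam s ^ i * zetam (of_nat i * s)) holomorphic_on half_strip"
    proof (intro holomorphic_intros zetam_compose_holomorphic)
      fix s assume "s \<in> half_strip"
      hence "real i * Re s > 2 * (1/2)" using that False unfolding half_strip_def by (intro mult_le_less_imp_less) auto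
      thus "Re (of_nat i * s) \<noteq> 1" by simp
    qed
    thus ?thesis using False by simp
  qed (use eta_holomorphic in auto)
  thus ?thesis unfolding Gdiag_def by (intro esym_holomorphic)
qed

lemma Gdiag_eq: "lam s \<noteq> 0 \<Longrightarrow> Gdiag r s = lam s ^ r * Fdiag r s"
  unfolding Gdiag_def Fdiag_def esym_scale [symmetric]
  by (rule esym_cong) (auto simp: zetam_def)

section \<open>The leading term far to the right\<close>

lemma length_less_hd_decr_list:
  "n # ns \<in> decr_lists r \<Longrightarrow> n \<ge> r"
proof (induction ns arbitrary: n r)
  case Nil
  thus ?case by (auto simp: decr_lists_def)
next
  case (Cons m ns)
  have "m # ns \<in> decr_lists (r - 1)" "m < n" "r \<ge> 1" using Cons.prems by (auto simp: decr_lists_def)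
  with Cons.IH[of m "r - 1"] show ?case by auto
qed

text \<open>The first entry of a decreasing tuple of length r is at least r; peeling it off builds
  up the factorial, with equality only for r, ..., 1.\<close>

lemma prod_list_decr_lists_ge:
  "ns \<in> decr_lists r \<Longrightarrow> prod_list ns \<ge> fact r"
  "ns \<in> decr_lists r \<Longrightarrow> prod_list ns = fact r \<Longrightarrow> ns = rev [1..<Suc r]"
proof (induction ns arbitrary: r)
  case Nil
  { case 1 thus ?case by (auto simp: decr_lists_def) }
  { case 2 thus ?case by (auto simp: decr_lists_def) }
next
  case (Cons n ns)
  { case 1
    then obtain q where q: "r = Suc q" "ns \<in> decr_lists q" by (cases r) (auto simp: decr_lists_def)
    from length_less_hd_decr_list[OF 1] Cons.IH(1)[OF q(2)] q(1)
    have "Suc q * fact q \<le> n * prod_list ns" by (intro mult_le_mono) auto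
    thus ?case using q by simp }
  { case 2
    then obtain q where q: "r = Suc q" "ns \<in> decr_lists q" by (cases r) (auto simp: decr_lists_def)
    have n: "n \<ge> Suc q" using length_less_hd_decr_list[OF 2(1)] q by simp
    have p: "prod_list ns \<ge> fact q" by (rule Cons.IH(1)[OF q(2)])
    have e: "n * prod_list ns = Suc q * fact q" using 2 q by simp
    have "prod_list ns = fact q"
    proof (rule ccontr)
      assume "prod_list ns \<noteq> fact q"
      hence "prod_list ns > fact q" using p by simp
      hence "Suc q * fact q < n * prod_list ns" using n by (intro mult_le_less_imp_less) auto
      thus False using e by simp
    qed
    moreover from this e have "n * fact q = Suc q * fact q" by (simp only:)
    hence "n = Suc q" by (metis mult_cancel2 fact_nonzero)
    ultimately show ?case using Cons.IH(2)[OF q(2)] q by simp }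
qed

lemma prod_list_powr: "ns \<in> decr_lists r \<Longrightarrow> prod_list (map (\<lambda>n. real n powr a) ns) = real (prod_list ns) powr a"
proof (induction ns arbitrary: r)
  case (Cons n ns)
  have "ns \<in> decr_lists (r - 1)" using Cons.prems by (auto simp: decr_lists_def)
  thus ?case using Cons.IH by (simp add: powr_mult)
qed auto

text \<open>Every product except the smallest, r!, is at least r! + 1. With K the sum of the other
  terms at exponent 2, their total at exponent A is at most (r! + 1)^(2-A) K, which for large A is
  less than half of the leading term.\<close>

lemma norm_Fdiag_ge:
  obtains A c where "A > 1" "c > 0" "\<And>s. Re s = A \<Longrightarrow> norm (Fdiag r s) \<ge> c"
proof -
  define x0 where "x0 = rev [1..<Suc r]"
  have x0: "x0 \<in> decr_lists r" 
    by (auto simp: x0_def decr_lists_def sorted_wrt_rev simp del: upt_Suc)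
  have px0: "prod_list x0 = fact r"
    unfolding x0_def by (induction r) (simp_all add: prod_list.rev)
  define S where "S = decr_lists r - {x0}"
  define p where "p = (\<lambda>ns. real (prod_list ns))"
  define a :: real where "a = fact r"
  have a: "a \<ge> 1" by (simp add: a_def)
  have pS: "p ns \<ge> a + 1" if "ns \<in> S" for ns
  proof -
    have "prod_list ns \<ge> fact r" "prod_list ns \<noteq> fact r"
      using prod_list_decr_lists_ge[of ns r] that by (auto simp: S_def x0_def simp del: upt_Suc)
    hence "prod_list ns \<ge> fact r + 1" by simp
    hence "real (prod_list ns) \<ge> real (fact r + 1)" by (simp only: of_nat_le_iff)
    thus ?thesis by (simp add: p_def a_def)
  qed
  have sm: "(\<lambda>ns. p ns powr - \<sigma>) summable_on decr_lists r" if "\<sigma> > 1" for \<sigma>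
  proof -
    have "(\<lambda>ns. prod_list (map (\<lambda>n. real n powr - \<sigma>) ns)) summable_on decr_lists r"
      using summable_powr_Suc[OF that] by (intro summable_on_decr_lists) auto
    thus ?thesis by (rule summable_on_cong[THEN iffD1, rotated]) (simp add: prod_list_powr p_def)
  qed
  define K where "K = (\<Sum>\<^sub>\<infinity>ns\<in>S. p ns powr - 2)"
  have smS: "(\<lambda>ns. p ns powr - \<sigma>) summable_on S" if "\<sigma> > 1" for \<sigma>
    using sm[OF that] by (rule summable_on_subset_banach) (auto simp: S_def)
  have "((\<lambda>\<sigma>. ((a + 1) powr 2 * K) * (a / (a + 1)) powr \<sigma>) \<longlongrightarrow> ((a + 1) powr 2 * K) * 0) at_top"
  proof (intro tendsto_intros)
    show "((\<lambda>\<sigma>. (a / (a + 1)) powr \<sigma>) \<longlongrightarrow> 0) at_top" using a by real_asymp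
  qed
  hence "\<forall>\<^sub>F \<sigma> in at_top. ((a + 1) powr 2 * K) * (a / (a + 1)) powr \<sigma> < 1/2"
    by (rule order_tendstoD) simp
  hence "\<forall>\<^sub>F \<sigma> in at_top. ((a + 1) powr 2 * K) * (a / (a + 1)) powr \<sigma> < 1/2 \<and> \<sigma> \<ge> 2"
    by (intro eventually_conj eventually_ge_at_top)
  then obtain A where A: "((a + 1) powr 2 * K) * (a / (a + 1)) powr A < 1/2" "A \<ge> 2"
    using eventually_happens by fastforce
  show ?thesis
  proof (rule that[of A "a powr -A / 2"])
    fix s assume s: "Re s = A"
    let ?f = "\<lambda>ns. prod_list (map (\<lambda>n. of_nat n powr - s) ns) :: complex"
    have nf: "norm (?f ns) = p ns powr - A" if "ns \<in> decr_lists r" for ns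
    proof -
      have "norm (?f ns) = prod_list (map (\<lambda>n. real n powr - A) ns)"
        using that
      proof (induction ns arbitrary: r)
        case (Cons n ns)
        have "ns \<in> decr_lists (r - 1)" "n > 0" using Cons.prems by (auto simp: decr_lists_def)
        thus ?case using Cons.IH s by (simp add: norm_mult norm_nat_powr)
      qed auto
      also have "\<dots> = p ns powr - A" unfolding p_def using that by (rule prod_list_powr)
      finally show ?thesis .
    qed
    have smf: "(\<lambda>ns. norm (?f ns)) summable_on S"
    proof -
      have "(\<lambda>ns. p ns powr - A) summable_on S" using A by (intro smS) auto
      thus ?thesis by (rule summable_on_cong[THEN iffD1, rotated]) (auto simp: nf S_def)
    qed
    have "Fdiag r s = infsum ?f (decr_lists r)"
      using s A by (simp add: euler_zagier_series_eq_Fdiag [symmetric] euler_zagier_series_eq_infsum)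
    also have "decr_lists r = insert x0 S" using x0 by (auto simp: S_def)
    also have "infsum ?f (insert x0 S) = ?f x0 + infsum ?f S"
      by (rule infsum_insert) (use abs_summable_summable[OF smf] in \<open>auto simp: S_def\<close>)
    finally have F: "Fdiag r s = ?f x0 + infsum ?f S" .
    have "norm (infsum ?f S) \<le> (\<Sum>\<^sub>\<infinity>ns\<in>S. norm (?f ns))"
      using smf by (rule norm_infsum_bound)
    also have "\<dots> \<le> (\<Sum>\<^sub>\<infinity>ns\<in>S. (a + 1) powr (2 - A) * p ns powr - 2)"
    proof (rule infsum_mono[OF smf])
      show "(\<lambda>ns. (a + 1) powr (2 - A) * p ns powr - 2) summable_on S"
        by (intro summable_on_cmult_right smS) auto
      fix ns assume ns: "ns \<in> S"
      have "norm (?f ns) = p ns powr (2 - A) * p ns powr - 2"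
        using nf[of ns] ns by (simp add: S_def flip: powr_add)
      also have "\<dots> \<le> (a + 1) powr (2 - A) * p ns powr - 2"
        using pS[OF ns] a A by (intro mult_right_mono powr_mono2') auto
      finally show "norm (?f ns) \<le> (a + 1) powr (2 - A) * p ns powr - 2" .
    qed
    also have "\<dots> = (a + 1) powr (2 - A) * K"
      unfolding K_def by (rule infsum_cmult_right) (use smS[of 2] in auto)
    also have "\<dots> = a powr -A * (((a + 1) powr 2 * K) * (a / (a + 1)) powr A)"
      using a by (simp add: powr_diff powr_minus powr_divide field_simps)
    also have "\<dots> \<le> a powr -A * (1/2)"
      using A by (intro mult_left_mono) auto
    finally have "norm (infsum ?f S) \<le> a powr -A / 2" by simp
    moreover have "norm (?f x0) = a powr -A" using nf[OF x0] px0 by (simp add: p_def a_def)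
    ultimately show "norm (Fdiag r s) \<ge> a powr -A / 2"
      unfolding F using norm_triangle_ineq2[of "?f x0" "- infsum ?f S"] by simp
  qed (use A a in auto)
qed

section \<open>Upper bound for the number of zeros\<close>

lemma zorder_mult_linear:
  assumes "h analytic_on {z}" "\<forall>\<^sub>F w in at z. (w - a) * h w \<noteq> 0"
  shows "zorder (\<lambda>w. (w - a) * h w) z = (if z = a then 1 else 0) + zorder h z"
proof -
  have "zorder (\<lambda>w. (w - a) * h w) z = zorder (\<lambda>w. w - a) z + zorder h z"
    using assms by (intro zorder_times_analytic analytic_intros) auto
  also have "zorder (\<lambda>w. w - a) z = (if z = a then 1 else 0)"
  proof (cases "z = a")
    case True
    have "zorder (\<lambda>w. w - a) a = 1"
      by (rule zorder_eqI[of UNIV a "\<lambda>_. 1"]) auto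
    thus ?thesis using True by simp
  next
    case False
    thus ?thesis by (simp add: zorder_eq_0I analytic_intros)
  qed
  finally show ?thesis .
qed

text \<open>The zeros are removed one at a time by dividing by the Blaschke factor
  \<open>R (z - a) / (R\<^sup>2 - cnj a z)\<close>, which has modulus 1 on the circle of radius \<open>R\<close>.\<close>

lemma jensen_aux:
  assumes U: "open U" "connected U" "cball c R \<subseteq> U" and R: "0 < r" "r < R"
  assumes S: "finite S" "S \<subseteq> cball c r"
  assumes "f holomorphic_on U" "f c \<noteq> 0" "\<And>z. z \<in> sphere c R \<Longrightarrow> norm (f z) \<le> M"
    and "(\<Sum>z\<in>S. zorder f z) = int n"
  shows "norm (f c) * (R / r) ^ n \<le> M"
  using assms(8-11)
proof (induction n arbitrary: f)
  case 0
  have "norm (f c) \<le> M"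
  proof (rule maximum_modulus_frontier[of f "cball c R"])
    show "f holomorphic_on interior (cball c R)" 
      using 0(1) U(3) interior_subset holomorphic_on_subset by blast
    show "continuous_on (closure (cball c R)) f"
      using holomorphic_on_imp_continuous_on[OF holomorphic_on_subset[OF 0(1) U(3)]] by simp
  qed (use R 0 in \<open>auto simp: frontier_cball\<close>)
  thus ?case by simp
next
  case (Suc n)
  have cU: "c \<in> U" using U R by auto
  have SU: "S \<subseteq> U" using S R U by (meson cball_subset_cball_iff dual_order.trans subset_trans subset_cball less_imp_le)
  have ev: "\<forall>\<^sub>F w in at z. f w \<noteq> 0" if "z \<in> U" for z
    using non_zero_neighbour_alt[OF Suc.prems(1) U(1,2) that cU Suc.prems(2)] by (auto elim: eventually_mono)
  have "\<exists>a\<in>S. zorder f a > 0"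
  proof (rule ccontr)
    assume "\<not> ?thesis"
    hence "(\<Sum>z\<in>S. zorder f z) \<le> 0" by (intro sum_nonpos) auto
    thus False using Suc.prems(4) by simp
  qed
  then obtain a where a: "a \<in> S" "zorder f a > 0" by auto
  have aU: "a \<in> U" using a SU by auto
  have fa: "f a = 0"
    using zorder_pos_iff[OF Suc.prems(1) U(1) aU] ev[OF aU] a by (auto simp: eventually_frequently)
  define h where "h = (\<lambda>z. if z = a then deriv f a else (f z - f a) / (z - a))"
  have hol_h: "h holomorphic_on U" unfolding h_def using Suc.prems(1) U(1) by (rule pole_lemma_open)
  have fh: "f z = (z - a) * h z" for z by (simp add: h_def fa)
  \<comment> \<open>On the circle of radius R about c one has |q z| = |z - a|. Replacing the factor
    z - a of f by q therefore removes the zero at a without changing the modulus on the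
    circle.\<close>
  define q where "q = (\<lambda>z. (of_real (R^2) - cnj (a - c) * (z - c)) / of_real R)"
  have hol_q: "q holomorphic_on A" for A unfolding q_def using R by (intro holomorphic_intros) auto
  define g where "g = (\<lambda>z. h z * q z)"
  have hol_g: "g holomorphic_on U" unfolding g_def by (intro holomorphic_intros hol_h hol_q)
  have ac: "a \<noteq> c" using fa Suc.prems(2) by auto
  have nac: "norm (a - c) \<le> r" "norm (a - c) > 0"
    using a S ac by (auto simp: dist_norm norm_minus_commute)
  have q_nz: "q z \<noteq> 0" if "z \<in> cball c r" for z
  proof
    assume "q z = 0"
    hence "of_real (R^2) = cnj (a - c) * (z - c)" using R by (simp add: q_def)
    hence "R^2 = norm (cnj (a - c) * (z - c))" by (metis norm_of_real abs_power2)
    also have "\<dots> \<le> r * r" unfolding norm_mult complex_mod_cnj using nac that R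
      by (intro mult_mono) (auto simp: dist_norm norm_minus_commute)
    also have "\<dots> < R * R" using R by (intro mult_strict_mono) auto
    finally show False by (simp add: power2_eq_square)
  qed
  have "(\<Sum>z\<in>S. zorder g z) = (\<Sum>z\<in>S. zorder f z - (if z = a then 1 else 0))"
  proof (rule sum.cong)
    fix z assume z: "z \<in> S"
    hence zU: "z \<in> U" using SU by auto
    have an: "h analytic_on {z}" "q analytic_on {z}"
      using hol_h hol_q U(1) zU analytic_at by blast+
    have evh: "\<forall>\<^sub>F w in at z. (w - a) * h w \<noteq> 0" using ev[OF zU] by (simp add: fh)
    have "q \<midarrow>z\<rightarrow> q z" using an(2) analytic_at_imp_isCont isCont_def by blast
    hence evq: "\<forall>\<^sub>F w in at z. q w \<noteq> 0"
      using q_nz[of z] z S by (intro tendsto_imp_eventually_ne) auto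
    have "zorder g z = zorder h z + zorder q z"
      unfolding g_def using evh evq by (intro zorder_times_analytic an) (auto elim: eventually_elim2)
    also have "zorder q z = 0" using q_nz[of z] z S an by (intro zorder_eq_0I) auto
    also have "zorder h z = zorder f z - (if z = a then 1 else 0)"
      using zorder_mult_linear[OF an(1) evh] by (simp add: fh [symmetric])
    finally show "zorder g z = zorder f z - (if z = a then 1 else 0)" by simp
  qed auto
  also have "\<dots> = int n"
    using Suc.prems(4) a S(1) by (simp add: sum_subtractf)
  finally have ord: "(\<Sum>z\<in>S. zorder g z) = int n" .
  have gM: "norm (g z) \<le> M" if z: "z \<in> sphere c R" for z
  proof -
    define w where "w = z - c"
    define b where "b = a - c"
    have w: "norm w = R" using z by (simp add: w_def dist_norm norm_minus_commute)
    have "of_real (R^2) = w * cnj w" using w complex_norm_square[of w] by simp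
    hence "q z = w * cnj w / of_real R - cnj b * w / of_real R"
      by (simp add: q_def b_def w_def diff_divide_distrib)
    also have "\<dots> = w * cnj (w - b) / of_real R" by (simp add: algebra_simps diff_divide_distrib)
    finally have "norm (q z) = norm (w - b)" using w R by (simp add: norm_mult norm_divide del: complex_cnj_diff)
    also have "w - b = z - a" by (simp add: w_def b_def)
    finally have "norm (g z) = norm (f z)" by (simp add: g_def fh norm_mult mult.commute)
    thus ?thesis using Suc.prems(3)[OF z] by simp
  qed
  have qc: "q c = of_real R" using R by (simp add: q_def power2_eq_square)
  have gc: "norm (g c) = norm (f c) * R / norm (a - c)"
  proof -
    have "\<bar>R\<bar> = R" using R by simp
    thus ?thesis using nac by (simp add: g_def fh qc norm_mult norm_minus_commute)
  qed
  have "norm (g c) > 0"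
    unfolding gc using Suc.prems(2) R nac(2) by (intro divide_pos_pos mult_pos_pos) auto
  hence "g c \<noteq> 0" by auto
  \<comment> \<open>At the centre, z - a of modulus at most r is replaced by q of modulus R: every
    removed zero gains a factor of at least R / r.\<close>
  have "norm (f c) * (R / r) ^ Suc n = norm (f c) * R / r * (R / r) ^ n" by simp
  also have "\<dots> \<le> norm (g c) * (R / r) ^ n"
    unfolding gc using R
    by (intro mult_right_mono divide_left_mono mult_nonneg_nonneg mult_pos_pos zero_le_power divide_nonneg_nonneg nac norm_ge_zero) linarith+
  also have "\<dots> \<le> M" by (rule Suc.IH[OF hol_g \<open>g c \<noteq> 0\<close> gM ord])
  finally show ?case .
qed

lemma sum_zorder_le:
  assumes U: "open U" "connected U" "cball c R \<subseteq> U" and R: "0 < r" "r < R"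
  assumes S: "finite S" "S \<subseteq> cball c r"
  assumes f: "f holomorphic_on U" "f c \<noteq> 0" "\<And>z. z \<in> sphere c R \<Longrightarrow> norm (f z) \<le> M"
  shows "of_int (\<Sum>z\<in>S. zorder f z) * ln (R / r) \<le> ln (M / norm (f c))"
proof -
  have cU: "c \<in> U" using U R by auto
  have SU: "S \<subseteq> U" using S R U by fastforce
  have "zorder f z \<ge> 0" if "z \<in> S" for z
  proof (rule zorder_ge_0)
    show "f analytic_on {z}" using f(1) U(1) that SU analytic_at by blast
    have "\<forall>\<^sub>F w in at z. f w \<noteq> 0"
      using non_zero_neighbour_alt[OF f(1) U(1,2) _ cU f(2), of z] that SU by (auto elim!: eventually_mono)
    thus "\<exists>\<^sub>F w in at z. f w \<noteq> 0" by (simp add: eventually_frequently)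
  qed
  hence "(\<Sum>z\<in>S. zorder f z) \<ge> 0" by (intro sum_nonneg) auto
  then obtain n where n: "(\<Sum>z\<in>S. zorder f z) = int n" using nonneg_int_cases by blast
  have "norm (f c) * (R / r) ^ n \<le> M"
    using assms n by (intro jensen_aux[OF U R S f]) auto
  hence "(R / r) ^ n \<le> M / norm (f c)" using f(2) by (simp add: field_simps)
  hence "ln ((R / r) ^ n) \<le> ln (M / norm (f c))" using R by (intro ln_mono) auto
  thus ?thesis using R n by (simp add: ln_realpow)
qed

text \<open>Cauchy's formula for f^2 on the larger circle. It replaces a supremum over a disc by a
  circle mean of |f|^2, which can be integrated over the height.\<close>

lemma norm_square_le_circle_integral:
  assumes f: "f holomorphic_on cball c R2" and w: "dist c w \<le> R" and R: "0 \<le> R" "R < R2"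
  shows "norm (f w) ^ 2 \<le> R2 / (R2 - R) * integral {0..1} (\<lambda>x. norm (f (circlepath c R2 x)) ^ 2)"
proof -
  have cont: "continuous_on {0..1} (\<lambda>x. f (circlepath c R2 x))"
  proof (rule continuous_on_compose2[OF holomorphic_on_imp_continuous_on[OF f]])
    show "continuous_on {0..1} (circlepath c R2)" using path_circlepath by (simp add: path_def)
    show "circlepath c R2 ` {0..1} \<subseteq> cball c R2"
      using R path_image_circlepath[of c R2] by (auto simp: path_image_def)
  qed
  have on: "dist c (circlepath c R2 x) = R2" if "x \<in> {0..1}" for x
    using R that path_image_circlepath[of c R2] by (auto simp: path_image_def)
  have "((\<lambda>u. f u ^ 2 / (u - w)) has_contour_integral 2 * of_real pi * \<i> * f w ^ 2) (circlepath c R2)"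
    using f w R by (intro Cauchy_integral_circlepath_simple holomorphic_intros) (auto simp: dist_norm norm_minus_commute)
  hence hi: "((\<lambda>x. f (circlepath c R2 x) ^ 2 / (circlepath c R2 x - w) * vector_derivative (circlepath c R2) (at x within {0..1}))
     has_integral 2 * of_real pi * \<i> * f w ^ 2) {0..1}"
    by (simp add: has_contour_integral_def)
  have "norm (2 * of_real pi * \<i> * f w ^ 2) \<le> integral {0..1} (\<lambda>x. 2 * pi * R2 / (R2 - R) * norm (f (circlepath c R2 x)) ^ 2)"
    unfolding integral_unique[OF hi, symmetric]
  proof (rule integral_norm_bound_integral)
    show "(\<lambda>x. 2 * pi * R2 / (R2 - R) * (cmod (f (circlepath c R2 x)))\<^sup>2) integrable_on {0..1}"
      using R by (intro integrable_continuous_interval continuous_intros cont) auto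
    fix x :: real assume x: "x \<in> {0..1}"
    have d: "norm (circlepath c R2 x - w) \<ge> R2 - R"
      using on[OF x] w dist_triangle[of c "circlepath c R2 x" w] by (simp add: dist_norm norm_minus_commute)
    have "norm (vector_derivative (circlepath c R2) (at x within {0..1})) = 2 * pi * R2"
      using x R by (simp add: vector_derivative_circlepath01 norm_mult)
    hence "norm (f (circlepath c R2 x) ^ 2 / (circlepath c R2 x - w) * vector_derivative (circlepath c R2) (at x within {0..1}))
      = norm (f (circlepath c R2 x)) ^ 2 * (2 * pi * R2) / norm (circlepath c R2 x - w)"
      by (simp add: norm_mult norm_divide norm_power)
    also have "\<dots> \<le> norm (f (circlepath c R2 x)) ^ 2 * (2 * pi * R2) / (R2 - R)"
      using d R by (intro divide_left_mono) (auto intro!: mult_pos_pos)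
    finally show "norm (f (circlepath c R2 x) ^ 2 / (circlepath c R2 x - w) * vector_derivative (circlepath c R2) (at x within {0..1}))
        \<le> 2 * pi * R2 / (R2 - R) * norm (f (circlepath c R2 x)) ^ 2"
      by (simp add: mult_ac)
  qed (use hi in blast)
  also have "norm (2 * of_real pi * \<i> * f w ^ 2) = 2 * pi * norm (f w) ^ 2"
    by (simp add: norm_mult norm_power)
  also have "integral {0..1} (\<lambda>x. 2 * pi * R2 / (R2 - R) * norm (f (circlepath c R2 x)) ^ 2)
     = 2 * pi * (R2 / (R2 - R) * integral {0..1} (\<lambda>x. norm (f (circlepath c R2 x)) ^ 2))"
    by simp
  finally show ?thesis by (subst (asm) mult_le_cancel_left_pos) auto
qed

section \<open>Zeros in the rectangle as zeros of a holomorphic function\<close>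

definition rect :: "real \<Rightarrow> real \<Rightarrow> real \<Rightarrow> complex set" where
  "rect \<sigma>\<^sub>1 \<sigma>\<^sub>2 T = {s. \<sigma>\<^sub>1 < Re s \<and> Re s < \<sigma>\<^sub>2 \<and> 0 < Im s \<and> Im s < T}"

definition Gzeros :: "nat \<Rightarrow> real \<Rightarrow> real \<Rightarrow> real \<Rightarrow> complex set" where
  "Gzeros r \<sigma>\<^sub>1 \<sigma>\<^sub>2 T = {s \<in> rect \<sigma>\<^sub>1 \<sigma>\<^sub>2 T. Gdiag r s = 0}"

lemma Gdiag_nonzero_point:
  obtains s0 where "s0 \<in> half_strip" "Gdiag r s0 \<noteq> 0"
proof -
  obtain A c where A: "A > 1" "c > 0" "\<And>s. Re s = A \<Longrightarrow> norm (Fdiag r s) \<ge> c"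
    using norm_Fdiag_ge by blast
  have "Gdiag r (of_real A) \<noteq> 0"
    using A(1,2) A(3)[of "of_real A"] lam_nonzero[of "of_real A"] by (auto simp: Gdiag_eq)
  thus ?thesis using A by (intro that[of "of_real A"]) (auto simp: half_strip_def)
qed

lemma Gdiag_eventually_nonzero:
  assumes "Re z > 1/2"
  shows "\<forall>\<^sub>F w in at z. Gdiag r w \<noteq> 0"
proof -
  obtain s0 where "s0 \<in> half_strip" "Gdiag r s0 \<noteq> 0" by (rule Gdiag_nonzero_point)
  from non_zero_neighbour_alt[OF Gdiag_holomorphic open_half_strip connected_half_strip _ this, of z]
  show ?thesis using assms by (auto simp: half_strip_def elim: eventually_mono)
qed

lemma finite_Gzeros:
  assumes "1/2 < \<sigma>\<^sub>1"
  shows "finite (Gzeros r \<sigma>\<^sub>1 \<sigma>\<^sub>2 T)"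
proof (cases "Gdiag r constant_on half_strip")
  case True
  obtain s0 where "s0 \<in> half_strip" "Gdiag r s0 \<noteq> 0" by (rule Gdiag_nonzero_point)
  hence "Gzeros r \<sigma>\<^sub>1 \<sigma>\<^sub>2 T = {}"
    using True assms unfolding Gzeros_def rect_def constant_on_def half_strip_def by force
  thus ?thesis by simp
next
  case False
  have "finite {z \<in> cbox (Complex \<sigma>\<^sub>1 0) (Complex \<sigma>\<^sub>2 T). Gdiag r z = 0}"
    using assms by (intro holomorphic_compact_finite_zeros[OF Gdiag_holomorphic open_half_strip connected_half_strip _ _ False])
       (auto simp: in_cbox_complex_iff half_strip_def)
  thus ?thesis by (rule finite_subset[rotated]) (auto simp: Gzeros_def rect_def in_cbox_complex_iff)
qed

lemma Gdiag_analytic: "Re z > 1/2 \<Longrightarrow> Gdiag r analytic_on {z}"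
  using Gdiag_holomorphic open_half_strip analytic_at by (force simp: half_strip_def)

lemma lam_eventually_nonzero: "Re z \<noteq> 1 \<Longrightarrow> \<forall>\<^sub>F w in at z. lam w \<noteq> 0"
proof -
  assume z: "Re z \<noteq> 1"
  have "\<forall>\<^sub>F w in nhds z. Re w \<noteq> 1"
    using z by (intro tendsto_imp_eventually_ne[of Re "Re z"] tendsto_Re filterlim_ident) auto
  hence "\<forall>\<^sub>F w in at z. Re w \<noteq> 1" by (auto simp: eventually_at_filter elim: eventually_mono)
  thus ?thesis by (auto elim!: eventually_mono simp: lam_nonzero)
qed

text \<open>Off the line Re s = 1 the factor \<open>lam w ^ r\<close> is analytic and non-zero, so
  it does not affect orders; the non-vanishing nearby is inherited from the function on the
  connected half-plane.\<close>

lemma zorder_Fdiag: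
  assumes "Re z > 1/2" "Re z \<noteq> 1"
  shows "zorder (Fdiag r) z = zorder (Gdiag r) z" "\<forall>\<^sub>F w in at z. Fdiag r w \<noteq> 0"
proof -
  have ev: "\<forall>\<^sub>F w in at z. Gdiag r w = lam w ^ r * Fdiag r w"
    using lam_eventually_nonzero[OF assms(2)] by eventually_elim (simp add: Gdiag_eq)
  have nz: "\<forall>\<^sub>F w in at z. lam w ^ r * Fdiag r w \<noteq> 0"
    using ev Gdiag_eventually_nonzero[OF assms(1), of r] by eventually_elim simp
  thus "\<forall>\<^sub>F w in at z. Fdiag r w \<noteq> 0" by eventually_elim simp
  have an: "(\<lambda>w. lam w ^ r) analytic_on {z}"
  proof -
    have "(\<lambda>w. lam w ^ r) holomorphic_on UNIV" by (intro holomorphic_intros)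
    thus ?thesis using analytic_at by blast
  qed
  have "zorder (Gdiag r) z = zorder (\<lambda>w. lam w ^ r * Fdiag r w) z"
    using ev by (intro zorder_cong) auto
  also have "\<dots> = zorder (\<lambda>w. lam w ^ r) z + zorder (Fdiag r) z"
    using nz by (intro zorder_times_analytic an Fdiag_analytic assms)
  also have "zorder (\<lambda>w. lam w ^ r) z = 0"
    using lam_nonzero[OF assms(2)] by (intro zorder_eq_0I an) auto
  finally show "zorder (Fdiag r) z = zorder (Gdiag r) z" by simp
qed

text \<open>In the rectangle F is analytic and not locally zero, so isolated zeros are just zeros;
  filling in removable singularities changes neither the zeros nor their orders.\<close>

lemma zero_count_eq:
  assumes "1/2 < \<sigma>\<^sub>1" "\<sigma>\<^sub>2 < 1"
  shows "zero_count (euler_zagier_diag r) (rect \<sigma>\<^sub>1 \<sigma>\<^sub>2 T) = (\<Sum>z\<in>Gzeros r \<sigma>\<^sub>1 \<sigma>\<^sub>2 T. zorder (Gdiag r) z)"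
  unfolding zero_count_def
proof (rule sum.cong)
  have F: "isolated_singularity_at (Fdiag r) z" "not_essential (Fdiag r) z" for z
    using Fdiag_meromorphic[of r] meromorphic_on_isolated_singularity meromorphic_on_not_essential meromorphic_on_subset by blast+
  show "{z \<in> rect \<sigma>\<^sub>1 \<sigma>\<^sub>2 T. isolated_zero (euler_zagier_diag r) z} = Gzeros r \<sigma>\<^sub>1 \<sigma>\<^sub>2 T"
  proof -
    have "isolated_zero (euler_zagier_diag r) z \<longleftrightarrow> Gdiag r z = 0" if z: "z \<in> rect \<sigma>\<^sub>1 \<sigma>\<^sub>2 T" for z
    proof -
      have z': "Re z > 1/2" "Re z \<noteq> 1" using z assms by (auto simp: rect_def)
      have "isolated_zero (euler_zagier_diag r) z \<longleftrightarrow> isolated_zero (Fdiag r) z"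
        unfolding euler_zagier_diag_eq using F by simp
      also have "\<dots> \<longleftrightarrow> Fdiag r z = 0"
        using zorder_Fdiag(2)[OF z', of r] by (simp add: isolated_zero_analytic_iff[OF Fdiag_analytic[OF z']])
      also have "\<dots> \<longleftrightarrow> Gdiag r z = 0"
        using lam_nonzero[OF z'(2)] by (simp add: Gdiag_eq)
      finally show ?thesis .
    qed
    thus ?thesis by (auto simp: Gzeros_def)
  qed
  fix z assume "z \<in> Gzeros r \<sigma>\<^sub>1 \<sigma>\<^sub>2 T"
  hence z': "Re z > 1/2" "Re z \<noteq> 1" using assms by (auto simp: rect_def Gzeros_def)
  show "zorder (euler_zagier_diag r) z = zorder (Gdiag r) z"
    unfolding euler_zagier_diag_eq using F zorder_Fdiag(1)[OF z'] by simp
qed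

lemma zorder_Gdiag_ge_1:
  assumes "1/2 < \<sigma>\<^sub>1" "z \<in> Gzeros r \<sigma>\<^sub>1 \<sigma>\<^sub>2 T"
  shows "zorder (Gdiag r) z \<ge> 1"
proof -
  have z: "Re z > 1/2" "Gdiag r z = 0" using assms by (auto simp: Gzeros_def rect_def)
  have "isolated_zero (Gdiag r) z"
    using Gdiag_eventually_nonzero[OF z(1), of r] z by (simp add: isolated_zero_analytic_iff Gdiag_analytic)
  from zorder_isolated_zero_pos[OF this Gdiag_analytic[OF z(1)]] show ?thesis by simp
qed

section \<open>The bound of Jensen averaged over the height\<close>

lemma continuous_on_eta [continuous_intros]:
  "continuous_on A f \<Longrightarrow> continuous_on A (\<lambda>x. eta (f x))"
  using continuous_on_compose2[OF holomorphic_on_imp_continuous_on[OF eta_holomorphic[of UNIV]]] by auto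

text \<open>The inequality holds strictly at \<beta> = 1, because 2 - 2\<alpha> < 1, and persists
  slightly to the right of 1.\<close>

lemma ex_beta:
  assumes "1/2 < \<alpha>"
  obtains \<beta> :: real where "\<beta> > 1" "(2 - 2 * \<alpha>) * \<beta> < 1"
proof -
  define g where "g = 2 - 2 * \<alpha>"
  have "((\<lambda>b. g * b) \<longlongrightarrow> g * 1) (at_right 1)" by (intro tendsto_intros)
  hence "\<forall>\<^sub>F b in at_right 1. g * b < 1" by (rule order_tendstoD) (use assms in \<open>simp add: g_def\<close>)
  hence "\<forall>\<^sub>F b in at_right 1. g * b < 1 \<and> b > 1"
    by (intro eventually_conj eventually_at_right_less)
  then obtain b where "g * b < 1 \<and> b > 1" using eventually_happens by fastforce
  thus ?thesis using that[of b] by (simp add: g_def)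
qed

lemma mean_square_eta:
  assumes a: "1/2 < \<alpha>" "\<alpha> < 1"
    and I: "\<And>s. s \<in> I \<Longrightarrow> Re s \<ge> \<alpha>" "\<And>s. s \<in> I \<Longrightarrow> norm s \<le> B"
  shows "\<exists>C. \<forall>\<^sub>F T in at_top. \<forall>s\<in>I. integral {0..T} (\<lambda>t. norm (eta (s + \<i> * of_real t))^2) \<le> C * T"
proof -
  obtain \<beta> :: real where b: "\<beta> > 1" "(2 - 2 * \<alpha>) * \<beta> < 1" using ex_beta[OF a(1)] .
  define V where "V = (\<Sum>n. real (Suc n) powr -(2 * \<alpha>))"
  have sm: "summable (\<lambda>n. real (Suc n) powr -(2 * \<alpha>))"
    using a by (intro summable_powr_Suc) auto
  have V: "V \<ge> 0" unfolding V_def using sm by (intro suminf_nonneg) auto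
  have "\<forall>\<^sub>F T in at_top. \<forall>s\<in>I. integral {0..T} (\<lambda>t. norm (eta (s + \<i> * of_real t))^2) \<le> (V + 1) * T"
  proof (rule mean_square_le[OF dirichlet_approx_eta[of \<alpha> \<beta> I B]])
    fix s :: complex and M :: nat assume s: "s \<in> I"
    have "(\<Sum>m\<in>{1..M}. norm (alt m * of_nat m powr - s)^2) \<le> (\<Sum>m\<in>{1..M}. real m powr -(2 * \<alpha>))"
    proof (rule sum_mono)
      fix m assume m: "m \<in> {1..M}"
      have "norm (alt m * of_nat m powr - s) \<le> real m powr -\<alpha>"
        using m I(1)[OF s] by (auto simp: norm_mult norm_nat_powr intro!: powr_mono)
      hence "norm (alt m * of_nat m powr - s)^2 \<le> (real m powr -\<alpha>)^2" by (intro power_mono) auto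
      also have "\<dots> = real m powr -(2 * \<alpha>)"
        by (simp add: power2_eq_square flip: powr_add)
      finally show "norm (alt m * of_nat m powr - s)^2 \<le> real m powr -(2 * \<alpha>)" .
    qed
    also have "\<dots> = (\<Sum>n<M. real (Suc n) powr -(2 * \<alpha>))"
      by (rule sum.reindex_bij_witness[of _ Suc "\<lambda>n. n - 1"]) auto
    also have "\<dots> \<le> V" unfolding V_def by (intro sum_le_suminf sm) auto
    finally show "(\<Sum>m\<in>{1..M}. norm (alt m * of_nat m powr - s)^2) \<le> V" .
  qed (use a b I V in \<open>auto intro!: continuous_intros\<close>)
  thus ?thesis by blast
qed

text \<open>Fubini's theorem: a bound for the integral over t that is uniform in the point of the
  circle survives averaging over the circle.\<close>

lemma circle_mean_square_swap:
  fixes f :: "complex \<Rightarrow> real \<Rightarrow> real"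
  assumes cont: "continuous_on UNIV (\<lambda>(s, t). f s t)" and T: "T \<ge> 0" and R: "R \<ge> 0"
    and le: "\<And>s. s \<in> sphere c R \<Longrightarrow> integral {0..T} (f s) \<le> B"
  shows "(\<lambda>t. integral {0..1} (\<lambda>x. f (circlepath c R x) t)) integrable_on {0..T}"
    and "integral {0..T} (\<lambda>t. integral {0..1} (\<lambda>x. f (circlepath c R x) t)) \<le> B"
proof -
  have cc: "continuous_on UNIV (circlepath c R)"
    unfolding circlepath by (intro continuous_intros)
  have c1: "continuous_on A (\<lambda>(t, x). f (circlepath c R x) t)" for A
  proof -
    have "continuous_on A (\<lambda>z. (circlepath c R (snd z), fst z))"
      by (intro continuous_intros continuous_on_compose2[OF cc]) auto
    from continuous_on_compose2[OF cont this] show ?thesis by (simp add: case_prod_unfold)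
  qed
  have c2: "continuous_on A (\<lambda>(x, t). f (circlepath c R x) t)" for A
  proof -
    have "continuous_on A (\<lambda>z. (circlepath c R (fst z), snd z))"
      by (intro continuous_intros continuous_on_compose2[OF cc]) auto
    from continuous_on_compose2[OF cont this] show ?thesis by (simp add: case_prod_unfold)
  qed
  have "continuous_on {0..T} (\<lambda>t. integral (cbox 0 1) (\<lambda>x. f (circlepath c R x) t))"
    using integral_continuous_on_param[of "{0..T}" 0 1 "\<lambda>t x. f (circlepath c R x) t"] c1 by simp
  thus "(\<lambda>t. integral {0..1} (\<lambda>x. f (circlepath c R x) t)) integrable_on {0..T}"
    by (simp add: integrable_continuous_interval)
  have "continuous_on {0..1} (\<lambda>x. integral (cbox 0 T) (\<lambda>t. f (circlepath c R x) t))"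
    using integral_continuous_on_param[of "{0..1}" 0 T "\<lambda>x t. f (circlepath c R x) t"] c2 by simp
  hence i2: "(\<lambda>x. integral {0..T} (\<lambda>t. f (circlepath c R x) t)) integrable_on {0..1}"
    by (simp add: integrable_continuous_interval)
  have "integral {0..T} (\<lambda>t. integral {0..1} (\<lambda>x. f (circlepath c R x) t))
     = integral {0..1} (\<lambda>x. integral {0..T} (\<lambda>t. f (circlepath c R x) t))"
    using integral_swap_continuous[of 0 0 T 1 "\<lambda>t x. f (circlepath c R x) t"] c1 by simp
  also have "\<dots> \<le> integral {0..1} (\<lambda>x::real. B)"
  proof (rule integral_le[OF i2])
    fix x :: real assume "x \<in> {0..1}"
    hence "circlepath c R x \<in> sphere c R" using R path_image_circlepath[of c R] by (auto simp: path_image_def)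
    thus "integral {0..T} (\<lambda>t. f (circlepath c R x) t) \<le> B" using le by simp
  qed auto
  finally show "integral {0..T} (\<lambda>t. integral {0..1} (\<lambda>x. f (circlepath c R x) t)) \<le> B" by simp
qed

lemma norm_Gdiag_le:
  assumes "1/2 < a"
  obtains B where "B \<ge> 1" "\<And>z. Re z \<ge> a \<Longrightarrow> norm (Gdiag r z) \<le> (B * (1 + norm (eta z))) ^ r"
proof -
  define Z where "Z = (\<Sum>n. real (Suc n) powr - (2 * a))"
  have Z0: "Z \<ge> 0" unfolding Z_def using assms by (intro suminf_nonneg summable_powr_Suc) auto
  define B where "B = 3 ^ r * (Z + 1)"
  have B1: "B \<ge> 1 * 1" unfolding B_def using Z0 by (intro mult_mono) auto
  show ?thesis
  proof (rule that[of B])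
    show "B \<ge> 1" using B1 by simp
    fix z assume z: "Re z \<ge> a"
    have "norm (esym r (\<lambda>k. if k = 1 then eta z else lam z ^ k * zetam (of_nat k * z))) 
      \<le> (B * (1 + norm (if (1::nat) = 1 then eta z else lam z ^ 1 * zetam (of_nat 1 * z)))) ^ r"
    proof (rule norm_esym_le)
      fix k assume k: "2 \<le> k" "k \<le> r"
      have kz: "Re (of_nat k * z) \<ge> 2 * a"
      proof -
        have "2 * a \<le> real k * Re z" using k z assms by (intro mult_mono) auto
        thus ?thesis by simp
      qed
      hence "zetam (of_nat k * z) = zeta_series (of_nat k * z)" using assms by (intro zetam_eq_zeta_series) linarith
      hence "norm (zetam (of_nat k * z)) \<le> Z" using norm_zeta_series_le[OF kz] assms by (simp add: Z_def)
      moreover have "norm (lam z) ^ k \<le> 3 ^ r"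
      proof -
        have "norm (lam z) ^ k \<le> 3 ^ k" using norm_lam_le[of z] z assms by (intro power_mono) auto
        also have "\<dots> \<le> (3::real) ^ r" using k by (intro power_increasing) auto
        finally show ?thesis .
      qed
      ultimately have "norm (lam z) ^ k * norm (zetam (of_nat k * z)) \<le> 3 ^ r * (Z + 1)"
        using Z0 by (intro mult_mono) auto
      thus "norm (if k = 1 then eta z else lam z ^ k * zetam (of_nat k * z)) \<le> B"
        using k by (simp add: B_def norm_mult norm_power)
    qed (use B1 in simp)
    thus "norm (Gdiag r z) \<le> (B * (1 + norm (eta z))) ^ r" by (simp add: Gdiag_def)
  qed
qed

text \<open>Jensen's inequality in the disc about A + it bounds the number of zeros at heights near
  t by a linear function of the local mean square \<open>Q t\<close>. Integrated over t, every zero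
  is counted on an interval of length h, while the integral of Q is O(T).\<close>

lemma zero_count_upper:
  assumes s: "1/2 < \<sigma>\<^sub>1" "\<sigma>\<^sub>1 < \<sigma>\<^sub>2" "\<sigma>\<^sub>2 < 1"
  shows "\<exists>C. \<forall>\<^sub>F T in at_top. of_int (zero_count (euler_zagier_diag r) (rect \<sigma>\<^sub>1 \<sigma>\<^sub>2 T)) \<le> C * T"
proof -
  obtain a where a: "1/2 < a" "a < \<sigma>\<^sub>1" using dense[OF s(1)] by blast
  obtain b where b: "1/2 < b" "b < a" using dense[OF a(1)] by blast
  obtain A c0 where A: "A > 1" "c0 > 0" "\<And>s. Re s = A \<Longrightarrow> norm (Fdiag r s) \<ge> c0"
    using norm_Fdiag_ge by blast
  define R where "R = A - a"
  define R2 where "R2 = A - b"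
  \<comment> \<open>Halfway between A - \<open>\<sigma>\<^sub>1\<close> and R. The surplus h over A
    - \<open>\<sigma>\<^sub>1\<close> is the height up to which the inner disc is sure to cover the
    strip, by |Re| + |Im| \<le> r0.\<close>
  define r0 where "r0 = (A - \<sigma>\<^sub>1 + R) / 2"
  define h where "h = r0 - (A - \<sigma>\<^sub>1)"
  have R: "0 < r0" "r0 < R" "R < R2" "h > 0" "0 < R"
    using a b s A by (auto simp: R_def R2_def r0_def h_def)
  obtain B where B: "B \<ge> 1" "\<And>z. Re z \<ge> a \<Longrightarrow> norm (Gdiag r z) \<le> (B * (1 + norm (eta z))) ^ r"
    using norm_Gdiag_le[OF a(1)] by blast
  define Q where "Q = (\<lambda>t. R2 / (R2 - R) * integral {0..1} (\<lambda>x. norm (eta (circlepath (of_real A) R2 x + \<i> * of_real t)) ^ 2))"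
  define c1 where "c1 = (1 - 2 powr (1 - A)) ^ r * c0"
  have l1: "1 - 2 powr (1 - A) > 0" using A powr_less_mono[of "1 - A" 0 2] by simp
  hence c1: "c1 > 0" using A by (simp add: c1_def)
  define L where "L = ln (R / r0)"
  have L: "L > 0" using R by (simp add: L_def)
  define K where "K = real r * ln B + real r - ln c1"
  have key: "of_int (\<Sum>z\<in>S. zorder (Gdiag r) z) * L \<le> K + real r * Q t"
    if S: "finite S" "\<And>z. z \<in> S \<Longrightarrow> \<sigma>\<^sub>1 < Re z \<and> Re z < \<sigma>\<^sub>2 \<and> \<bar>Im z - t\<bar> \<le> h" for S t
  proof -
    define c where "c = of_real A + \<i> * of_real t"
    have Rec: "Re c = A" "Im c = t" by (auto simp: c_def)
    have bd: "norm (eta z) ^ 2 \<le> Q t" if "dist c z \<le> R" for z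
    proof -
      have "circlepath c R2 x = circlepath (of_real A) R2 x + \<i> * of_real t" for x
        by (simp add: circlepath c_def)
      thus ?thesis using norm_square_le_circle_integral[of eta c R2 z R] that R eta_holomorphic
        by (simp add: Q_def)
    qed
    have Q0: "Q t \<ge> 0" using order_trans[OF zero_le_power2 bd[of c]] R by simp
    have Rez: "Re z \<ge> a" if "dist c z \<le> R" for z
    proof -
      have "\<bar>Re (c - z)\<bar> \<le> R" using that abs_Re_le_cmod[of "c - z"] by (simp add: dist_norm)
      thus ?thesis using Rec by (simp add: R_def)
    qed
    define M where "M = (B * (1 + sqrt (Q t))) ^ r"
    have Gc: "norm (Gdiag r c) \<ge> c1"
    proof -
      have "norm (lam c) \<ge> 1 - 2 powr (1 - A)" using norm_lam_ge[of c] Rec by simp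
      hence "norm (lam c) ^ r \<ge> (1 - 2 powr (1 - A)) ^ r" using l1 by (intro power_mono) auto
      hence "norm (lam c) ^ r * norm (Fdiag r c) \<ge> c1"
        unfolding c1_def using A Rec l1 by (intro mult_mono) auto
      moreover have "lam c \<noteq> 0" using Rec A by (intro lam_nonzero) auto
      ultimately show ?thesis by (simp add: Gdiag_eq norm_mult norm_power)
    qed
    have "of_int (\<Sum>z\<in>S. zorder (Gdiag r) z) * ln (R / r0) \<le> ln (M / norm (Gdiag r c))"
    proof (rule sum_zorder_le[OF open_half_strip connected_half_strip])
      show "cball c R \<subseteq> half_strip" using Rez a by (force simp: half_strip_def)
      show "S \<subseteq> cball c r0"
      proof
        fix z assume z: "z \<in> S"
        have "norm (c - z) \<le> \<bar>Re (c - z)\<bar> + \<bar>Im (c - z)\<bar>" by (rule cmod_le)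
        also have "\<dots> \<le> r0" using S(2)[OF z] Rec A s by (auto simp: h_def abs_if split: if_splits)
        finally show "z \<in> cball c r0" by (simp add: dist_norm)
      qed
      show "Gdiag r c \<noteq> 0" using Gc c1 by auto
      fix z assume "z \<in> sphere c R"
      hence z: "dist c z \<le> R" by simp
      have "norm (Gdiag r z) \<le> (B * (1 + norm (eta z))) ^ r" using B(2) Rez[OF z] by blast
      also have "\<dots> \<le> M" unfolding M_def using B(1) bd[OF z]
        by (intro power_mono mult_left_mono add_left_mono real_le_rsqrt) auto
      finally show "norm (Gdiag r z) \<le> M" .
    qed (use R S Gdiag_holomorphic in auto)
    also have "\<dots> \<le> ln (M / c1)"
      using Gc c1 B(1) Q0 by (intro ln_mono divide_left_mono divide_pos_pos) (auto simp: M_def add_pos_nonneg intro!: mult_pos_pos)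
    also have "\<dots> = ln M - ln c1"
      using c1 B(1) Q0 by (intro ln_divide_pos) (auto simp: M_def add_pos_nonneg)
    also have "ln M = real r * (ln B + ln (1 + sqrt (Q t)))"
      using B(1) Q0 by (simp add: M_def ln_realpow ln_mult_pos add_pos_nonneg)
    \<comment> \<open>A bound that is linear in \<open>Q t\<close> suffices, since only the integral
      of Q over t is going to be used.\<close>
    also have "ln (1 + sqrt (Q t)) \<le> sqrt (Q t)" using Q0 by (intro ln_add_one_self_le_self) auto
    also have "sqrt (Q t) \<le> 1 + Q t"
    proof -
      have "0 \<le> (sqrt (Q t) - 1)^2" by simp
      also have "\<dots> = Q t - 2 * sqrt (Q t) + 1" using Q0 by (simp add: power2_diff)
      finally show ?thesis using real_sqrt_ge_zero[OF Q0] by linarith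
    qed
    finally have "of_int (\<Sum>z\<in>S. zorder (Gdiag r) z) * ln (R / r0) \<le> real r * (ln B + (1 + Q t)) - ln c1"
      by (simp add: mult_left_mono)
    thus ?thesis unfolding L_def K_def by (simp add: algebra_simps)
  qed
  define I where "I = sphere (complex_of_real A) R2"
  have I: "Re s \<ge> b" "norm s \<le> A + R2" if "s \<in> I" for s
  proof -
    have d: "norm (of_real A - s) = R2" using that by (simp add: I_def dist_norm)
    show "Re s \<ge> b" using abs_Re_le_cmod[of "of_real A - s"] d by (simp add: R2_def)
    show "norm s \<le> A + R2" using norm_triangle_sub[of s "of_real A"] d A by (simp add: norm_minus_commute)
  qed
  have "b < 1" using b a s by simp
  from mean_square_eta[OF b(1) this I] obtain C where
    C: "\<forall>\<^sub>F T in at_top. \<forall>s\<in>I. integral {0..T} (\<lambda>t. norm (eta (s + \<i> * of_real t))^2) \<le> C * T" by blast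
  have cont: "continuous_on UNIV (\<lambda>(s, t). norm (eta (s + \<i> * of_real t))^2)"
    by (auto simp: case_prod_unfold intro!: continuous_intros)
  have "\<forall>\<^sub>F T in at_top. of_int (zero_count (euler_zagier_diag r) (rect \<sigma>\<^sub>1 \<sigma>\<^sub>2 T)) \<le> ((K + real r * (R2 / (R2 - R) * C)) / (h * L)) * T"
    using C eventually_ge_at_top[of "2 * h"]
  proof eventually_elim
    case (elim T)
    have T: "T \<ge> 0" using elim R by linarith
    define S where "S = Gzeros r \<sigma>\<^sub>1 \<sigma>\<^sub>2 T"
    have S: "finite S" unfolding S_def using s by (intro finite_Gzeros)
    define m where "m = (\<lambda>z. of_int (zorder (Gdiag r) z) :: real)"
    have m0: "m z \<ge> 0" if "z \<in> S" for z using zorder_Gdiag_ge_1[OF s(1), of z] that by (force simp: S_def m_def)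
    \<comment> \<open>Lower end of an interval of length h that has Im z as an endpoint and stays
      inside [0, T]. For zeros of height below h it extends upwards, which fits because T \<ge> 2
      h.\<close>
    define e where "e = (\<lambda>z::complex. if Im z \<ge> h then Im z - h else Im z)"
    have e: "{e z..e z + h} \<subseteq> {0..T}" "\<And>t. t \<in> {e z..e z + h} \<Longrightarrow> \<bar>Im z - t\<bar> \<le> h" if "z \<in> S" for z
      using that elim R by (auto simp: e_def S_def Gzeros_def rect_def split: if_splits)
    have qi: "Q integrable_on {0..T}" "integral {0..T} Q \<le> R2 / (R2 - R) * (C * T)"
    proof -
      note sw = circle_mean_square_swap[OF cont T, of R2 "of_real A" "C * T"]
      show "Q integrable_on {0..T}" unfolding Q_def
        using sw(1) elim R by (intro integrable_on_mult_right) (auto simp: I_def)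
      show "integral {0..T} Q \<le> R2 / (R2 - R) * (C * T)" unfolding Q_def
        using sw(2) elim R by (auto simp: I_def intro!: mult_left_mono divide_right_mono)
    qed
    have ind: "((\<lambda>t. if t \<in> {e z..e z + h} then (1::real) else 0) has_integral h) {0..T}" if "z \<in> S" for z
      using has_integral_const_real[of "1::real" "e z" "e z + h"] R e(1)[OF that] by (subst has_integral_restrict) auto
    have hi: "((\<lambda>t. (\<Sum>z\<in>S. m z * (if t \<in> {e z..e z + h} then 1 else 0)) * L) has_integral ((\<Sum>z\<in>S. m z * h) * L)) {0..T}"
      by (intro has_integral_mult_left has_integral_sum has_integral_mult_right ind S)
    have "(\<Sum>z\<in>S. m z * h) * L \<le> integral {0..T} (\<lambda>t. K + real r * Q t)"
    proof (rule has_integral_le[OF hi])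
      show "((\<lambda>t. K + real r * Q t) has_integral integral {0..T} (\<lambda>t. K + real r * Q t)) {0..T}"
        using qi(1) by (intro integrable_integral integrable_add integrable_on_mult_right) auto
      fix t assume "t \<in> {0..T}"
      have "(\<Sum>z\<in>S. m z * (if t \<in> {e z..e z + h} then 1 else 0)) = (\<Sum>z\<in>{z\<in>S. t \<in> {e z..e z + h}}. m z)"
        using S by (subst sum.inter_filter) (auto intro!: sum.cong)
      also have "\<dots> = of_int (\<Sum>z\<in>{z\<in>S. t \<in> {e z..e z + h}}. zorder (Gdiag r) z)"
        by (simp add: m_def)
      also have "\<dots> * L \<le> K + real r * Q t"
      proof (rule key)
        show "finite {z \<in> S. t \<in> {e z..e z + h}}" using S by simp
        fix z assume z: "z \<in> {z \<in> S. t \<in> {e z..e z + h}}"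
        thus "\<sigma>\<^sub>1 < Re z \<and> Re z < \<sigma>\<^sub>2 \<and> \<bar>Im z - t\<bar> \<le> h"
          using e(2)[of z t] by (simp add: S_def Gzeros_def rect_def)
      qed
      finally show "(\<Sum>z\<in>S. m z * (if t \<in> {e z..e z + h} then 1 else 0)) * L \<le> K + real r * Q t" .
    qed
    also have "\<dots> = K * T + real r * integral {0..T} Q"
      using qi(1) T by (subst integral_add) (auto intro!: integrable_on_mult_right simp: mult.commute)
    also have "\<dots> \<le> K * T + real r * (R2 / (R2 - R) * (C * T))"
      using qi(2) by (intro add_left_mono mult_left_mono) auto
    finally have "(\<Sum>z\<in>S. m z) * (h * L) \<le> (K + real r * (R2 / (R2 - R) * C)) * T"
      unfolding sum_distrib_right[symmetric] by (simp add: algebra_simps)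
    hence "(\<Sum>z\<in>S. m z) \<le> ((K + real r * (R2 / (R2 - R) * C)) / (h * L)) * T"
      using R L by (simp add: pos_le_divide_eq mult_ac)
    thus ?case using s by (simp add: zero_count_eq S_def m_def)
  qed
  thus ?thesis by blast
qed

section \<open>Sieved Dirichlet series\<close>

definition rough :: "nat set \<Rightarrow> nat \<Rightarrow> bool" where
  "rough P m \<longleftrightarrow> (\<forall>p\<in>P. \<not> p dvd m)"

definition smooth :: "nat set \<Rightarrow> nat \<Rightarrow> bool" where
  "smooth P m \<longleftrightarrow> m > 0 \<and> prime_factors m \<subseteq> P"

lemma rough_insert: "rough (insert p P) m \<longleftrightarrow> \<not> p dvd m \<and> rough P m"
  by (auto simp: rough_def)

lemma rough_prime_mult:
  assumes "prime p" "p \<notin> P" "\<And>q. q \<in> P \<Longrightarrow> prime q"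
  shows "rough P (p * m) \<longleftrightarrow> rough P m"
proof -
  have "q dvd p * m \<longleftrightarrow> q dvd m" if "q \<in> P" for q
    using assms that by (metis prime_dvd_mult_iff primes_dvd_imp_eq)
  thus ?thesis by (auto simp: rough_def)
qed

lemma coprime_smooth_rough:
  assumes "smooth P m" "rough P n"
  shows "coprime m n"
proof (rule ccontr)
  assume "\<not> coprime m n"
  hence "gcd m n \<noteq> 1" by (simp add: coprime_iff_gcd_eq_1)
  then obtain p where "prime p" "p dvd gcd m n" using prime_factor_nat by blast
  hence "prime p" "p dvd m" "p dvd n" by auto
  moreover from this have "p \<in> P" using assms(1) by (auto simp: smooth_def in_prime_factors_iff)
  ultimately show False using assms(2) by (auto simp: rough_def)
qed

text \<open>A smooth and a rough number are coprime, so each of the two smooth factors divides the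
  other.\<close>

lemma smooth_rough_unique:
  assumes "smooth P m" "smooth P m'" "rough P n" "rough P n'" "m * n = m' * n'"
  shows "m = m'"
proof (rule dvd_antisym)
  show "m dvd m'" using coprime_smooth_rough[OF assms(1,4)] assms(5)
    by (metis coprime_dvd_mult_left_iff dvd_triv_left)
  show "m' dvd m" using coprime_smooth_rough[OF assms(2,3)] assms(5)
    by (metis coprime_dvd_mult_left_iff dvd_triv_left)
qed

lemma rough_gt:
  assumes "rough {p. prime p \<and> p \<le> N} m" "m \<noteq> 1"
  shows "m > N \<or> m = 0"
proof (rule ccontr)
  assume m: "\<not> (m > N \<or> m = 0)"
  obtain p where "prime p" "p dvd m" using assms(2) prime_factor_nat by blast
  moreover from this have "p \<le> m" using m by (intro dvd_imp_le) auto
  ultimately show False using assms(1) m by (auto simp: rough_def)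
qed

lemma finite_primes_le [simp, intro]: "finite {p::nat. prime p \<and> p \<le> N}"
  by (rule finite_subset[of _ "{..N}"]) auto

lemma powr_nat_mult: "m > 0 \<Longrightarrow> n > 0 \<Longrightarrow> (of_nat (m * n) :: complex) powr w = of_nat m powr w * of_nat n powr w"
proof -
  assume "m > 0" "n > 0"
  have "of_nat (m * n) = complex_of_real (real m) * complex_of_real (real n)" by simp
  also have "\<dots> powr w = of_nat m powr w * of_nat n powr w"
    by (subst powr_times_real) auto
  finally show ?thesis .
qed

text \<open>Multiplication by 1 - p^(-w) subtracts the terms divisible by p. Index n stands for the
  integer n + 1, so these sit at the indices \<open>p * Suc m - 1\<close>.\<close>

lemma zeta_sieve:
  assumes "finite P" "\<And>p. p \<in> P \<Longrightarrow> prime p" "Re w > 1"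
  shows "(\<lambda>n. if rough P (Suc n) then of_nat (Suc n) powr - w else 0) sums
           (zeta_series w * (\<Prod>p\<in>P. 1 - of_nat p powr - w))"
  using assms(1,2)
proof (induction P)
  case empty
  show ?case using zeta_series_sums[OF assms(3)] by (simp add: rough_def)
next
  case (insert p P)
  define f where "f = (\<lambda>n. if rough P (Suc n) then of_nat (Suc n) powr - w else (0::complex))"
  define V where "V = zeta_series w * (\<Prod>p\<in>P. 1 - of_nat p powr - w)"
  have f: "f sums V" unfolding f_def V_def using insert by auto
  have p: "prime p" "p > 0" using insert by (auto simp: prime_gt_0_nat)
  define g where "g = (\<lambda>n. if p dvd Suc n then f n else 0)"
  have "(\<lambda>m. g (p * Suc m - 1)) sums (of_nat p powr - w * V)"
  proof -
    have "g (p * Suc m - 1) = of_nat p powr - w * f m" for m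
    proof -
      have e: "Suc (p * Suc m - 1) = p * Suc m" using p by simp
      have pw: "of_nat (p * Suc m) powr - w = (of_nat p powr - w * of_nat (Suc m) powr - w :: complex)"
        using p by (intro powr_nat_mult) auto
      have "rough P (p * Suc m) \<longleftrightarrow> rough P (Suc m)" using insert by (intro rough_prime_mult) auto
      thus ?thesis unfolding g_def f_def e pw by simp
    qed
    thus ?thesis using sums_mult[OF f] by simp
  qed
  hence "g sums (of_nat p powr - w * V)"
  proof (subst (asm) sums_mono_reindex)
    show "strict_mono (\<lambda>m. p * Suc m - 1)"
    proof (rule strict_monoI)
      fix a b :: nat assume "a < b"
      hence "p * Suc a < p * Suc b" using p by simp
      moreover have "p * Suc a > 0" using p by simp
      ultimately show "p * Suc a - 1 < p * Suc b - 1" by linarith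
    qed
    fix n assume n: "n \<notin> range (\<lambda>m. p * Suc m - 1)"
    have "\<not> p dvd Suc n"
    proof
      assume "p dvd Suc n"
      then obtain k where k: "Suc n = p * k" by auto
      hence "k > 0" by (cases k) auto
      then obtain m where "k = Suc m" by (cases k) auto
      hence "n = p * Suc m - 1" using k by simp
      thus False using n by blast
    qed
    thus "g n = 0" by (simp add: g_def)
  qed
  from sums_diff[OF f this] have "(\<lambda>n. f n - g n) sums (V - of_nat p powr - w * V)" .
  moreover have "(\<lambda>n. f n - g n) = (\<lambda>n. if rough (insert p P) (Suc n) then of_nat (Suc n) powr - w else 0)"
    by (auto simp: f_def g_def rough_insert fun_eq_iff)
  moreover have "V - of_nat p powr - w * V = zeta_series w * (\<Prod>p\<in>insert p P. 1 - of_nat p powr - w)"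
    using insert by (simp add: V_def algebra_simps)
  ultimately show ?case by simp
qed

section \<open>The zeta-function compared with its Euler product over the primes up to N\<close>

text \<open>The part of the series of \<zeta>(a) that runs over the integers larger than N.\<close>

definition ztail :: "nat \<Rightarrow> real \<Rightarrow> real" where
  "ztail N a = (\<Sum>n. real (Suc (n + N)) powr - a)"

lemma summable_ztail: "a > 1 \<Longrightarrow> summable (\<lambda>n. real (Suc (n + N)) powr - a)"
  using summable_fdiff_bound[of "Suc N" a] by simp

lemma ztail_nonneg: "a > 1 \<Longrightarrow> ztail N a \<ge> 0"
  unfolding ztail_def by (intro suminf_nonneg summable_ztail) auto

lemma ztail_tendsto_0:
  assumes "a > 1"
  shows "(\<lambda>N. ztail N a) \<longlonglongrightarrow> 0"
proof -
  let ?f = "\<lambda>n. real (Suc n) powr - a"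
  have sm: "summable ?f" using assms by (rule summable_powr_Suc)
  have "ztail N a = suminf ?f - (\<Sum>n<N. ?f n)" for N
    unfolding ztail_def using suminf_minus_initial_segment[OF sm, of N] by simp
  moreover have "(\<lambda>N. suminf ?f - (\<Sum>n<N. ?f n)) \<longlonglongrightarrow> suminf ?f - suminf ?f"
    by (intro tendsto_intros summable_LIMSEQ sm)
  ultimately show ?thesis by simp
qed

text \<open>After sieving by all primes up to N, only the term 1 and integers above N
  survive.\<close>

lemma zeta_euler_product_approx:
  assumes "N \<ge> 1" "Re w \<ge> a" "a > 1"
  shows "norm (zeta_series w * (\<Prod>p | prime p \<and> p \<le> N. 1 - of_nat p powr - w) - 1) \<le> ztail N a"
proof -
  let ?P = "{p. prime p \<and> p \<le> N}"
  define f where "f = (\<lambda>n. if rough ?P (Suc n) then of_nat (Suc n) powr - w else (0::complex))"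
  have f: "f sums (zeta_series w * (\<Prod>p\<in>?P. 1 - of_nat p powr - w))"
    unfolding f_def using assms by (intro zeta_sieve) auto
  have sf: "summable f" using f by (rule sums_summable)
  have "(\<Sum>n<N. f n) = (\<Sum>n<N. if n = 0 then 1 else 0)"
  proof (rule sum.cong)
    fix n assume n: "n \<in> {..<N}"
    show "f n = (if n = 0 then 1 else 0)"
    proof (cases "n = 0")
      case True
      have "rough ?P (Suc 0)" by (auto simp: rough_def dest: prime_nat_iff[THEN iffD1])
      thus ?thesis using True by (simp add: f_def)
    next
      case False
      hence "\<not> rough ?P (Suc n)" using rough_gt[of N "Suc n"] n by auto
      thus ?thesis using False by (simp add: f_def)
    qed
  qed auto
  also have "\<dots> = 1" using assms by simp
  finally have 1: "(\<Sum>n<N. f n) = 1" .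
  have "zeta_series w * (\<Prod>p\<in>?P. 1 - of_nat p powr - w) - 1 = (\<Sum>n. f (n + N))"
    using suminf_minus_initial_segment[OF sf, of N] 1 f by (simp add: sums_iff)
  also have "norm \<dots> \<le> ztail N a" unfolding ztail_def
  proof (rule norm_suminf_le)
    fix n
    have "norm (f (n + N)) \<le> norm (of_nat (Suc (n + N)) powr - w :: complex)" by (simp add: f_def del: of_nat_Suc of_nat_add)
    also have "\<dots> \<le> real (Suc (n + N)) powr - a"
      unfolding norm_nat_powr[OF zero_less_Suc] using assms by (intro powr_mono) auto
    finally show "norm (f (n + N)) \<le> real (Suc (n + N)) powr - a" .
  qed (rule summable_ztail[OF assms(3)])
  finally show ?thesis .
qed

text \<open>\<open>Hfun P z = (1 - 2\<^sup>1\<^sup>-\<^sup>z) (\<zeta>(z) \<Prod> (1 - p\<^sup>-\<^sup>z) - 1)\<close>, with the pole at \<open>z = 1\<close> removed.\<close>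

definition Hfun :: "nat set \<Rightarrow> complex \<Rightarrow> complex" where
  "Hfun P z = eta z * (\<Prod>p\<in>P. 1 - of_nat p powr - z) - lam z"

lemma Hfun_holomorphic:
  "finite P \<Longrightarrow> (\<And>p. p \<in> P \<Longrightarrow> p > 0) \<Longrightarrow> Hfun P holomorphic_on A"
  unfolding Hfun_def by (intro holomorphic_intros) auto

lemma dirichlet_approx_cong:
  assumes "dirichlet_approx \<alpha> \<beta> I f c"
    and "\<And>i t. i \<in> I \<Longrightarrow> f i t = g i t" "\<And>i m. i \<in> I \<Longrightarrow> m > 0 \<Longrightarrow> c i m = d i m"
  shows "dirichlet_approx \<alpha> \<beta> I g d"
proof -
  have "(\<Sum>m\<in>{1..M}. c i m * nit m t) = (\<Sum>m\<in>{1..M}. d i m * nit m t)" if "i \<in> I" for i M t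
    using assms(3)[OF that] by (intro sum.cong) auto
  thus ?thesis using assms unfolding dirichlet_approx_def by (simp cong: ball_cong)
qed

definition rind :: "nat set \<Rightarrow> nat \<Rightarrow> complex" where
  "rind P m = (if rough P m then 1 else 0)"

lemma rind_insert:
  assumes "prime p" "p \<notin> P" "\<And>q. q \<in> P \<Longrightarrow> prime q"
  shows "rind (insert p P) m = rind P m - (if p dvd m then rind P (m div p) else 0)"
proof (cases "p dvd m")
  case True
  then obtain k where "m = p * k" by auto
  thus ?thesis using rough_prime_mult[OF assms] assms(1) by (auto simp: rind_def rough_insert)
qed (auto simp: rind_def rough_insert)

text \<open>The alternating coefficients are those of \<zeta> minus twice their dilate by 2. Each
  factor 1 - p^(-s-it) is a subtraction of the dilate by p, and this sieving acts on both parts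
  separately.\<close>

lemma dirichlet_approx_sieved_eta:
  assumes ab: "0 < \<alpha>" "\<beta> > 1"
    and I: "\<And>s. s \<in> I \<Longrightarrow> Re s \<ge> \<alpha>" "\<And>s. s \<in> I \<Longrightarrow> norm s \<le> B"
    and P: "finite P" "\<And>p. p \<in> P \<Longrightarrow> prime p"
  shows "dirichlet_approx \<alpha> \<beta> I (\<lambda>s t. eta (s + \<i> * of_real t) * (\<Prod>p\<in>P. 1 - of_nat p powr - s * nit p t))
     (\<lambda>s m. of_nat m powr - s * (rind P m - (if 2 dvd m then 2 * rind P (m div 2) else 0)))"
  using P
proof (induction P)
  case empty
  show ?case
    by (rule dirichlet_approx_cong[OF dirichlet_approx_eta[OF ab I]]) (auto simp: rind_def rough_def alt_def)
next
  case (insert p P)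
  define E where "E = (\<lambda>s t. eta (s + \<i> * of_real t) * (\<Prod>p\<in>P. 1 - of_nat p powr - s * nit p t))"
  define c where "c = (\<lambda>s m. of_nat m powr - s * (rind P m - (if 2 dvd m then 2 * rind P (m div 2) else 0)))"
  have IH: "dirichlet_approx \<alpha> \<beta> I E c" unfolding E_def c_def using insert by auto
  have p: "prime p" "p > 0" using insert by (auto simp: prime_gt_0_nat)
  have "dirichlet_approx \<alpha> \<beta> I (\<lambda>s t. E s t - of_nat p powr - s * (nit p t * E s t))
     (\<lambda>s m. c s m - of_nat p powr - s * (if p dvd m then c s (m div p) else 0))"
  proof (intro dirichlet_approx_diff dirichlet_approx_cmult dirichlet_approx_dilate IH)
    fix s assume s: "s \<in> I"
    show "norm (of_nat p powr - s :: complex) \<le> real p powr - \<alpha>"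
      using I(1)[OF s] p by (auto simp: norm_nat_powr intro!: powr_mono)
  qed (use p ab in auto)
  thus ?case
  proof (rule dirichlet_approx_cong)
    fix s t
    show "E s t - of_nat p powr - s * (nit p t * E s t) = eta (s + \<i> * of_real t) * (\<Prod>p\<in>insert p P. 1 - of_nat p powr - s * nit p t)"
      using insert by (simp add: E_def algebra_simps)
  next
    fix s and m :: nat assume m: "m > 0"
    have ri: "rind (insert p P) k = rind P k - (if p dvd k then rind P (k div p) else 0)" for k
      using insert by (intro rind_insert) auto
    show "c s m - of_nat p powr - s * (if p dvd m then c s (m div p) else 0)
        = of_nat m powr - s * (rind (insert p P) m - (if 2 dvd m then 2 * rind (insert p P) (m div 2) else 0))"
    proof (cases "p dvd m")
      case True
      then obtain k where k: "m = p * k" by auto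
      have "k > 0" using m k by (cases k) auto
      have pk: "of_nat p powr - s * of_nat k powr - s = (of_nat m powr - s :: complex)"
        using powr_nat_mult[of p k "-s"] p \<open>k > 0\<close> k by simp
      have "c s m - of_nat p powr - s * (if p dvd m then c s (m div p) else 0)
         = of_nat m powr - s * (rind P m - (if 2 dvd m then 2 * rind P (m div 2) else 0))
           - of_nat m powr - s * (rind P k - (if 2 dvd k then 2 * rind P (k div 2) else 0))"
      proof -
        have "(if p dvd m then c s (m div p) else 0) = c s k" using k p by simp
        moreover have "of_nat p powr - s * c s k = of_nat m powr - s * (rind P k - (if 2 dvd k then 2 * rind P (k div 2) else 0))"
          unfolding c_def by (simp only: mult.assoc[symmetric] pk)
        ultimately show ?thesis by (simp only: c_def)
      qed
      also have "\<dots> = of_nat m powr - s * (rind (insert p P) m - (if 2 dvd m then 2 * rind (insert p P) (m div 2) else 0))"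
      proof -
        have r1: "rind (insert p P) m = rind P m - rind P k" using k p by (simp add: ri)
        \<comment> \<open>Dilation by 2 commutes with sieving by p. Only for p = 2 can m be even
          while its quotient k by p is odd.\<close>
        have r2: "(if 2 dvd m then 2 * rind (insert p P) (m div 2) else 0)
           = (if 2 dvd m then 2 * rind P (m div 2) else 0) - (if 2 dvd k then 2 * rind P (k div 2) else 0)"
        proof (cases "even k")
          case True
          then obtain l where l: "k = 2 * l" by auto
          hence "m div 2 = p * l" "even m" using k by auto
          thus ?thesis using l p by (simp add: ri)
        next
          case False
          show ?thesis
          proof (cases "even m")
            case True
            hence "even p" using k False by auto
            hence "p = 2" using p(1) primes_dvd_imp_eq two_is_prime_nat by blast
            hence "m div 2 = k" using k by simp
            thus ?thesis using True False \<open>p = 2\<close> ri[of k] by simp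
          qed (use False in auto)
        qed
        show ?thesis unfolding r1 r2 by (simp add: algebra_simps)
      qed
      finally show ?thesis .
    next
      case False
      have "\<not> p dvd m div 2" if "even m"
        using False that by (metis dvd_div_mult_self dvd_mult2)
      thus ?thesis using False by (simp add: c_def ri)
    qed
  qed
qed

text \<open>By unique factorisation into a smooth and a rough part, at most one n contributes for
  each m. The squares add up without cross terms, so the bound is linear in the number of elements
  of S instead of quadratic.\<close>

lemma sum_norm_square_smooth_rough:
  fixes e r :: "nat \<Rightarrow> complex"
  assumes S: "finite S" "\<And>n. n \<in> S \<Longrightarrow> smooth P n"
    and e: "\<And>n. n \<in> S \<Longrightarrow> norm (e n) \<le> 1"
    and r: "\<And>k. k > 0 \<Longrightarrow> \<not> rough P k \<Longrightarrow> r k = 0"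
    and V: "\<And>M. (\<Sum>k\<in>{1..M}. norm (r k)^2) \<le> V"
  shows "(\<Sum>m\<in>{1..M}. norm (\<Sum>n\<in>S. if n dvd m then e n * r (m div n) else 0)^2) \<le> real (card S) * V"
proof -
  have one: "norm (\<Sum>n\<in>S. if n dvd m then e n * r (m div n) else 0)^2
      \<le> (\<Sum>n\<in>S. if n dvd m then norm (r (m div n))^2 else 0)" if m: "m > 0" for m
  proof (cases "\<exists>n\<in>S. n dvd m \<and> r (m div n) \<noteq> 0")
    case False
    hence "(\<Sum>n\<in>S. if n dvd m then e n * r (m div n) else 0) = 0" by (intro sum.neutral) auto
    thus ?thesis by (simp add: sum_nonneg)
  next
    case True
    then obtain n where n: "n \<in> S" "n dvd m" "r (m div n) \<noteq> 0" by blast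
    have uniq: "n' = n" if "n' \<in> S" "n' dvd m" "r (m div n') \<noteq> 0" for n'
    proof -
      have pos: "m div n' > 0" "m div n > 0" using that n m by (metis div_greater_zero_iff dvd_imp_le dvd_pos_nat)+
      show ?thesis
        using that n S pos r by (intro smooth_rough_unique[of P n' n "m div n'" "m div n"]) auto
    qed
    have "(\<Sum>n\<in>S. if n dvd m then e n * r (m div n) else 0) = (\<Sum>n'\<in>S. if n' = n then e n * r (m div n) else 0)"
    proof (rule sum.cong)
      fix n' assume n': "n' \<in> S"
      show "(if n' dvd m then e n' * r (m div n') else 0) = (if n' = n then e n * r (m div n) else 0)"
      proof (cases "n' = n")
        case False
        hence "\<not> (n' dvd m \<and> r (m div n') \<noteq> 0)" using uniq[OF n'] by blast
        thus ?thesis using False by simp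
      qed (use n in simp)
    qed simp
    also have "\<dots> = e n * r (m div n)" using S n by simp
    finally have "norm (\<Sum>n\<in>S. if n dvd m then e n * r (m div n) else 0)^2 = (norm (e n) * norm (r (m div n)))^2"
      by (simp add: norm_mult)
    also have "\<dots> \<le> (1 * norm (r (m div n)))^2"
      using e n by (intro power_mono mult_right_mono) auto
    also have "\<dots> = (if n dvd m then norm (r (m div n))^2 else 0)" using n by simp
    also have "\<dots> \<le> (\<Sum>n\<in>S. if n dvd m then norm (r (m div n))^2 else 0)"
      using S n by (intro member_le_sum) auto
    finally show ?thesis .
  qed
  have "(\<Sum>m\<in>{1..M}. norm (\<Sum>n\<in>S. if n dvd m then e n * r (m div n) else 0)^2)
     \<le> (\<Sum>m\<in>{1..M}. \<Sum>n\<in>S. if n dvd m then norm (r (m div n))^2 else 0)"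
    using one by (intro sum_mono) auto
  also have "\<dots> = (\<Sum>n\<in>S. \<Sum>m\<in>{1..M}. if n dvd m then norm (r (m div n))^2 else 0)"
    by (rule sum.swap)
  also have "\<dots> \<le> (\<Sum>n\<in>S. V)"
  proof (rule sum_mono)
    fix n assume "n \<in> S"
    hence n: "n > 0" using S(2) by (auto simp: smooth_def)
    have "(\<Sum>m\<in>{1..M}. if n dvd m then norm (r (m div n))^2 else 0) = (\<Sum>m\<in>{m\<in>{1..M}. n dvd m}. norm (r (m div n))^2)"
      by (rule sum.inter_filter [symmetric]) auto
    also have "\<dots> = (\<Sum>k\<in>{1..M div n}. norm (r k)^2)"
    proof (rule sum.reindex_bij_witness[of _ "\<lambda>k. n * k" "\<lambda>m. m div n"])
      fix k assume "k \<in> {1..M div n}"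
      thus "n * k \<in> {m\<in>{1..M}. n dvd m}"
        using n by (auto simp: less_eq_div_iff_mult_less_eq mult.commute)
    next
      fix m assume "m \<in> {m\<in>{1..M}. n dvd m}"
      thus "m div n \<in> {1..M div n}"
        using n by (auto intro!: div_le_mono)
    qed (use n in auto)
    also have "\<dots> \<le> V" by (rule V)
    finally show "(\<Sum>m\<in>{1..M}. if n dvd m then norm (r (m div n))^2 else 0) \<le> V" .
  qed
  also have "\<dots> = real (card S) * V" by simp
  finally show ?thesis .
qed

lemma sum_rough_le_ztail:
  assumes "N \<ge> 1" "a > 1"
  shows "(\<Sum>k\<in>{1..M}. if rough {p. prime p \<and> p \<le> N} k \<and> k \<noteq> 1 then real k powr - a else 0) \<le> ztail N a"
proof -
  have "(\<Sum>k\<in>{1..M}. if rough {p. prime p \<and> p \<le> N} k \<and> k \<noteq> 1 then real k powr - a else 0)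
     \<le> (\<Sum>k\<in>{1..M}. if k > N then real k powr - a else 0)"
    using rough_gt[of N] by (intro sum_mono) auto
  also have "\<dots> = (\<Sum>k\<in>{k\<in>{1..M}. k > N}. real k powr - a)" by (rule sum.inter_filter [symmetric]) auto
  also have "\<dots> = (\<Sum>n<M-N. real (Suc (n + N)) powr - a)"
    by (rule sum.reindex_bij_witness[of _ "\<lambda>n. Suc (n + N)" "\<lambda>k. k - Suc N"]) auto
  also have "\<dots> \<le> ztail N a"
    unfolding ztail_def by (intro sum_le_suminf summable_ztail assms) auto
  finally show ?thesis .
qed

lemma Hfun_shift:
  assumes "\<And>p. p \<in> P \<Longrightarrow> p > 0"
  shows "Hfun P (s + \<i> * of_real t) = eta (s + \<i> * of_real t) * (\<Prod>p\<in>P. 1 - of_nat p powr - s * nit p t)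
           - (1 - 2 * 2 powr - s * nit 2 t)"
proof -
  have "lam z = 1 - 2 * of_nat 2 powr - z" for z
    by (simp add: lam_def powr_diff powr_minus field_simps)
  hence "lam (s + \<i> * of_real t) = 1 - 2 * of_nat 2 powr - (s + \<i> * of_real t)" .
  also have "\<dots> = 1 - 2 * 2 powr - s * nit 2 t" by (subst powr_shift_eq_nit) auto
  finally have l: "lam (s + \<i> * of_real t) = 1 - 2 * 2 powr - s * nit 2 t" .
  have "(\<Prod>p\<in>P. 1 - of_nat p powr - (s + \<i> * of_real t)) = (\<Prod>p\<in>P. 1 - of_nat p powr - s * nit p t)"
    using assms by (intro prod.cong refl) (simp only: powr_shift_eq_nit)
  thus ?thesis unfolding Hfun_def l by simp
qed

text \<open>The coefficients of \<open>Hfun P\<close> come from the rough integers k > 1, which all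
  exceed N, together with a copy dilated by 2 stemming from \<open>lam\<close>. Relative to the
  number of terms of the weight the mean square is thus at most a fixed multiple of a tail at
  2\<alpha> > 1, however large S is.\<close>

lemma mean_square_weighted_Hfun:
  assumes a: "1/2 < \<alpha>" "\<alpha> < 1"
    and I: "\<And>s. s \<in> I \<Longrightarrow> Re s \<ge> \<alpha>" "\<And>s. s \<in> I \<Longrightarrow> norm s \<le> B"
    and N: "N \<ge> 2" and P: "P = {p. prime p \<and> p \<le> N}"
    and S: "finite S" "\<And>n. n \<in> S \<Longrightarrow> smooth P n" "\<And>n. n \<in> S \<Longrightarrow> norm (d n) = 1"
    and "\<delta> > 0"
  shows "\<forall>\<^sub>F T in at_top. \<forall>s\<in>I. integral {0..T} (\<lambda>t. norm ((\<Sum>n\<in>S. d n * nit n t) * Hfun P (s + \<i> * of_real t))^2)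
            \<le> (10 * real (card S) * ztail N (2 * \<alpha>) + \<delta>) * T"
proof -
  obtain \<beta> :: real where b: "\<beta> > 1" "(2 - 2 * \<alpha>) * \<beta> < 1" using ex_beta[OF a(1)] .
  have finP: "finite P" "\<And>p. p \<in> P \<Longrightarrow> prime p" unfolding P by auto
  have posP: "p > 0" if "p \<in> P" for p using finP(2)[OF that] by (simp add: prime_gt_0_nat)
  define r where "r = (\<lambda>s k. if rough P k \<and> k \<noteq> 1 then of_nat k powr - s else (0::complex))"
  define h where "h = (\<lambda>s m. r s m - (if 2 dvd m then 2 * 2 powr - s * r s (m div 2) else 0))"
  have two: "norm (2 powr - s :: complex) \<le> 1" if "s \<in> I" for s
  proof -
    have "norm (of_nat 2 powr - s :: complex) = real 2 powr - Re s" by (rule norm_nat_powr) simp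
    also have "\<dots> \<le> real 2 powr 0" using I(1)[OF that] a by (intro powr_mono) auto
    finally show ?thesis by simp
  qed
  have daH: "dirichlet_approx \<alpha> \<beta> I (\<lambda>s t. Hfun P (s + \<i> * of_real t)) h"
  proof (rule dirichlet_approx_cong)
    show "dirichlet_approx \<alpha> \<beta> I
      (\<lambda>s t. eta (s + \<i> * of_real t) * (\<Prod>p\<in>P. 1 - of_nat p powr - s * nit p t) - (1 - 2 * 2 powr - s * (nit 2 t * 1)))
      (\<lambda>s m. of_nat m powr - s * (rind P m - (if 2 dvd m then 2 * rind P (m div 2) else 0))
          - ((if m = 1 then 1 else 0) - 2 * 2 powr - s * (if 2 dvd m then (if m div 2 = 1 then 1 else 0) else 0)))"
    proof (intro dirichlet_approx_diff dirichlet_approx_sieved_eta dirichlet_approx_const)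
      show "dirichlet_approx \<alpha> \<beta> I (\<lambda>s t. 2 * 2 powr - s * (nit 2 t * 1))
         (\<lambda>s m. 2 * 2 powr - s * (if 2 dvd m then (if m div 2 = 1 then 1 else 0) else 0))"
      proof (rule dirichlet_approx_cmult[of _ _ _ _ _ _ 2])
        show "dirichlet_approx \<alpha> \<beta> I (\<lambda>s t. nit 2 t * 1) (\<lambda>s m. if 2 dvd m then (if m div 2 = 1 then 1 else 0) else 0)"
          using a b by (intro dirichlet_approx_dilate dirichlet_approx_const[of _ _ 1]) auto
      qed (use two in \<open>auto simp: norm_mult\<close>)
      show "norm (1::complex) \<le> 1" by simp
    qed (use a b I finP in auto)
    fix s t
    show "eta (s + \<i> * of_real t) * (\<Prod>p\<in>P. 1 - of_nat p powr - s * nit p t) - (1 - 2 * 2 powr - s * (nit 2 t * 1)) = Hfun P (s + \<i> * of_real t)"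
      using posP by (simp add: Hfun_shift)
  next
    fix s and m :: nat assume m: "m > 0"
    have r1: "rough P (Suc 0)" using finP(2)[of 1] by (auto simp: rough_def)
    have e: "of_nat m powr - s * rind P m - (if m = 1 then 1 else 0) = r s m" for m
      using r1 by (auto simp: rind_def r_def)
    have e2: "of_nat m powr - s * (if 2 dvd m then 2 * rind P (m div 2) else 0) - 2 * 2 powr - s * (if 2 dvd m then (if m div 2 = 1 then 1 else 0) else 0)
       = (if 2 dvd m then 2 * 2 powr - s * r s (m div 2) else 0)"
    proof (cases "even m")
      case True
      then obtain k where k: "m = 2 * k" by auto
      have "of_nat m powr - s = (2 powr - s * of_nat k powr - s :: complex)"
        using powr_nat_mult[of 2 k "-s"] k m by simp
      thus ?thesis using k by (simp flip: e add: algebra_simps)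
    qed auto
    have "x * (u - v) - (w - y) = (x * u - w) - (x * v - y)" for x u v w y :: complex
      by (simp add: algebra_simps)
    thus "of_nat m powr - s * (rind P m - (if 2 dvd m then 2 * rind P (m div 2) else 0))
          - ((if m = 1 then 1 else 0) - 2 * 2 powr - s * (if 2 dvd m then (if m div 2 = 1 then 1 else 0) else 0)) = h s m"
      unfolding h_def by (simp only: e e2)
  qed
  have Spos: "n > 0" if "n \<in> S" for n using S(2)[OF that] by (simp add: smooth_def)
  define c where "c = (\<lambda>s m. \<Sum>n\<in>S. d n * (if n dvd m then h s (m div n) else 0))"
  have da: "dirichlet_approx \<alpha> \<beta> I (\<lambda>s t. (\<Sum>n\<in>S. d n * nit n t) * Hfun P (s + \<i> * of_real t)) c"
  proof (rule dirichlet_approx_cong)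
    show "dirichlet_approx \<alpha> \<beta> I (\<lambda>s t. \<Sum>n\<in>S. d n * (nit n t * Hfun P (s + \<i> * of_real t))) c"
      unfolding c_def
    proof (rule dirichlet_approx_sum)
      fix n assume n: "n \<in> S"
      show "dirichlet_approx \<alpha> \<beta> I (\<lambda>s t. d n * (nit n t * Hfun P (s + \<i> * of_real t))) (\<lambda>s m. d n * (if n dvd m then h s (m div n) else 0))"
        using S(3)[OF n] Spos[OF n] a b by (intro dirichlet_approx_cmult[of _ _ _ _ _ _ 1] dirichlet_approx_dilate daH) auto
    qed (use S b in auto)
  qed (auto simp: sum_distrib_right mult.assoc)
  have rbound: "(\<Sum>k\<in>{1..M}. norm (r s k)^2) \<le> ztail N (2 * \<alpha>)" if s: "s \<in> I" for s M
  proof -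
    have "(\<Sum>k\<in>{1..M}. norm (r s k)^2) \<le> (\<Sum>k\<in>{1..M}. if rough P k \<and> k \<noteq> 1 then real k powr - (2 * \<alpha>) else 0)"
    proof (rule sum_mono)
      fix k assume k: "k \<in> {1..M}"
      have "norm (of_nat k powr - s :: complex) \<le> real k powr -\<alpha>"
        using k I(1)[OF s] by (auto simp: norm_nat_powr intro!: powr_mono)
      hence "norm (of_nat k powr - s :: complex)^2 \<le> (real k powr -\<alpha>)^2" by (intro power_mono) auto
      also have "\<dots> = real k powr -(2 * \<alpha>)" by (simp add: power2_eq_square flip: powr_add)
      finally show "norm (r s k)^2 \<le> (if rough P k \<and> k \<noteq> 1 then real k powr - (2 * \<alpha>) else 0)"
        by (simp add: r_def)
    qed
    also have "\<dots> \<le> ztail N (2 * \<alpha>)" unfolding P using N a by (intro sum_rough_le_ztail) auto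
    finally show ?thesis .
  qed
  have V0: "10 * real (card S) * ztail N (2 * \<alpha>) \<ge> 0" using a by (simp add: ztail_nonneg)
  show ?thesis
  proof (rule mean_square_le[OF da a _ b(2) _ _ V0 \<open>\<delta> > 0\<close>])
    fix s :: complex and M :: nat assume s: "s \<in> I"
    \<comment> \<open>The two parts of \<open>lam\<close> are separated: \<open>c1\<close> belongs
      to the weight supported on S, \<open>c2\<close> to its dilate on 2 S. The latter is still
      smooth, since N \<ge> 2 puts the prime 2 into P.\<close>
    define c1 where "c1 = (\<lambda>m. \<Sum>n\<in>S. if n dvd m then d n * r s (m div n) else 0)"
    define c2 where "c2 = (\<lambda>m. \<Sum>n\<in>(*) 2 ` S. if n dvd m then d (n div 2) * r s (m div n) else 0)"
    have inj: "inj_on ((*) (2::nat)) S" by (auto simp: inj_on_def)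
    have c: "c s m = c1 m - 2 * 2 powr - s * c2 m" if "m > 0" for m
    proof -
      have "c2 m = (\<Sum>n\<in>S. if 2 * n dvd m then d n * r s (m div (2 * n)) else 0)"
        unfolding c2_def sum.reindex[OF inj] o_def by (intro sum.cong refl) auto
      hence "c1 m - 2 * 2 powr - s * c2 m = (\<Sum>n\<in>S. (if n dvd m then d n * r s (m div n) else 0)
            - 2 * 2 powr - s * (if 2 * n dvd m then d n * r s (m div (2 * n)) else 0))"
        by (simp add: c1_def sum_subtractf sum_distrib_left)
      also have "\<dots> = c s m"
        unfolding c_def
      proof (intro sum.cong refl)
        fix n assume n: "n \<in> S"
        show "(if n dvd m then d n * r s (m div n) else 0) - 2 * 2 powr - s * (if 2 * n dvd m then d n * r s (m div (2 * n)) else 0)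
            = d n * (if n dvd m then h s (m div n) else 0)"
        proof (cases "n dvd m")
          case True
          then obtain k where k: "m = n * k" by auto
          have "2 * n dvd m \<longleftrightarrow> even k" using k Spos[OF n] by (simp add: mult.commute)
          moreover have "m div (2 * n) = k div 2" using k Spos[OF n] by (simp add: mult.commute)
          ultimately show ?thesis using k Spos[OF n] by (simp add: h_def algebra_simps)
        next
          case False
          hence "\<not> 2 * n dvd m" using dvd_mult_right by blast
          thus ?thesis using False by simp
        qed
      qed
      finally show ?thesis by simp
    qed
    \<comment> \<open>The constant 10 is 2 + 8, from (x + 2 y)^2 \<le> 2 x^2 + 8 y^2 and |2^(-s)|
      \<le> 1.\<close>
    have "(\<Sum>m\<in>{1..M}. norm (c s m)^2) \<le> (\<Sum>m\<in>{1..M}. 2 * norm (c1 m)^2 + 8 * norm (c2 m)^2)"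
    proof (rule sum_mono)
      fix m assume "m \<in> {1..M}"
      hence "norm (c s m) \<le> norm (c1 m) + norm (2 * 2 powr - s * c2 m)"
        using c[of m] norm_triangle_ineq4[of "c1 m" "2 * 2 powr - s * c2 m"] by simp
      also have "norm (2 * 2 powr - s * c2 m) \<le> 2 * norm (c2 m)"
        using mult_right_mono[OF two[OF s], of "norm (c2 m)"] by (simp add: norm_mult)
      finally have "norm (c s m)^2 \<le> (norm (c1 m) + 2 * norm (c2 m))^2" by (intro power_mono) auto
      also have "\<dots> \<le> 2 * norm (c1 m)^2 + 8 * norm (c2 m)^2"
        using zero_le_power2[of "norm (c1 m) - 2 * norm (c2 m)"] by (simp add: power2_eq_square algebra_simps)
      finally show "norm (c s m)^2 \<le> 2 * norm (c1 m)^2 + 8 * norm (c2 m)^2" .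
    qed
    also have "\<dots> = 2 * (\<Sum>m\<in>{1..M}. norm (c1 m)^2) + 8 * (\<Sum>m\<in>{1..M}. norm (c2 m)^2)"
      by (simp add: sum.distrib sum_distrib_left)
    also have "\<dots> \<le> 2 * (real (card S) * ztail N (2 * \<alpha>)) + 8 * (real (card ((*) 2 ` S)) * ztail N (2 * \<alpha>))"
    proof (intro add_mono mult_left_mono)
      show "(\<Sum>m\<in>{1..M}. norm (c1 m)^2) \<le> real (card S) * ztail N (2 * \<alpha>)"
        unfolding c1_def using S rbound[OF s] by (intro sum_norm_square_smooth_rough[of S P]) (auto simp: r_def)
      have "2 \<in> P" using N unfolding P by simp
      hence "smooth P (2 * n)" if "n \<in> S" for n
        using S(2)[OF that] by (auto simp: smooth_def prime_factors_product prime_factorization_prime two_is_prime_nat)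
      thus "(\<Sum>m\<in>{1..M}. norm (c2 m)^2) \<le> real (card ((*) 2 ` S)) * ztail N (2 * \<alpha>)"
        unfolding c2_def using S rbound[OF s] by (intro sum_norm_square_smooth_rough[of _ P]) (auto simp: r_def)
    qed auto
    also have "\<dots> = 10 * real (card S) * ztail N (2 * \<alpha>)"
      by (simp add: card_image[OF inj])
    finally show "(\<Sum>m\<in>{1..M}. norm (c s m)^2) \<le> 10 * real (card S) * ztail N (2 * \<alpha>)" .
  next
    fix s assume "s \<in> I"
    have "continuous_on UNIV (Hfun P)"
      using Hfun_holomorphic[OF finP(1) posP] holomorphic_on_imp_continuous_on by blast
    moreover have "continuous_on UNIV (\<lambda>t. s + \<i> * complex_of_real t)" by (intro continuous_intros)
    ultimately have "continuous_on UNIV (\<lambda>t. Hfun P (s + \<i> * of_real t))"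
      by (rule continuous_on_compose2) simp
    thus "continuous_on UNIV (\<lambda>t. (\<Sum>n\<in>S. d n * nit n t) * Hfun P (s + \<i> * of_real t))"
      by (intro continuous_on_mult continuous_on_sum continuous_on_const continuous_on_nit continuous_on_id)
  qed (use b in auto)
qed

section \<open>A weighted mean value and the times at which primes are synchronised\<close>

lemma mean_square_poly_eventually:
  assumes "finite A" "\<And>m. m \<in> A \<Longrightarrow> m > 0" "\<delta> > 0"
  shows "\<forall>\<^sub>F T in at_top. \<bar>integral {0..T} (\<lambda>t. norm (\<Sum>m\<in>A. c m * nit m t)^2) - T * (\<Sum>m\<in>A. norm (c m)^2)\<bar> \<le> \<delta> * T"
proof -
  define K where "K = (\<Sum>m\<in>A. \<Sum>n\<in>A-{m}. norm (c m) * norm (c n) * (2 / \<bar>ln (real m) - ln (real n)\<bar>))"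
  show ?thesis
    using eventually_ge_at_top[of "K / \<delta>"] eventually_ge_at_top[of 0]
  proof eventually_elim
    case (elim T)
    have "K \<le> \<delta> * T" using elim assms by (simp add: field_simps)
    with mean_square_dirichlet_poly[OF assms(1,2) elim(2), of c] show ?case
      by (simp add: K_def)
  qed
qed

section \<open>A weight concentrated on prescribed phases of the primes\<close>

text \<open>The completely multiplicative function with given values at the primes.\<close>

definition cmext :: "(nat \<Rightarrow> complex) \<Rightarrow> nat \<Rightarrow> complex" where
  "cmext c n = prod_mset (image_mset c (prime_factorization n))"

lemma cmext_mult: "m > 0 \<Longrightarrow> n > 0 \<Longrightarrow> cmext c (m * n) = cmext c m * cmext c n"
  by (simp add: cmext_def prime_factorization_mult)

lemma cmext_prime: "prime p \<Longrightarrow> cmext c p = c p"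
  by (simp add: cmext_def prime_factorization_prime)

lemma norm_cmext:
  assumes "\<And>p. norm (c p) = 1"
  shows "norm (cmext c n) = 1"
proof -
  have "norm (prod_mset (image_mset c A)) = 1" for A
    by (induction A) (simp_all add: norm_mult assms)
  thus ?thesis by (simp add: cmext_def)
qed

lemma smooth_divisors:
  assumes "finite P" "\<And>p. p \<in> P \<Longrightarrow> prime p" "n dvd (\<Prod>P) ^ k"
  shows "smooth P (n::nat)"
proof -
  have pos: "\<Prod>P > 0" using assms(1,2) by (intro prod_pos) (auto simp: prime_gt_0_nat)
  have "n > 0" using assms(3) pos by (meson dvd_pos_nat zero_less_power)
  moreover have "prime_factors n \<subseteq> P"
  proof
    fix p assume "p \<in> prime_factors n"
    hence p: "prime p" "p dvd n" by auto
    hence "p dvd (\<Prod>P) ^ k" using assms(3) dvd_trans by blast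
    hence "p dvd \<Prod>P" using p prime_dvd_power by blast
    then obtain q where "q \<in> P" "p dvd q" using p assms(1) prime_dvd_prod_iff[of P p id] by auto
    thus "p \<in> P" using p assms(2) primes_dvd_imp_eq by blast
  qed
  ultimately show ?thesis by (simp add: smooth_def)
qed

text \<open>Multiplying a divisor prime to p by p^j for j < J gives J divisors, all distinct, since
  j is recovered as the multiplicity of p. So the divisors prime to p are at most a proportion 1 /
  J.\<close>

lemma card_divisors_not_dvd:
  assumes P: "finite P" "\<And>p. p \<in> P \<Longrightarrow> prime p" "p \<in> P" and "J \<ge> 1"
  shows "J * card {n. n dvd (\<Prod>P) ^ (J - 1) \<and> \<not> p dvd n} \<le> card {n::nat. n dvd (\<Prod>P) ^ (J - 1)}"
proof -
  let ?X = "(\<Prod>P) ^ (J - 1)"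
  have p: "prime p" using P by auto
  have pos: "?X > 0" using P(1,2) by (intro zero_less_power prod_pos) (auto simp: prime_gt_0_nat)
  define A where "A = {n. n dvd ?X \<and> \<not> p dvd n}"
  have inj: "inj_on (\<lambda>(n, j). n * p ^ j) (A \<times> {..<J})"
  proof (rule inj_onI, clarify)
    fix n j m i assume n: "n \<in> A" and m: "m \<in> A" and e: "n * p ^ j = m * p ^ i"
    have "multiplicity p (n * p ^ j) = j" if "n \<in> A" for n j
      using that p pos by (subst prime_elem_multiplicity_mult_distrib)
        (auto simp: A_def not_dvd_imp_multiplicity_0 multiplicity_same_power intro!: Nat.gr0I)
    hence "j = i" using n m e by metis
    thus "n = m \<and> j = i" using e p by simp
  qed
  have sub: "(\<lambda>(n, j). n * p ^ j) ` (A \<times> {..<J}) \<subseteq> {n. n dvd ?X}"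
  proof clarify
    fix n j assume n: "n \<in> A" and j: "j < J"
    have "p dvd \<Prod>P" using P by (simp add: dvd_prodI[of P p id, simplified])
    hence "p ^ (J - 1) dvd ?X" by (rule dvd_power_same)
    moreover have "p ^ j dvd p ^ (J - 1)" using j by (intro le_imp_power_dvd) auto
    ultimately have "p ^ j dvd ?X" by (rule dvd_trans[rotated])
    moreover have "coprime n (p ^ j)"
    proof -
      have "coprime p n" using n p by (intro prime_imp_coprime) (auto simp: A_def)
      thus ?thesis by (simp add: coprime_commute)
    qed
    ultimately show "n * p ^ j dvd ?X" using n by (intro divides_mult) (auto simp: A_def)
  qed
  have "J * card A = card (A \<times> {..<J})" by (simp add: card_cartesian_product)
  also have "\<dots> = card ((\<lambda>(n, j). n * p ^ j) ` (A \<times> {..<J}))" using inj by (simp add: card_image)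
  also have "\<dots> \<le> card {n. n dvd ?X}" using pos by (intro card_mono sub finite_divisors_nat)
  finally show ?thesis by (simp add: A_def)
qed

text \<open>Multiplication of \<open>D\<close> by \<open>d p * nit p t\<close> shifts the support \<open>S\<close> to \<open>p S\<close>, so the difference
  is supported on the symmetric difference, which is small because \<open>S\<close> is a Foelner set.\<close>

lemma mean_square_shift_diff:
  fixes P :: "nat set"
  assumes P: "finite P" "\<And>p. p \<in> P \<Longrightarrow> prime p" "p \<in> P" and J: "J \<ge> 1"
    and S: "S = {n. n dvd (\<Prod>P) ^ (J - 1)}"
    and d: "\<And>n. n > 0 \<Longrightarrow> norm (d n) = 1" "\<And>m n. m > 0 \<Longrightarrow> n > 0 \<Longrightarrow> d (m * n) = d m * d n"
    and "\<delta> > 0"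
  shows "\<forall>\<^sub>F T in at_top. integral {0..T} (\<lambda>t. norm ((\<Sum>n\<in>S. d n * nit n t) * (d p * nit p t - 1))^2)
            \<le> (2 * real (card S) / real J + \<delta>) * T"
proof -
  let ?X = "(\<Prod>P) ^ (J - 1)"
  have p: "prime p" "p > 0" using P by (auto simp: prime_gt_0_nat)
  have pos: "?X > 0" using P(1,2) by (intro zero_less_power prod_pos) (auto simp: prime_gt_0_nat)
  have finS: "finite S" unfolding S using pos by (intro finite_divisors_nat)
  have Spos: "n > 0" if "n \<in> S" for n using that pos unfolding S by (metis dvd_pos_nat mem_Collect_eq)
  define S' where "S' = (*) p ` S"
  have inj: "inj_on ((*) p) S" using p by (auto simp: inj_on_def)
  have finS': "finite S'" using finS by (simp add: S'_def)
  have S'pos: "n > 0" if "n \<in> S'" for n using that Spos p by (auto simp: S'_def)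
  define A where "A = (S' - S) \<union> (S - S')"
  define c where "c = (\<lambda>n. if n \<in> S' then d n else - d n)"
  have eq: "(\<Sum>n\<in>S. d n * nit n t) * (d p * nit p t - 1) = (\<Sum>n\<in>A. c n * nit n t)" for t
  proof -
    have "(\<Sum>n\<in>S. d n * nit n t) * (d p * nit p t) = (\<Sum>n\<in>S. d (p * n) * nit (p * n) t)"
      unfolding sum_distrib_right using p Spos by (intro sum.cong refl) (simp add: d nit_mult)
    also have "\<dots> = (\<Sum>n\<in>S'. d n * nit n t)"
      unfolding S'_def by (subst sum.reindex[OF inj]) (simp add: o_def)
    finally have e1: "(\<Sum>n\<in>S. d n * nit n t) * (d p * nit p t - 1) = (\<Sum>n\<in>S'. d n * nit n t) - (\<Sum>n\<in>S. d n * nit n t)"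
      by (simp add: right_diff_distrib)
    have e2: "(\<Sum>n\<in>S'. d n * nit n t) = (\<Sum>n\<in>S'-S. d n * nit n t) + (\<Sum>n\<in>S \<inter> S'. d n * nit n t)"
      using finS' by (subst sum.Int_Diff[of S' _ S]) (simp_all add: Int_commute)
    have e3: "(\<Sum>n\<in>S. d n * nit n t) = (\<Sum>n\<in>S-S'. d n * nit n t) + (\<Sum>n\<in>S \<inter> S'. d n * nit n t)"
      using finS by (subst sum.Int_Diff[of S _ S']) simp_all
    have "(\<Sum>n\<in>S. d n * nit n t) * (d p * nit p t - 1) = (\<Sum>n\<in>S'-S. d n * nit n t) + (\<Sum>n\<in>S \<inter> S'. d n * nit n t) - ((\<Sum>n\<in>S-S'. d n * nit n t) + (\<Sum>n\<in>S \<inter> S'. d n * nit n t))"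
      unfolding e1 using e2 e3 by (simp only:)
    also have "(\<Sum>n\<in>S'-S. d n * nit n t) + (\<Sum>n\<in>S \<inter> S'. d n * nit n t) - ((\<Sum>n\<in>S-S'. d n * nit n t) + (\<Sum>n\<in>S \<inter> S'. d n * nit n t))
       = (\<Sum>n\<in>S'-S. c n * nit n t) + (\<Sum>n\<in>S-S'. c n * nit n t)"
      by (simp add: c_def sum_negf)
    also have "\<dots> = (\<Sum>n\<in>A. c n * nit n t)"
      unfolding A_def using finS finS' by (intro sum.union_disjoint [symmetric]) auto
    finally show ?thesis .
  qed
  have cardA: "real (card A) \<le> 2 * real (card S) / real J"
  proof -
    \<comment> \<open>A divisor that is a multiple of p is p times another divisor, so what the
      shifted set misses consists of divisors prime to p. The other half of the symmetric difference
      has the same size, as both sets have equally many elements.\<close>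
    have sub: "S - S' \<subseteq> {n. n dvd ?X \<and> \<not> p dvd n}"
    proof
      fix n assume n: "n \<in> S - S'"
      have "\<not> p dvd n"
      proof
        assume "p dvd n"
        then obtain k where k: "n = p * k" by auto
        have "k dvd ?X" using n k unfolding S by (auto intro: dvd_mult_right)
        thus False using n k by (auto simp: S'_def S)
      qed
      thus "n \<in> {n. n dvd ?X \<and> \<not> p dvd n}" using n by (auto simp: S)
    qed
    have fin: "finite {n. n dvd ?X \<and> \<not> p dvd n}" using finS unfolding S by (rule finite_subset[rotated]) auto
    have c1: "card (S - S') \<le> card {n. n dvd ?X \<and> \<not> p dvd n}" by (intro card_mono sub fin)
    have "card S' = card S" by (simp add: S'_def card_image[OF inj])
    hence c2: "card (S' - S) = card (S - S')"
      using card_Diff_subset_Int[of S' S] card_Diff_subset_Int[of S S'] finS finS' by (simp add: Int_commute)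
    have "card A \<le> card (S' - S) + card (S - S')" unfolding A_def by (rule card_Un_le)
    hence "J * card A \<le> 2 * (J * card {n. n dvd ?X \<and> \<not> p dvd n})" using c1 c2 by (simp add: mult.left_commute)
    also have "\<dots> \<le> 2 * card S" using card_divisors_not_dvd[OF P J] by (simp add: S)
    finally have "real (J * card A) \<le> real (2 * card S)" by (simp only: of_nat_le_iff)
    thus ?thesis using J by (simp add: field_simps)
  qed
  have Apos: "n > 0" if "n \<in> A" for n using that Spos S'pos by (auto simp: A_def)
  have "(\<Sum>n\<in>A. norm (c n)^2) = (\<Sum>n\<in>A. 1)"
    by (intro sum.cong refl) (use Apos d in \<open>auto simp: c_def\<close>)
  hence sA: "(\<Sum>n\<in>A. norm (c n)^2) = real (card A)" by simp
  have finA: "finite A" using finS finS' by (simp add: A_def)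
  have "\<forall>\<^sub>F T in at_top. \<bar>integral {0..T} (\<lambda>t. norm (\<Sum>m\<in>A. c m * nit m t)^2) - T * (\<Sum>m\<in>A. norm (c m)^2)\<bar> \<le> \<delta> * T"
    by (intro mean_square_poly_eventually finA Apos \<open>\<delta> > 0\<close>)
  thus ?thesis
    using eventually_ge_at_top[of 0]
  proof eventually_elim
    case (elim T)
    have "integral {0..T} (\<lambda>t. norm (\<Sum>m\<in>A. c m * nit m t)^2) \<le> T * real (card A) + \<delta> * T"
      using elim(1) unfolding sA by linarith
    also have "\<dots> \<le> T * (2 * real (card S) / real J) + \<delta> * T"
      using elim cardA by (intro add_right_mono mult_left_mono) auto
    finally show ?case unfolding eq by (simp add: algebra_simps)
  qed
qed

lemma integral_indicator_le:
  assumes "a \<le> b" "T \<ge> 0"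
  shows "(\<lambda>t. if t \<in> {a..b} then (1::real) else 0) integrable_on {0..T}"
    "integral {0..T} (\<lambda>t. if t \<in> {a..b} then (1::real) else 0) \<le> b - a"
proof -
  define U where "U = {min 0 a..max T b}"
  have hi: "((\<lambda>t. if t \<in> {a..b} then (1::real) else 0) has_integral (b - a)) U"
    using has_integral_const_real[of "1::real" a b] assms by (subst has_integral_restrict) (auto simp: U_def)
  have sub: "{0..T} \<subseteq> U" using assms by (auto simp: U_def)
  show i: "(\<lambda>t. if t \<in> {a..b} then (1::real) else 0) integrable_on {0..T}"
    using integrable_on_subinterval[of _ U 0 T] hi sub by (auto simp: has_integral_integrable)
  have "integral {0..T} (\<lambda>t. if t \<in> {a..b} then (1::real) else 0) \<le> integral U (\<lambda>t. if t \<in> {a..b} then (1::real) else 0)"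
    using i hi sub by (intro integral_subset_le) (auto simp: has_integral_integrable)
  thus "integral {0..T} (\<lambda>t. if t \<in> {a..b} then (1::real) else 0) \<le> b - a"
    using integral_unique[OF hi] by simp
qed

text \<open>The weight |D|^2 has mean s, its number of terms. By Chebyshev's inequality the times
  violating one of the conditions carry only a fixed fraction of the mass s T; since |D| \<le> s,
  the good times cannot be covered by intervals whose total length is a small multiple of T.
  Coverings by a finite set Z stand in for the measure of the good times; later Z consists of the
  heights of zeros.\<close>

lemma good_times:
  fixes \<xi> :: "nat \<Rightarrow> complex" and c :: complex
  assumes a: "1/2 < \<alpha>" "\<alpha> < 1"
    and N: "N \<ge> 2" and P: "P = {p. prime p \<and> p \<le> N}"
    and \<xi>: "\<And>p. norm (\<xi> p) = 1"
    and R: "0 < R" "R < R2" "Re c - R2 \<ge> \<alpha>"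
    and \<delta>: "\<delta> > 0" and \<delta>': "\<delta>' > 0"
    and small: "80 * ztail N (2 * \<alpha>) * (R2 / (R2 - R)) \<le> \<delta>'"
    and good: "good = (\<lambda>t. (\<forall>p\<in>P. norm (nit p t - \<xi> p) < \<delta>) \<and>
                 (\<forall>s. dist c s \<le> R \<longrightarrow> norm (Hfun P (s + \<i> * of_real t))^2 < \<delta>'))"
  obtains C where "C > 0"
    "\<forall>\<^sub>F T in at_top. \<forall>Z \<rho>. finite Z \<longrightarrow> \<rho> > 0 \<longrightarrow> (\<forall>t\<in>{1..T-1}. good t \<longrightarrow> (\<exists>y\<in>Z. \<bar>y - t\<bar> \<le> \<rho>)) \<longrightarrow>
        C * T \<le> \<rho> * real (card Z)"
proof -
  have finP: "finite P" "\<And>p. p \<in> P \<Longrightarrow> prime p" unfolding P by auto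
  have posP: "p > 0" if "p \<in> P" for p using finP(2)[OF that] by (simp add: prime_gt_0_nat)
  define d where "d = cmext (\<lambda>p. cnj (\<xi> p))"
  have d1: "norm (d n) = 1" for n unfolding d_def by (rule norm_cmext) (simp add: \<xi>)
  have dm: "d (m * n) = d m * d n" if "m > 0" "n > 0" for m n unfolding d_def using that by (rule cmext_mult)
  have dp: "norm (d p * nit p t - 1) = norm (nit p t - \<xi> p)" if "p \<in> P" for p t
  proof -
    have dpp: "d p = cnj (\<xi> p)" unfolding d_def using finP(2)[OF that] by (rule cmext_prime)
    have "cnj (\<xi> p) * \<xi> p = 1" using complex_norm_square[of "\<xi> p"] \<xi> by (simp add: mult.commute)
    hence "d p * nit p t - 1 = cnj (\<xi> p) * (nit p t - \<xi> p)" by (simp add: dpp right_diff_distrib)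
    thus ?thesis by (simp add: norm_mult \<xi>)
  qed
  \<comment> \<open>Each prime condition contributes a mean square of at most 2 s / J, up to
    \<open>\<delta>1\<close>, to be divided by \<open>\<delta>^2\<close>. This choice and that of
    \<open>\<delta>1\<close> keep the share of all primes together below s / 8.\<close>
  define J where "J = nat \<lceil>32 * (real (card P) + 1) / \<delta>^2\<rceil> + 1"
  have J: "J \<ge> 1" by (simp add: J_def)
  have J2: "real J \<ge> 32 * (real (card P) + 1) / \<delta>^2" unfolding J_def by linarith
  define S where "S = {n. n dvd (\<Prod>P) ^ (J - 1)}"
  define X where "X = (\<Prod>P) ^ (J - 1)"
  have Xpos: "X > 0" unfolding X_def using finP by (intro zero_less_power prod_pos) (auto simp: prime_gt_0_nat)
  have finS: "finite S" unfolding S_def X_def[symmetric] using Xpos by (intro finite_divisors_nat)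
  have Ssm: "smooth P n" if "n \<in> S" for n using that finP smooth_divisors by (auto simp: S_def)
  have Spos: "n > 0" if "n \<in> S" for n using Ssm[OF that] by (simp add: smooth_def)
  define s where "s = real (card S)"
  have "1 \<in> S" by (simp add: S_def)
  hence s1: "s \<ge> 1" using finS card_gt_0_iff[of S] by (auto simp: s_def Suc_le_eq)
  define D where "D = (\<lambda>t. \<Sum>n\<in>S. d n * nit n t)"
  have contD: "continuous_on A D" for A unfolding D_def by (intro continuous_intros)
  have Ds: "norm (D t) \<le> s" for t
  proof -
    have "norm (D t) \<le> (\<Sum>n\<in>S. 1)" unfolding D_def by (intro sum_norm_le) (simp add: norm_mult d1)
    thus ?thesis by (simp add: s_def)
  qed
  define K where "K = R2 / (R2 - R)"
  have K: "K > 0" using R by (simp add: K_def)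
  define z where "z = ztail N (2 * \<alpha>)"
  have z: "z \<ge> 0" unfolding z_def using a by (intro ztail_nonneg) auto
  define \<delta>1 where "\<delta>1 = \<delta>^2 * s / (16 * (real (card P) + 1))"
  have \<delta>1: "\<delta>1 > 0" using \<delta> s1 by (simp add: \<delta>1_def)
  \<comment> \<open>The condition on \<open>Hfun\<close> gets the share s / 4 of the mass: s / 8 for
    the tail, which explains 80 = 8 * 10 in the assumption \<open>small\<close>, and s / 8 for
    \<open>\<delta>2\<close>.\<close>
  define \<delta>2 where "\<delta>2 = \<delta>' * s / (8 * K)"
  have \<delta>2: "\<delta>2 > 0" using \<delta>' s1 K by (simp add: \<delta>2_def)
  define I where "I = sphere c R2"
  have I: "Re w \<ge> \<alpha>" "norm w \<le> norm c + R2" if "w \<in> I" for w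
  proof -
    have dd: "norm (c - w) = R2" using that by (simp add: I_def dist_norm)
    show "Re w \<ge> \<alpha>" using abs_Re_le_cmod[of "c - w"] dd R by simp
    show "norm w \<le> norm c + R2" using norm_triangle_sub[of w c] dd by (simp add: norm_minus_commute)
  qed
  have holH: "Hfun P holomorphic_on A" for A using finP(1) posP by (intro Hfun_holomorphic)
  define q where "q = (\<lambda>t. integral {0..1} (\<lambda>x. norm (D t * Hfun P (circlepath c R2 x + \<i> * of_real t))^2))"
  have ev1: "\<forall>\<^sub>F T in at_top. \<forall>w\<in>I. integral {0..T} (\<lambda>t. norm (D t * Hfun P (w + \<i> * of_real t))^2) \<le> (10 * s * z + \<delta>2) * T"
    unfolding D_def s_def z_def using a I N P finS Ssm d1 \<delta>2 by (intro mean_square_weighted_Hfun) auto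
  have ev2: "\<forall>\<^sub>F T in at_top. \<forall>p\<in>P. integral {0..T} (\<lambda>t. norm (D t * (d p * nit p t - 1))^2) \<le> (2 * s / real J + \<delta>1) * T"
    using finP(1)
  proof (rule eventually_ball_finite, intro ballI)
    fix p assume p: "p \<in> P"
    show "\<forall>\<^sub>F T in at_top. integral {0..T} (\<lambda>t. norm (D t * (d p * nit p t - 1))^2) \<le> (2 * s / real J + \<delta>1) * T"
      unfolding D_def s_def using finP p J S_def d1 dm \<delta>1 by (intro mean_square_shift_diff) auto
  qed
  have ev3: "\<forall>\<^sub>F T in at_top. \<bar>integral {0..T} (\<lambda>t. norm (D t)^2) - T * (\<Sum>m\<in>S. norm (d m)^2)\<bar> \<le> (s / 8) * T"
    unfolding D_def using finS Spos s1 by (intro mean_square_poly_eventually) auto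
  have ev: "\<forall>\<^sub>F T in at_top. \<forall>Z \<rho>. finite Z \<longrightarrow> \<rho> > 0 \<longrightarrow> (\<forall>t\<in>{1..T-1}. good t \<longrightarrow> (\<exists>y\<in>Z. \<bar>y - t\<bar> \<le> \<rho>)) \<longrightarrow>
        (1 / (8 * s)) * T \<le> \<rho> * real (card Z)"
    using ev1 ev2 ev3 eventually_ge_at_top[of "8 * s"]
  proof eventually_elim
    case (elim T)
    have T: "T \<ge> 0" "T \<ge> 1" using elim(4) s1 by linarith+
    show ?case
    proof (intro allI impI)
      fix Z :: "real set" and \<rho> :: real
      assume Z: "finite Z" and \<rho>: "\<rho> > 0" and hit: "\<forall>t\<in>{1..T-1}. good t \<longrightarrow> (\<exists>y\<in>Z. \<bar>y - t\<bar> \<le> \<rho>)"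
      have contf: "continuous_on UNIV (\<lambda>(w, t). norm (D t * Hfun P (w + \<i> * of_real t))^2)"
      proof -
        have "continuous_on UNIV (\<lambda>z. Hfun P (fst z + \<i> * of_real (snd z)))"
          by (rule continuous_on_compose2[OF holomorphic_on_imp_continuous_on[OF holH[of UNIV]]]) (auto intro!: continuous_intros)
        moreover have "continuous_on UNIV (\<lambda>z::complex \<times> real. D (snd z))"
          by (rule continuous_on_compose2[OF contD[of UNIV]]) (auto intro!: continuous_intros)
        ultimately show ?thesis unfolding case_prod_unfold
          by (intro continuous_on_power continuous_on_norm continuous_on_mult)
      qed
      note sw = circle_mean_square_swap[OF contf T(1), of R2 c "(10 * s * z + \<delta>2) * T"]
      have R20: "R2 \<ge> 0" using R by simp
      have q1: "q integrable_on {0..T}" unfolding q_def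
        using sw(1)[OF R20] elim(1) by (simp add: I_def)
      have q2: "integral {0..T} q \<le> (10 * s * z + \<delta>2) * T" unfolding q_def
        using sw(2)[OF R20] elim(1) by (simp add: I_def)
      define ind where "ind = (\<lambda>(a::real) b t. if t \<in> {a..b} then (1::real) else 0)"
      have ind0: "ind a b t \<ge> 0" for a b t by (simp add: ind_def)
      \<comment> \<open>A majorant of |D|^2: Chebyshev terms for violated conditions, and the
        trivial bound s^2 on the covering intervals and on the two end pieces of length 1, where no
        covering is assumed.\<close>
      define rhs where "rhs = (\<lambda>t. (\<Sum>p\<in>P. norm (D t * (d p * nit p t - 1))^2) * (1 / \<delta>^2) + (K / \<delta>') * q t
            + s^2 * ((\<Sum>y\<in>Z. ind (y - \<rho>) (y + \<rho>) t) + (ind 0 1 t + ind (T - 1) T t)))"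
      have q0: "q t \<ge> 0" for t 
      proof (cases "(\<lambda>x. norm (D t * Hfun P (circlepath c R2 x + \<i> * of_real t))^2) integrable_on {0..1}")
        case True
        thus ?thesis unfolding q_def by (intro integral_nonneg) auto
      qed (simp add: q_def not_integrable_integral)
      have pw: "norm (D t)^2 \<le> rhs t" if t: "t \<in> {0..T}" for t
      proof -
        have nn: "(\<Sum>p\<in>P. norm (D t * (d p * nit p t - 1))^2) * (1 / \<delta>^2) \<ge> 0" "(K / \<delta>') * q t \<ge> 0"
           "(\<Sum>y\<in>Z. ind (y - \<rho>) (y + \<rho>) t) \<ge> 0" "s^2 \<ge> 0"
          using K \<delta>' q0[of t] ind0 by (auto intro!: sum_nonneg mult_nonneg_nonneg divide_nonneg_nonneg)
        have w: "norm (D t)^2 \<le> s^2 * 1" using Ds[of t] by (simp add: power_mono)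
        consider "t \<le> 1 \<or> t \<ge> T - 1" | "t \<in> {1..T-1}" "good t" | "\<not> good t" using t by fastforce
        thus ?thesis
        proof cases
          case 1
          hence "ind 0 1 t + ind (T - 1) T t \<ge> 1" using t by (auto simp: ind_def)
          hence "s^2 * 1 \<le> s^2 * ((\<Sum>y\<in>Z. ind (y - \<rho>) (y + \<rho>) t) + (ind 0 1 t + ind (T - 1) T t))"
            using nn by (intro mult_left_mono) linarith+
          thus ?thesis unfolding rhs_def using w nn(1,2) by linarith
        next
          case 2
          then obtain y where y: "y \<in> Z" "\<bar>y - t\<bar> \<le> \<rho>" using hit by blast
          have "1 \<le> ind (y - \<rho>) (y + \<rho>) t" using y by (auto simp: ind_def)
          also have "\<dots> \<le> (\<Sum>y\<in>Z. ind (y - \<rho>) (y + \<rho>) t)" using y Z ind0 by (intro member_le_sum) auto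
          finally have "s^2 * 1 \<le> s^2 * ((\<Sum>y\<in>Z. ind (y - \<rho>) (y + \<rho>) t) + (ind 0 1 t + ind (T - 1) T t))"
            using nn ind0[of 0 1 t] ind0[of "T - 1" T t] by (intro mult_left_mono) linarith+
          thus ?thesis unfolding rhs_def using w nn(1,2) by linarith
        next
          case 3
          have rest: "s^2 * ((\<Sum>y\<in>Z. ind (y - \<rho>) (y + \<rho>) t) + (ind 0 1 t + ind (T - 1) T t)) \<ge> 0"
            using nn ind0 by (intro mult_nonneg_nonneg add_nonneg_nonneg) auto
          from 3 consider p where "p \<in> P" "norm (nit p t - \<xi> p) \<ge> \<delta>"
            | w where "dist c w \<le> R" "norm (Hfun P (w + \<i> * of_real t))^2 \<ge> \<delta>'"
            unfolding good by (auto simp: not_less)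
          thus ?thesis
          proof cases
            case 1
            have "norm (D t)^2 * \<delta>^2 \<le> norm (D t)^2 * norm (d p * nit p t - 1)^2"
              unfolding dp[OF 1(1)] using 1 \<delta> by (intro mult_left_mono power_mono) auto
            also have "\<dots> = norm (D t * (d p * nit p t - 1))^2" by (simp add: norm_mult power_mult_distrib)
            also have "\<dots> \<le> (\<Sum>p\<in>P. norm (D t * (d p * nit p t - 1))^2)"
              using 1 finP by (intro member_le_sum) auto
            finally have "norm (D t)^2 \<le> (\<Sum>p\<in>P. norm (D t * (d p * nit p t - 1))^2) * (1 / \<delta>^2)"
              using \<delta> by (simp add: field_simps)
            thus ?thesis unfolding rhs_def using nn rest by linarith
          next
            case 2
            define g where "g = (\<lambda>v. D t * Hfun P (v + \<i> * of_real t))"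
            have "g holomorphic_on cball c R2"
            proof -
              have "(\<lambda>v. v + \<i> * of_real t) holomorphic_on cball c R2" by (intro holomorphic_intros)
              hence "(Hfun P \<circ> (\<lambda>v. v + \<i> * of_real t)) holomorphic_on cball c R2"
                using holH by (rule holomorphic_on_compose)
              thus ?thesis unfolding g_def o_def by (intro holomorphic_on_mult holomorphic_on_const)
            qed
            from norm_square_le_circle_integral[OF this 2(1)] have "norm (g w)^2 \<le> K * q t"
              using R by (simp add: K_def q_def g_def)
            moreover have "norm (D t)^2 * \<delta>' \<le> norm (g w)^2"
              unfolding g_def norm_mult power_mult_distrib using 2 by (intro mult_left_mono) auto
            ultimately have "norm (D t)^2 \<le> (K / \<delta>') * q t" using \<delta>' by (simp add: field_simps)
            thus ?thesis unfolding rhs_def using nn rest by linarith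
          qed
        qed
      qed
      have iD: "(\<lambda>t. norm (D t * (d p * nit p t - 1))^2) integrable_on {0..T}" for p
        by (intro integrable_continuous_interval continuous_intros contD)
      have iS: "(\<lambda>t. \<Sum>p\<in>P. norm (D t * (d p * nit p t - 1))^2) integrable_on {0..T}"
        by (intro integrable_sum finP iD)
      have ii: "ind a b integrable_on {0..T}" "integral {0..T} (ind a b) \<le> b - a" if "a \<le> b" for a b
        unfolding ind_def using integral_indicator_le[OF that T(1)] by auto
      have iZ: "(\<lambda>t. \<Sum>y\<in>Z. ind (y - \<rho>) (y + \<rho>) t) integrable_on {0..T}"
        using \<rho> Z by (intro integrable_sum ii) auto
      have iI: "(\<lambda>t. ind 0 1 t + ind (T - 1) T t) integrable_on {0..T}"
        by (intro integrable_add ii) auto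
      have irhs: "rhs integrable_on {0..T}" unfolding rhs_def
        by (intro integrable_add integrable_on_mult_right integrable_on_mult_left iS q1 iZ iI)
      have "integral {0..T} (\<lambda>t. norm (D t)^2) \<le> integral {0..T} rhs"
        using pw by (intro integral_le irhs integrable_continuous_interval continuous_intros contD) auto
      also have "\<dots> = integral {0..T} (\<lambda>t. \<Sum>p\<in>P. norm (D t * (d p * nit p t - 1))^2) * (1 / \<delta>^2) + (K / \<delta>') * integral {0..T} q
            + s^2 * (integral {0..T} (\<lambda>t. \<Sum>y\<in>Z. ind (y - \<rho>) (y + \<rho>) t) + (integral {0..T} (ind 0 1) + integral {0..T} (ind (T - 1) T)))"
      proof -
        have "(rhs has_integral (integral {0..T} (\<lambda>t. \<Sum>p\<in>P. norm (D t * (d p * nit p t - 1))^2) * (1 / \<delta>^2) + (K / \<delta>') * integral {0..T} q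
            + s^2 * (integral {0..T} (\<lambda>t. \<Sum>y\<in>Z. ind (y - \<rho>) (y + \<rho>) t) + (integral {0..T} (ind 0 1) + integral {0..T} (ind (T - 1) T))))) {0..T}"
          unfolding rhs_def
          by (intro has_integral_add has_integral_mult_left has_integral_mult_right integrable_integral iS q1 iZ ii) auto
        thus ?thesis by (rule integral_unique)
      qed
      also have "\<dots> \<le> (real (card P) * ((2 * s / real J + \<delta>1) * T)) * (1 / \<delta>^2) + (K / \<delta>') * ((10 * s * z + \<delta>2) * T)
            + s^2 * (real (card Z) * (2 * \<rho>) + (1 + 1))"
      proof (intro add_mono mult_right_mono mult_left_mono)
        show "integral {0..T} (\<lambda>t. \<Sum>p\<in>P. norm (D t * (d p * nit p t - 1))^2) \<le> real (card P) * ((2 * s / real J + \<delta>1) * T)"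
        proof -
          have "integral {0..T} (\<lambda>t. \<Sum>p\<in>P. norm (D t * (d p * nit p t - 1))^2) = (\<Sum>p\<in>P. integral {0..T} (\<lambda>t. norm (D t * (d p * nit p t - 1))^2))"
            by (intro integral_sum finP iD)
          also have "\<dots> \<le> (\<Sum>p\<in>P. (2 * s / real J + \<delta>1) * T)" using elim(2) by (intro sum_mono) blast
          finally show ?thesis by simp
        qed
        show "integral {0..T} (\<lambda>t. \<Sum>y\<in>Z. ind (y - \<rho>) (y + \<rho>) t) \<le> real (card Z) * (2 * \<rho>)"
        proof -
          have "integral {0..T} (\<lambda>t. \<Sum>y\<in>Z. ind (y - \<rho>) (y + \<rho>) t) = (\<Sum>y\<in>Z. integral {0..T} (ind (y - \<rho>) (y + \<rho>)))"
            using \<rho> Z by (intro integral_sum ii) auto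
          also have "\<dots> \<le> (\<Sum>y\<in>Z. 2 * \<rho>)"
            using ii(2)[of "y - \<rho>" "y + \<rho>" for y] \<rho> by (intro sum_mono) (smt (verit))
          finally show ?thesis by simp
        qed
        show "integral {0..T} (ind 0 1) \<le> 1" "integral {0..T} (ind (T - 1) T) \<le> 1"
          using ii(2)[of 0 1] ii(2)[of "T - 1" T] by auto
      qed (use q2 K \<delta>' in auto)
      finally have up: "integral {0..T} (\<lambda>t. norm (D t)^2) \<le> (real (card P) * ((2 * s / real J + \<delta>1) * T)) * (1 / \<delta>^2) + (K / \<delta>') * ((10 * s * z + \<delta>2) * T)
            + s^2 * (real (card Z) * (2 * \<rho>) + (1 + 1))" .
      have b1: "(real (card P) * ((2 * s / real J + \<delta>1) * T)) * (1 / \<delta>^2) \<le> (s / 8) * T"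
      proof -
        define k where "k = real (card P) + 1"
        have k: "k > 0" by (simp add: k_def add_nonneg_pos)
        have "2 * s / real J \<le> 2 * s / (32 * k / \<delta>^2)"
          using J2 J s1 k \<delta> unfolding k_def[symmetric] by (intro divide_left_mono) auto
        also have "\<dots> = \<delta>^2 * s / (16 * k)" using k \<delta> by (simp add: field_simps)
        finally have "2 * s / real J + \<delta>1 \<le> \<delta>^2 * s / (16 * k) + \<delta>^2 * s / (16 * k)"
          unfolding \<delta>1_def k_def[symmetric] by (rule add_right_mono)
        also have "\<dots> = \<delta>^2 * s / (8 * k)" using k by (simp add: field_simps)
        finally have "2 * s / real J + \<delta>1 \<le> \<delta>^2 * s / (8 * k)" .
        hence "real (card P) * ((2 * s / real J + \<delta>1) * T) \<le> k * ((\<delta>^2 * s / (8 * k)) * T)"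
          using T k s1 \<delta>1 by (intro mult_mono mult_right_mono) (auto simp: k_def)
        also have "\<dots> = \<delta>^2 * ((s / 8) * T)" using k by simp
        finally show ?thesis using \<delta> by (simp add: field_simps)
      qed
      have b2: "(K / \<delta>') * ((10 * s * z + \<delta>2) * T) \<le> (s / 4) * T"
      proof -
        have "K * (80 * z) \<le> \<delta>'" using small unfolding K_def z_def by (simp add: mult_ac)
        hence "s * (K * (80 * z)) \<le> s * \<delta>'" using s1 by (intro mult_left_mono) auto
        moreover have "K * \<delta>2 = s / 8 * \<delta>'" using K by (simp add: \<delta>2_def)
        ultimately have "K * (10 * s * z + \<delta>2) \<le> s / 4 * \<delta>'" by (simp add: algebra_simps)
        hence "K * (10 * s * z + \<delta>2) / \<delta>' \<le> s / 4" using \<delta>' by (simp add: field_simps)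
        from mult_right_mono[OF this T(1)] show ?thesis by simp
      qed
      have ds: "(\<Sum>m\<in>S. norm (d m)^2) = s" by (simp add: d1 s_def)
      have low: "integral {0..T} (\<lambda>t. norm (D t)^2) \<ge> s * T - (s / 8) * T" 
        using elim(3) unfolding ds mult.commute[of T] by linarith
      \<comment> \<open>The losses 1/8, 1/8 and 1/4 leave s T / 2; half of that absorbs the end
        pieces because T \<ge> 8 s.\<close>
      have "s * T - (s / 8) * T \<le> (s / 8) * T + (s / 4) * T + s^2 * (real (card Z) * (2 * \<rho>) + 2)"
        using low up b1 b2 unfolding one_add_one by linarith
      hence "(s / 2) * T \<le> s^2 * (real (card Z) * (2 * \<rho>)) + 2 * s^2" by (simp add: algebra_simps)
      moreover have "2 * s^2 \<le> (s / 4) * T"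
        using mult_left_mono[OF elim(4), of "s / 4"] s1 by (simp add: power2_eq_square)
      ultimately have "(s / 4) * T \<le> s^2 * (real (card Z) * (2 * \<rho>))" by simp
      hence "s * (T / 4) \<le> s * (s * (real (card Z) * (2 * \<rho>)))" by (simp add: power2_eq_square)
      hence "T / 4 \<le> s * (real (card Z) * (2 * \<rho>))" using s1 by (subst (asm) mult_le_cancel_left_pos) auto
      thus "(1 / (8 * s)) * T \<le> \<rho> * real (card Z)" using s1 by (simp add: field_simps)
    qed
  qed
  show ?thesis
    by (rule that[OF _ ev]) (use s1 in simp)
qed

section \<open>Twisted Euler products\<close>

text \<open>Euler's argument: convergence would bound the finite products of 1 - p^(-\<sigma>) below
  by some c > 0, uniformly for \<sigma> \<ge> 1. Then \<zeta>(\<sigma>) \<le> 1 / c for all \<sigma>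
  > 1, and \<sigma> \<rightarrow> 1 would bound the harmonic series.\<close>

lemma not_summable_prime_reciprocals:
  "\<not> summable (\<lambda>n. if prime n then 1 / real n else 0)"
proof
  let ?f = "\<lambda>n::nat. if prime n then 1 / real n else 0"
  assume sm: "summable ?f"
  define c where "c = exp (- 2 * suminf ?f)"
  have c: "c > 0" by (simp add: c_def)
  have Q: "(\<Prod>p | prime p \<and> p \<le> N. 1 - real p powr - \<sigma>) \<ge> c" if \<sigma>: "\<sigma> \<ge> 1" for N \<sigma>
  proof -
    have ex: "1 - x \<ge> exp (- 2 * x)" if "0 \<le> x" "x \<le> 1/2" for x :: real
    proof -
      have "1 \<le> (1 - x) * (1 + 2 * x)"
      proof -
        have "0 \<le> x * (1 - 2 * x)" using that by simp
        thus ?thesis by (simp add: algebra_simps)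
      qed
      also have "\<dots> \<le> (1 - x) * exp (2 * x)" using that by (intro mult_left_mono) auto
      finally show ?thesis by (simp add: exp_minus field_simps)
    qed
    have "c \<le> exp (\<Sum>p | prime p \<and> p \<le> N. - 2 * (1 / real p))"
    proof -
      have "(\<Sum>p | prime p \<and> p \<le> N. 1 / real p) = (\<Sum>n\<in>{..N}. ?f n)"
        by (subst sum.inter_filter [symmetric]) (auto intro!: sum.cong)
      also have "\<dots> \<le> suminf ?f" using sm by (intro sum_le_suminf) auto
      finally have "- 2 * suminf ?f \<le> - 2 * (\<Sum>p | prime p \<and> p \<le> N. 1 / real p)" by simp
      also have "\<dots> = (\<Sum>p | prime p \<and> p \<le> N. - 2 * (1 / real p))" by (rule sum_distrib_left)
      finally show ?thesis unfolding c_def by (simp only: exp_le_cancel_iff)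
    qed
    also have "\<dots> = (\<Prod>p | prime p \<and> p \<le> N. exp (- 2 * (1 / real p)))" by (rule exp_sum) simp
    also have "\<dots> \<le> (\<Prod>p | prime p \<and> p \<le> N. 1 - real p powr - \<sigma>)"
    proof (intro prod_mono conjI)
      fix p assume p: "p \<in> {p. prime p \<and> p \<le> N}"
      hence p2: "p \<ge> 2" by (auto simp: prime_ge_2_nat)
      have "exp (- 2 * (1 / real p)) \<le> 1 - 1 / real p" using p2 by (intro ex) auto
      also have "1 - 1 / real p = 1 - real p powr - 1" using p2 by (simp add: powr_minus_divide)
      also have "1 - real p powr - 1 \<le> 1 - real p powr - \<sigma>"
        using p2 \<sigma> by (intro diff_left_mono powr_mono) auto
      finally show "exp (- 2 * (1 / real p)) \<le> 1 - real p powr - \<sigma>" .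
    qed auto
    finally show ?thesis .
  qed
  have Z: "(\<Sum>n<M. real (Suc n) powr - \<sigma>) \<le> 1 / c" if \<sigma>: "\<sigma> > 1" for M \<sigma>
  proof -
    define z where "z = (\<Sum>n. real (Suc n) powr - \<sigma>)"
    have smz: "summable (\<lambda>n. real (Suc n) powr - \<sigma>)" using \<sigma> by (rule summable_powr_Suc)
    have cr: "complex_of_nat n powr - complex_of_real \<sigma> = complex_of_real (real n powr - \<sigma>)" if "n > 0" for n
      using powr_of_real[of "real n" "- \<sigma>"] that by simp
    have zz: "zeta_series (of_real \<sigma>) = of_real z"
      unfolding zeta_series_def z_def by (simp add: cr smz suminf_of_real del: of_nat_Suc)
    have z0: "z \<ge> 0" unfolding z_def using smz by (intro suminf_nonneg) auto
    have "z * c \<le> 1 + ztail N \<sigma>" if N: "N \<ge> 1" for N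
    proof -
      define q where "q = (\<Prod>p | prime p \<and> p \<le> N. 1 - real p powr - \<sigma>)"
      have "(\<Prod>p | prime p \<and> p \<le> N. 1 - of_nat p powr - of_real \<sigma>) = complex_of_real q"
        unfolding q_def of_real_prod by (intro prod.cong refl) (auto simp: cr prime_gt_0_nat)
      hence "norm (of_real z * of_real q - 1 :: complex) \<le> ztail N \<sigma>"
        using zeta_euler_product_approx[of N \<sigma> "of_real \<sigma>"] N \<sigma> zz by simp
      hence "\<bar>z * q - 1\<bar> \<le> ztail N \<sigma>"
        by (metis norm_of_real of_real_1 of_real_diff of_real_mult)
      moreover have "z * c \<le> z * q" unfolding q_def using Q[of \<sigma> N] \<sigma> z0 by (intro mult_left_mono) auto
      ultimately show ?thesis by linarith
    qed
    hence "\<forall>\<^sub>F N in sequentially. z * c \<le> 1 + ztail N \<sigma>"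
      by (intro eventually_sequentiallyI[of 1])
    moreover have "(\<lambda>N. 1 + ztail N \<sigma>) \<longlonglongrightarrow> 1 + 0" using \<sigma> by (intro tendsto_intros ztail_tendsto_0)
    ultimately have "z * c \<le> 1 + 0" by (intro tendsto_lowerbound) auto
    hence "z \<le> 1 / c" using c by (simp add: field_simps)
    moreover have "(\<Sum>n<M. real (Suc n) powr - \<sigma>) \<le> z"
      unfolding z_def using smz by (intro sum_le_suminf) auto
    ultimately show ?thesis by linarith
  qed
  have H: "(\<Sum>n<M. 1 / real (Suc n)) \<le> 1 / c" for M
  proof (rule tendsto_upperbound)
    show "((\<lambda>\<sigma>. \<Sum>n<M. real (Suc n) powr - \<sigma>) \<longlongrightarrow> (\<Sum>n<M. 1 / real (Suc n))) (at_right 1)"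
    proof (rule tendsto_sum)
      fix n
      have "((\<lambda>\<sigma>. real (Suc n) powr - \<sigma>) \<longlongrightarrow> real (Suc n) powr - 1) (at_right 1)"
        by (intro tendsto_intros) auto
      thus "((\<lambda>\<sigma>. real (Suc n) powr - \<sigma>) \<longlongrightarrow> 1 / real (Suc n)) (at_right 1)"
        by (simp add: powr_minus_divide del: of_nat_Suc)
    qed
    show "\<forall>\<^sub>F \<sigma> in at_right 1. (\<Sum>n<M. real (Suc n) powr - \<sigma>) \<le> 1 / c"
      using eventually_at_right_less[of 1] by eventually_elim (rule Z)
  qed simp
  have "summable (\<lambda>n. 1 / real (Suc n))"
    by (rule summableI_nonneg_bounded[OF _ H]) simp
  hence "summable (\<lambda>n. inverse (of_nat (Suc n)) :: real)" by (simp add: inverse_eq_divide)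
  thus False using not_summable_harmonic[where 'a = real] by (subst (asm) summable_Suc_iff) simp
qed

text \<open>If all late dyadic blocks had sums below V, the reciprocals of the primes in block j
  would add up to at most V 2^(j(\<sigma>-1)), a geometric series. Divergence of the sum of 1 / p is
  thus the only input on primes.\<close>

lemma dyadic_prime_block:
  assumes \<sigma>: "\<sigma> < 1"
  obtains j where "j \<ge> j0" "(\<Sum>p | prime p \<and> 2 ^ j < p \<and> p \<le> 2 ^ Suc j. real p powr - \<sigma>) \<ge> V"
proof (rule ccontr)
  note outer = that
  assume nt: "\<not> thesis"
  have less: "(\<Sum>p | prime p \<and> 2 ^ j < p \<and> p \<le> 2 ^ Suc j. real p powr - \<sigma>) < V" if "j \<ge> j0" for j
    using outer[OF that] nt by (meson not_le)
  let ?f = "\<lambda>n::nat. if prime n then 1 / real n else 0"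
  define q where "q = (2::real) powr (\<sigma> - 1)"
  have q: "0 < q" "q < 1" using \<sigma> powr_less_mono[of "\<sigma> - 1" 0 2] by (auto simp: q_def)
  have block: "(\<Sum>n\<in>{2^j<..2^Suc j}. ?f n) \<le> V * q ^ j" if "j \<ge> j0" for j
  proof -
    have "(\<Sum>n\<in>{2^j<..2^Suc j}. ?f n) = (\<Sum>p | prime p \<and> 2 ^ j < p \<and> p \<le> 2 ^ Suc j. 1 / real p)"
      by (subst sum.inter_filter [symmetric]) (auto intro!: sum.cong)
    also have "\<dots> \<le> (\<Sum>p | prime p \<and> 2 ^ j < p \<and> p \<le> 2 ^ Suc j. q ^ j * real p powr - \<sigma>)"
    proof (rule sum_mono)
      fix p :: nat assume "p \<in> {p. prime p \<and> 2 ^ j < p \<and> p \<le> 2 ^ Suc j}"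
      hence p: "2 ^ j \<le> p" by auto
      have "real (2 ^ j) \<le> real p" using p by (simp only: of_nat_le_iff)
      hence p': "2 ^ j \<le> real p" by simp
      have pp: "real p > 0" using p' by (rule order_less_le_trans[rotated]) simp
      have "1 / real p = real p powr (\<sigma> - 1) * real p powr - \<sigma>"
        using pp by (simp add: powr_diff powr_minus divide_simps)
      also have "real p powr (\<sigma> - 1) \<le> (2 ^ j) powr (\<sigma> - 1)" using p' \<sigma> by (intro powr_mono2') auto
      also have "(2 ^ j) powr (\<sigma> - 1) = q ^ j"
        by (simp add: q_def powr_powr mult.commute flip: powr_realpow)
      finally show "1 / real p \<le> q ^ j * real p powr - \<sigma>" by (simp add: mult_right_mono)
    qed
    also have "\<dots> = q ^ j * (\<Sum>p | prime p \<and> 2 ^ j < p \<and> p \<le> 2 ^ Suc j. real p powr - \<sigma>)"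
      by (simp add: sum_distrib_left)
    also have "\<dots> \<le> q ^ j * V" using less[OF that] q by (intro mult_left_mono) auto
    finally show ?thesis by (simp add: mult.commute)
  qed
  have V0: "V \<ge> 0" using less[of j0] by (meson le_refl less_imp_le order_trans sum_nonneg powr_ge_zero)
  have bd: "(\<Sum>n\<le>2^j. ?f n) \<le> (\<Sum>n\<le>2^j0. ?f n) + V * (\<Sum>i<j. q ^ i)" if "j \<ge> j0" for j
    using that
  proof (induction j rule: dec_induct)
    case base
    have "V * (\<Sum>i<j0. q ^ i) \<ge> 0" using V0 q by (intro mult_nonneg_nonneg sum_nonneg) auto
    thus ?case by linarith
  next
    case (step j)
    have "(2::nat)^j \<le> 2 ^ Suc j" by simp
    hence "{..2^Suc j} = {..2^j} \<union> {2^j<..(2::nat)^Suc j}" by auto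
    hence "(\<Sum>n\<le>2^Suc j. ?f n) = (\<Sum>n\<le>2^j. ?f n) + (\<Sum>n\<in>{2^j<..2^Suc j}. ?f n)"
      by (simp only:) (subst sum.union_disjoint, auto)
    also have "\<dots> \<le> (\<Sum>n\<le>2^j0. ?f n) + V * (\<Sum>i<j. q ^ i) + V * q ^ j"
      using step block[of j] by (intro add_mono) auto
    finally show ?case by (simp add: algebra_simps)
  qed
  have geo: "(\<Sum>i<j. q ^ i) \<le> 1 / (1 - q)" for j
    using q sum_le_suminf[of "\<lambda>i. q ^ i" "{..<j}"] by (simp add: suminf_geometric summable_geometric)
  have "summable ?f"
  proof (rule summableI_nonneg_bounded)
    fix n
    define j where "j = max n j0"
    have "n \<le> 2 ^ j" unfolding j_def using less_exp[of "max n j0"] by linarith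
    hence "(\<Sum>i<n. ?f i) \<le> (\<Sum>i\<le>2^j. ?f i)" by (intro sum_mono2) auto
    also have "\<dots> \<le> (\<Sum>n\<le>2^j0. ?f n) + V * (\<Sum>i<j. q ^ i)" by (rule bd) (simp add: j_def)
    also have "\<dots> \<le> (\<Sum>n\<le>2^j0. ?f n) + V * (1 / (1 - q))"
      using geo V0 by (intro add_left_mono mult_left_mono)
    finally show "(\<Sum>i<n. ?f i) \<le> (\<Sum>n\<le>2^j0. ?f n) + V * (1 / (1 - q))" .
  qed auto
  thus False using not_summable_prime_reciprocals by contradiction
qed

text \<open>The block is cut at the least endpoint where its sum reaches V, so it overshoots by at
  most its last term.\<close>

lemma prime_block:
  assumes \<sigma>: "\<sigma> < 1" "\<sigma> > 0" and V: "V > 0"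
  obtains N N' :: nat where "N \<ge> N0" "N \<ge> 2" "N' \<le> 2 * N" "N' \<ge> N"
    "(\<Sum>p | prime p \<and> N < p \<and> p \<le> N'. real p powr - \<sigma>) \<ge> V"
    "(\<Sum>p | prime p \<and> N < p \<and> p \<le> N'. real p powr - \<sigma>) \<le> V + real N powr - \<sigma>"
proof -
  obtain j where j: "j \<ge> max N0 1" "(\<Sum>p | prime p \<and> 2 ^ j < p \<and> p \<le> 2 ^ Suc j. real p powr - \<sigma>) \<ge> V"
    using dyadic_prime_block[OF \<sigma>(1)] by blast
  define N where "N = (2::nat) ^ j"
  have N: "N \<ge> N0" "N \<ge> 2"
  proof -
    have "N > j" unfolding N_def by (rule less_exp)
    thus "N \<ge> N0" "N \<ge> 2" using j by auto
  qed
  define s where "s = (\<lambda>M. \<Sum>p | prime p \<and> N < p \<and> p \<le> M. real p powr - \<sigma>)"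
  have "s (2 * N) \<ge> V" using j(2) by (simp add: s_def N_def)
  define N' where "N' = (LEAST M. s M \<ge> V)"
  have N': "s N' \<ge> V" "N' \<le> 2 * N" unfolding N'_def using \<open>s (2 * N) \<ge> V\<close> by (auto intro: LeastI Least_le)
  have "N' > N"
  proof (rule ccontr)
    assume "\<not> N' > N"
    hence "{p. prime p \<and> N < p \<and> p \<le> N'} = {}" by auto
    hence "s N' = 0" unfolding s_def by (simp only: sum.empty)
    thus False using N' V by simp
  qed
  have "\<not> s (N' - 1) \<ge> V" using not_less_Least[of "N' - 1" "\<lambda>M. s M \<ge> V"] \<open>N' > N\<close> unfolding N'_def by linarith
  moreover have "s N' \<le> s (N' - 1) + real N' powr - \<sigma>"
  proof -
    have "{p. prime p \<and> N < p \<and> p \<le> N'} \<subseteq> insert N' {p. prime p \<and> N < p \<and> p \<le> N' - 1}" by auto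
    hence "s N' \<le> (\<Sum>p\<in>insert N' {p. prime p \<and> N < p \<and> p \<le> N' - 1}. real p powr - \<sigma>)"
      unfolding s_def by (intro sum_mono2) auto
    also have "\<dots> = s (N' - 1) + real N' powr - \<sigma>"
      unfolding s_def using \<open>N' > N\<close> by (subst sum.insert) auto
    finally show ?thesis .
  qed
  moreover have "real N' powr - \<sigma> \<le> real N powr - \<sigma>" using \<open>N' > N\<close> \<sigma> N by (intro powr_mono2') auto
  ultimately have "s N' \<le> V + real N powr - \<sigma>" by linarith
  thus ?thesis using that[of N N'] N N' \<open>N' > N\<close> by (simp add: s_def)
qed

section \<open>Alternating signs on the small primes\<close>

text \<open>The sign alternates along the increasing sequence of primes, starting with +1 at
  2.\<close>

definition psign :: "nat \<Rightarrow> complex" where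
  "psign p = (-1) ^ card {q. prime q \<and> q < p}"

lemma norm_psign [simp]: "norm (psign p) = 1"
  by (simp add: psign_def norm_power)

lemma sum_psign: "(\<Sum>n\<le>N. if prime n then psign n else 0) = (if even (card {q::nat. prime q \<and> q \<le> N}) then 0 else 1)"
proof (induction N)
  case 0
  have "{q::nat. prime q \<and> q \<le> 0} = {}" by auto
  thus ?case by (simp only:) simp
next
  case (Suc N)
  have e: "{q::nat. prime q \<and> q < Suc N} = {q. prime q \<and> q \<le> N}" by auto
  show ?case
  proof (cases "prime (Suc N)")
    case True
    hence "{q::nat. prime q \<and> q \<le> Suc N} = insert (Suc N) {q. prime q \<and> q \<le> N}" by (auto simp: le_Suc_eq)
    thus ?thesis using Suc True by (auto simp: psign_def e)
  next
    case False
    hence "{q::nat. prime q \<and> q \<le> Suc N} = {q. prime q \<and> q \<le> N}" by (auto simp: le_Suc_eq)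
    thus ?thesis using Suc False by simp
  qed
qed

lemma summation_by_parts:
  fixes a b :: "nat \<Rightarrow> complex"
  shows "(\<Sum>n\<le>N. a n * b n) = (\<Sum>n\<le>N. a n) * b (Suc N) + (\<Sum>n\<le>N. (\<Sum>m\<le>n. a m) * (b n - b (Suc n)))"
  by (induction N) (simp_all add: algebra_simps)

lemma uniformly_convergent_on_atMost:
  assumes "uniformly_convergent_on K (\<lambda>N s. \<Sum>n<N. f n s)"
  shows "uniformly_convergent_on K (\<lambda>N s. \<Sum>n\<le>N. f n s :: complex)"
proof -
  obtain l where "uniform_limit K (\<lambda>N s. \<Sum>n<N. f n s) l sequentially"
    using assms by (auto simp: uniformly_convergent_on_def)
  hence "uniform_limit K (\<lambda>N s. \<Sum>n<Suc N. f n s) l sequentially"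
    by (rule filterlim_compose) (rule filterlim_Suc)
  thus ?thesis by (auto simp: uniformly_convergent_on_def lessThan_Suc_atMost)
qed

text \<open>Partial summation: the sums of the signs are 0 or 1, and consecutive powers differ by at
  most B n^(-1-\<alpha>).\<close>

lemma psign_sum_uniformly_convergent:
  assumes "0 < \<alpha>" "\<And>s. s \<in> K \<Longrightarrow> Re s \<ge> \<alpha>" "\<And>s. s \<in> K \<Longrightarrow> norm s \<le> B"
  shows "uniformly_convergent_on K (\<lambda>N s. \<Sum>n\<le>N. (if prime n then psign n else 0) * of_nat n powr - s)"
proof -
  define a where "a = (\<lambda>n. if prime n then psign n else 0)"
  define b where "b = (\<lambda>s n. if n = 0 then 1 else (of_nat n powr - s :: complex))"
  define S where "S = (\<lambda>n. \<Sum>m\<le>n. a m)"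
  have S: "norm (S n) \<le> 1" for n unfolding S_def a_def sum_psign by simp
  have S0: "S 0 = 0" by (simp add: S_def a_def)
  have eq: "(\<Sum>n\<le>N. a n * of_nat n powr - s) = S N * b s (Suc N) + (\<Sum>n\<le>N. S n * (b s n - b s (Suc n)))" for N s
  proof -
    have "(\<Sum>n\<le>N. a n * of_nat n powr - s) = (\<Sum>n\<le>N. a n * b s n)"
      by (intro sum.cong refl) (auto simp: b_def a_def)
    also have "\<dots> = S N * b s (Suc N) + (\<Sum>n\<le>N. S n * (b s n - b s (Suc n)))"
      unfolding S_def by (rule summation_by_parts)
    finally show ?thesis .
  qed
  have u1: "uniformly_convergent_on K (\<lambda>N s. \<Sum>n<N. S n * (b s n - b s (Suc n)))"
  proof (rule Weierstrass_m_test')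
    show "summable (\<lambda>n. B * real n powr - (1 + \<alpha>))"
      using assms(1) by (intro summable_mult) (subst summable_real_powr_iff, simp)
    fix n s assume s: "s \<in> K"
    show "norm (S n * (b s n - b s (Suc n))) \<le> B * real n powr - (1 + \<alpha>)"
    proof (cases "n = 0")
      case False
      have "norm (fdiff 1 s (real n)) \<le> (\<Prod>i<1. norm (s + of_nat i)) * real n powr (- Re s - real 1)"
        using False assms(2)[OF s] assms(1) by (intro norm_fdiff_le) auto
      also have "\<dots> \<le> B * real n powr - (1 + \<alpha>)"
        using assms(2,3)[OF s] False order_trans[OF norm_ge_zero assms(3)[OF s]] by (intro mult_mono powr_mono) auto
      finally have "norm (b s n - b s (Suc n)) \<le> B * real n powr - (1 + \<alpha>)"
        using False by (simp add: b_def add.commute)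
      moreover have "norm (S n * (b s n - b s (Suc n))) \<le> 1 * norm (b s n - b s (Suc n))"
        unfolding norm_mult using S by (intro mult_right_mono) auto
      ultimately show ?thesis by linarith
    qed (simp add: S0)
  qed
  have u2: "uniform_limit K (\<lambda>N s. S N * b s (Suc N)) (\<lambda>s. 0) sequentially"
  proof (rule uniform_limitI)
    fix e :: real assume "e > 0"
    have "(\<lambda>N. real (Suc N) powr - \<alpha>) \<longlonglongrightarrow> 0"
      using assms(1) by real_asymp
    hence "\<forall>\<^sub>F N in sequentially. real (Suc N) powr - \<alpha> < e" by (rule order_tendstoD) fact
    thus "\<forall>\<^sub>F N in sequentially. \<forall>s\<in>K. dist (S N * b s (Suc N)) 0 < e"
    proof eventually_elim
      case (elim N)
      show ?case
      proof
        fix s assume s: "s \<in> K"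
        have "norm (S N * b s (Suc N)) \<le> 1 * norm (b s (Suc N))"
          unfolding norm_mult using S by (intro mult_right_mono) auto
        also have "norm (b s (Suc N)) = real (Suc N) powr - Re s"
          unfolding b_def by (simp only: nat.distinct if_False norm_nat_powr zero_less_Suc)
        also have "1 * (real (Suc N) powr - Re s) \<le> real (Suc N) powr - \<alpha>"
          using assms(2)[OF s] by (simp add: powr_mono)
        finally show "dist (S N * b s (Suc N)) 0 < e" using elim by simp
      qed
    qed
  qed
  have u1': "uniformly_convergent_on K (\<lambda>N s. \<Sum>n\<le>N. S n * (b s n - b s (Suc n)))"
    using u1 by (rule uniformly_convergent_on_atMost)
  show ?thesis
    unfolding eq[unfolded a_def]
    by (intro uniformly_convergent_add u1') (use u2 in \<open>auto simp: uniformly_convergent_on_def\<close>)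
qed

text \<open>Logarithm of the twisted Euler product for \<zeta>(ks) over the primes up to N. Twisting
  p^(-s) by a sign twists p^(-ks) by its k-th power.\<close>

definition logprod :: "nat \<Rightarrow> nat \<Rightarrow> complex \<Rightarrow> complex" where
  "logprod k N s = (\<Sum>n\<le>N. if prime n then - Ln (1 - psign n ^ k * of_nat n powr - (of_nat k * s)) else 0)"

lemma norm_prime_powr_le:
  assumes "prime p" "Re s > 1/2"
  shows "norm (of_nat p powr - s :: complex) \<le> 3/4"
proof -
  have p: "p \<ge> 2" using assms(1) by (rule prime_ge_2_nat)
  have "norm (of_nat p powr - s :: complex) = real p powr - Re s" using p by (intro norm_nat_powr) simp
  also have "\<dots> \<le> real p powr - (1/2)" using p assms by (intro powr_mono) auto
  also have "\<dots> \<le> 2 powr - (1/2)" using p by (intro powr_mono2') auto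
  also have "2 powr - (1/2) = 1 / sqrt (2::real)" by (simp add: powr_minus_divide powr_half_sqrt)
  also have "\<dots> \<le> 3/4"
  proof -
    have "4/3 \<le> sqrt (2::real)" by (rule real_le_rsqrt) (simp add: power2_eq_square)
    thus ?thesis by (simp add: field_simps)
  qed
  finally show ?thesis .
qed

lemma Ln_one_minus_approx:
  fixes z :: complex
  assumes "norm z \<le> 3/4"
  shows "norm (- Ln (1 - z) - z) \<le> 4 * norm z ^ 2" "norm (Ln (1 - z)) \<le> 4 * norm z"
proof -
  have "norm (ln (1 + - z) - - z) \<le> norm (- z)^2 / (1 - norm (- z))"
    using assms by (intro Ln_approx_linear) auto
  also have "\<dots> = norm z^2 / (1 - norm z)" by simp
  finally have 1: "norm (- Ln (1 - z) - z) \<le> norm z ^ 2 / (1 - norm z)"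
    by (metis add_uminus_conv_diff minus_add_distrib minus_minus norm_minus_cancel diff_conv_add_uminus)
  also have "\<dots> \<le> norm z ^ 2 / (1/4)" using assms by (intro divide_left_mono) auto
  finally show "norm (- Ln (1 - z) - z) \<le> 4 * norm z ^ 2" by simp
  have "norm (Ln (1 - z)) = norm ((- Ln (1 - z) - z) + z)" by simp
  also have "\<dots> \<le> norm z ^ 2 / (1 - norm z) + norm z" by (rule norm_triangle_le) (use 1 in simp)
  also have "\<dots> = norm z / (1 - norm z)" using assms by (simp add: field_simps power2_eq_square)
  also have "\<dots> \<le> norm z / (1/4)" using assms by (intro divide_left_mono) auto
  finally show "norm (Ln (1 - z)) \<le> 4 * norm z" by simp
qed

lemma norm_prime_factor_le:
  assumes "prime p" "norm x = 1" "Re s \<ge> \<alpha>" "\<alpha> > 1/2" "1 \<le> k"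
  shows "norm (x ^ k * of_nat p powr - (of_nat k * s) :: complex) \<le> 3/4"
    and "norm (x ^ k * of_nat p powr - (of_nat k * s) :: complex) \<le> real p powr - (real k * \<alpha>)"
proof -
  have ks: "Re (of_nat k * s) \<ge> real k * \<alpha>" using assms by (simp add: mult_left_mono)
  moreover have "real k * \<alpha> \<ge> 1 * \<alpha>" using assms by (intro mult_right_mono) auto
  ultimately have "Re (of_nat k * s) > 1/2" using assms by linarith
  from norm_prime_powr_le[OF assms(1) this] show "norm (x ^ k * of_nat p powr - (of_nat k * s) :: complex) \<le> 3/4"
    using assms by (simp add: norm_mult norm_power)
  have p: "p > 0" "real p \<ge> 1" using prime_ge_2_nat[OF assms(1)] by auto
  have "norm (of_nat p powr - (of_nat k * s) :: complex) = real p powr - Re (of_nat k * s)"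
    using p by (intro norm_nat_powr)
  also have "\<dots> \<le> real p powr - (real k * \<alpha>)" using ks p by (intro powr_mono) auto
  finally show "norm (x ^ k * of_nat p powr - (of_nat k * s) :: complex) \<le> real p powr - (real k * \<alpha>)"
    using assms by (simp add: norm_mult norm_power)
qed

text \<open>For k \<ge> 2 the terms are O(n^(-2\<alpha>)). For k = 1 the same holds after the linear
  term is subtracted, and the linear terms converge because of the alternating signs.\<close>

lemma logprod_uniformly_convergent:
  assumes a: "1/2 < \<alpha>" "\<And>s. s \<in> K \<Longrightarrow> Re s \<ge> \<alpha>" "\<And>s. s \<in> K \<Longrightarrow> norm s \<le> B" and k: "k \<ge> 1"
  shows "uniformly_convergent_on K (logprod k)"
proof -
  have sm: "summable (\<lambda>n. 4 * real n powr - (2 * \<alpha>))"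
    using a by (intro summable_mult) (subst summable_real_powr_iff, simp)
  define g where "g = (\<lambda>n s. if prime n then - Ln (1 - psign n ^ k * of_nat n powr - (of_nat k * s)) else 0)"
  have lp: "logprod k = (\<lambda>N s. \<Sum>n\<le>N. g n s)" by (simp add: logprod_def g_def fun_eq_iff)
  show ?thesis
  proof (cases "k = 1")
    case False
    hence k2: "k \<ge> 2" using k by simp
    show ?thesis unfolding lp
    proof (intro uniformly_convergent_on_atMost Weierstrass_m_test'[OF _ sm])
      fix n s assume s: "s \<in> K"
      show "norm (g n s) \<le> 4 * real n powr - (2 * \<alpha>)"
      proof (cases "prime n")
        case True
        note b = norm_prime_factor_le[OF True norm_psign[of n] a(2)[OF s] a(1) k]
        have "norm (g n s) \<le> 4 * norm (psign n ^ k * of_nat n powr - (of_nat k * s))"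
          using Ln_one_minus_approx(2)[OF b(1)] True by (simp add: g_def)
        also have "\<dots> \<le> 4 * real n powr - (real k * \<alpha>)" using b(2) by (rule mult_left_mono) simp
        also have "\<dots> \<le> 4 * real n powr - (2 * \<alpha>)"
          using k2 a prime_ge_2_nat[OF True] by (intro mult_left_mono powr_mono) auto
        finally show ?thesis .
      qed (simp add: g_def)
    qed
  next
    case True
    define a1 where "a1 = (\<lambda>n s. (if prime n then psign n else 0) * (of_nat n powr - s :: complex))"
    have "uniformly_convergent_on K (\<lambda>N s. \<Sum>n\<le>N. g n s - a1 n s)"
    proof (intro uniformly_convergent_on_atMost Weierstrass_m_test'[OF _ sm])
      fix n s assume s: "s \<in> K"
      show "norm (g n s - a1 n s) \<le> 4 * real n powr - (2 * \<alpha>)"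
      proof (cases "prime n")
        case prime: True
        note b = norm_prime_factor_le[OF prime norm_psign[of n] a(2)[OF s] a(1) order_refl, unfolded power_one_right of_nat_1 mult_1]
        have "norm (g n s - a1 n s) \<le> 4 * norm (psign n * of_nat n powr - s) ^ 2"
          using Ln_one_minus_approx(1)[OF b(1)] prime True by (simp add: g_def a1_def)
        also have "\<dots> \<le> 4 * (real n powr - \<alpha>) ^ 2" using b(2) by (intro mult_left_mono power_mono) auto
        also have "(real n powr - \<alpha>) ^ 2 = real n powr - (2 * \<alpha>)" by (simp add: power2_eq_square flip: powr_add)
        finally show ?thesis .
      qed (simp add: g_def a1_def)
    qed
    moreover have "uniformly_convergent_on K (\<lambda>N s. \<Sum>n\<le>N. a1 n s)"
      unfolding a1_def using a by (intro psign_sum_uniformly_convergent[of \<alpha> K B]) auto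
    ultimately have "uniformly_convergent_on K (\<lambda>N s. (\<Sum>n\<le>N. g n s - a1 n s) + (\<Sum>n\<le>N. a1 n s))"
      by (rule uniformly_convergent_add)
    thus ?thesis unfolding lp by (simp add: sum_subtractf)
  qed
qed

text \<open>Uniform convergence and continuity give a joint limit as N \<rightarrow> \<infinity> and
  s \<rightarrow> \<sigma>. The joint form is needed because the discs around \<sigma> shrink while
  N grows.\<close>

lemma logprod_limit:
  assumes s: "1/2 < \<sigma>" and k: "k \<ge> 1"
  shows "\<exists>l. \<forall>\<epsilon>>0. \<exists>N1 \<eta>. \<eta> > 0 \<and> (\<forall>N\<ge>N1. \<forall>s. norm (s - of_real \<sigma>) < \<eta> \<longrightarrow> norm (logprod k N s - l) < \<epsilon>)"
proof -
  define d where "d = (\<sigma> - 1/2) / 2"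
  define K where "K = cball (complex_of_real \<sigma>) d"
  have d: "d > 0" using s by (simp add: d_def)
  have K: "Re z \<ge> 1/2 + d" "norm z \<le> \<bar>\<sigma>\<bar> + d" if "z \<in> K" for z
  proof -
    have dd: "norm (of_real \<sigma> - z) \<le> d" using that by (simp add: K_def dist_norm)
    show "Re z \<ge> 1/2 + d" using abs_Re_le_cmod[of "of_real \<sigma> - z"] dd by (simp add: d_def field_simps)
    show "norm z \<le> \<bar>\<sigma>\<bar> + d" using norm_triangle_sub[of z "of_real \<sigma>"] dd by (simp add: norm_minus_commute)
  qed
  have "uniformly_convergent_on K (logprod k)"
    using d K k by (intro logprod_uniformly_convergent[of "1/2 + d"]) auto
  then obtain F where F: "uniform_limit K (logprod k) F sequentially" by (auto simp: uniformly_convergent_on_def)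
  have cont: "continuous_on K (logprod k N)" for N
    unfolding logprod_def
  proof (intro continuous_intros)
    fix n
    show "continuous_on K (\<lambda>s. if prime n then - Ln (1 - psign n ^ k * of_nat n powr - (of_nat k * s)) else 0)"
    proof (cases "prime n")
      case True
      have "n > 0" using True by (simp add: prime_gt_0_nat)
      hence "continuous_on K (\<lambda>s. 1 - psign n ^ k * of_nat n powr - (of_nat k * s))"
        by (intro holomorphic_on_imp_continuous_on holomorphic_intros) auto
      hence "continuous_on K (\<lambda>s. - Ln (1 - psign n ^ k * of_nat n powr - (of_nat k * s)))"
      proof (intro continuous_on_minus continuous_on_Ln')
        fix z assume z: "z \<in> K"
        let ?a = "psign n ^ k * of_nat n powr - (of_nat k * z)"
        have "norm ?a \<le> 3/4" using norm_prime_factor_le(1)[OF True norm_psign K(1)[OF z] _ k] d by simp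
        hence "Re (1 - ?a) > 0" using abs_Re_le_cmod[of ?a] by simp
        thus "1 - ?a \<notin> \<real>\<^sub>\<le>\<^sub>0" by (auto simp: complex_nonpos_Reals_iff)
      qed
      thus ?thesis using True by simp
    qed simp
  qed
  have contF: "continuous_on K F"
    using F cont by (intro uniform_limit_theorem[OF _ F]) auto
  show ?thesis
  proof (intro exI[of _ "F (of_real \<sigma>)"] allI impI)
    fix \<epsilon> :: real assume e: "\<epsilon> > 0"
    hence e2: "\<epsilon> / 2 > 0" by simp
    have "of_real \<sigma> \<in> K" using d by (simp add: K_def)
    from contF[unfolded continuous_on_iff, rule_format, OF this e2] obtain \<eta>1 where
      \<eta>1: "\<eta>1 > 0" "\<And>z. z \<in> K \<Longrightarrow> dist z (of_real \<sigma>) < \<eta>1 \<Longrightarrow> dist (F z) (F (of_real \<sigma>)) < \<epsilon> / 2" by blast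
    from uniform_limitD[OF F e2] obtain N1 where
      N1: "\<And>N z. N \<ge> N1 \<Longrightarrow> z \<in> K \<Longrightarrow> dist (logprod k N z) (F z) < \<epsilon> / 2"
      unfolding eventually_sequentially by blast
    show "\<exists>N1 \<eta>. \<eta> > 0 \<and> (\<forall>N\<ge>N1. \<forall>s. norm (s - of_real \<sigma>) < \<eta> \<longrightarrow> norm (logprod k N s - F (of_real \<sigma>)) < \<epsilon>)"
    proof (intro exI[of _ N1] exI[of _ "min \<eta>1 d"] conjI allI impI)
      fix N and z :: complex assume N: "N \<ge> N1" and z: "norm (z - of_real \<sigma>) < min \<eta>1 d"
      have zK: "z \<in> K" using z by (simp add: K_def dist_norm norm_minus_commute)
      have "dist (logprod k N z) (F (of_real \<sigma>)) \<le> dist (logprod k N z) (F z) + dist (F z) (F (of_real \<sigma>))"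
        by (rule dist_triangle)
      also have "\<dots> < \<epsilon> / 2 + \<epsilon> / 2"
        using N1[OF N zK] \<eta>1(2)[OF zK] z by (intro add_strict_mono) (auto simp: dist_norm)
      finally show "norm (logprod k N z - F (of_real \<sigma>)) < \<epsilon>" by (simp add: dist_norm)
    qed (use \<eta>1 d in auto)
  qed
qed

section \<open>A block of primes with constant phase\<close>

text \<open>The Euler product of \<zeta>(ks) over P with p^(-s) replaced by \<open>y p\<close> times
  p^(-s).\<close>

definition tprod :: "nat set \<Rightarrow> (nat \<Rightarrow> complex) \<Rightarrow> nat \<Rightarrow> complex \<Rightarrow> complex" where
  "tprod P y k s = (\<Prod>p\<in>P. inverse (1 - y p ^ k * of_nat p powr - (of_nat k * s)))"

lemma tprod_eq_exp:
  assumes "\<And>p. p \<in> P \<Longrightarrow> prime p" "finite P" "\<And>p. norm (y p) = 1" "Re s \<ge> \<alpha>" "\<alpha> > 1/2" "k \<ge> 1"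
  shows "tprod P y k s = exp (\<Sum>p\<in>P. - Ln (1 - y p ^ k * of_nat p powr - (of_nat k * s)))"
proof -
  have "inverse (1 - y p ^ k * of_nat p powr - (of_nat k * s)) = exp (- Ln (1 - y p ^ k * of_nat p powr - (of_nat k * s)))"
    if "p \<in> P" for p
  proof -
    have "norm (y p ^ k * of_nat p powr - (of_nat k * s)) \<le> 3/4"
      using norm_prime_factor_le(1)[OF assms(1)[OF that] assms(3-6)] .
    hence "1 - y p ^ k * of_nat p powr - (of_nat k * s) \<noteq> 0" by auto
    thus ?thesis by (simp add: exp_minus)
  qed
  thus ?thesis unfolding tprod_def by (simp add: exp_sum[OF assms(2)])
qed

lemma norm_exp_minus_1_le:
  fixes z :: complex
  assumes "norm z \<le> 1/2"
  shows "norm (exp z - 1) \<le> 2 * norm z"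
proof -
  have "norm (exp z - 1) \<le> 3 / 2 * norm z" using norm_exp_bounds(2)[of z] assms by simp
  thus ?thesis using norm_ge_zero[of z] by linarith
qed

text \<open>The primes \<open>p\<close> in a block \<open>(N, 2N]\<close> satisfy \<open>ln p / ln N \<rightarrow> 1\<close>, so that on the scale
  \<open>s = \<sigma> + w / ln N\<close> their contribution \<open>u p\<^sup>-\<^sup>s\<close> is \<open>u p\<^sup>-\<^sup>\<sigma> exp (-w)\<close> up to a small error.\<close>

lemma block_sum_approx:
  fixes v w :: complex
  assumes v: "v \<noteq> 0" and N: "N \<ge> 2" "N' \<le> 2 * N" and L: "L = ln (real N)" "L \<ge> 1" and w: "norm w \<le> 1/2"
    and S: "S = (\<Sum>p | prime p \<and> N < p \<and> p \<le> N'. real p powr - \<sigma>)"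
    and Sv: "S \<ge> norm v" "S \<le> norm v + real N powr - \<sigma>" and \<sigma>: "\<sigma> > 0"
  shows "norm ((\<Sum>p | prime p \<and> N < p \<and> p \<le> N'. sgn v * of_nat p powr - (of_real \<sigma> + w / of_real L)) - v * exp (- w))
      \<le> 2 * (norm v + 1) / L + 2 * real N powr - \<sigma>"
proof -
  let ?B = "{p. prime p \<and> N < p \<and> p \<le> N'}"
  \<comment> \<open>The relative excess of ln p over ln N, at most ln 2 / L in a block that ends at
    2 N.\<close>
  define \<tau> where "\<tau> = (\<lambda>p. ln (real p) / L - 1)"
  have \<tau>: "0 \<le> \<tau> p" "\<tau> p \<le> 1 / L" if "p \<in> ?B" for p
  proof -
    have "ln (real p) \<ge> ln (real N)" "ln (real p) \<le> ln (real (2 * N))" using that N by (auto simp: ln_le_cancel_iff)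
    moreover have "ln (real (2 * N)) = ln 2 + ln (real N)" using N by (simp add: ln_mult)
    moreover have "ln (2::real) \<le> 1" using ln_le_minus_one[of 2] by simp
    ultimately have "ln (real p) \<ge> L" "ln (real p) \<le> L + 1" using L by auto
    hence "L / L \<le> ln (real p) / L" "ln (real p) / L \<le> (L + 1) / L" using L by (auto intro!: divide_right_mono)
    moreover have "L / L = 1" "(L + 1) / L = 1 + 1 / L" using L by (auto simp: add_divide_distrib)
    ultimately show "0 \<le> \<tau> p" "\<tau> p \<le> 1 / L" by (auto simp: \<tau>_def)
  qed
  have pw: "of_nat p powr - (of_real \<sigma> + w / of_real L) = of_real (real p powr - \<sigma>) * exp (- w) * exp (- w * of_real (\<tau> p))"
    if "p \<in> ?B" for p
  proof -
    have p: "real p > 0" using that by auto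
    have Lnp: "Ln (of_nat p) = of_real (ln (real p))" using p by (metis Ln_of_real of_real_of_nat_eq)
    have "of_nat p powr - (of_real \<sigma> + w / of_real L) = exp (- (of_real \<sigma> + w / of_real L) * of_real (ln (real p)))"
      using p by (simp add: powr_def Lnp)
    also have "- (of_real \<sigma> + w / of_real L) * of_real (ln (real p)) = of_real (- \<sigma> * ln (real p)) + (- w) + (- w * of_real (\<tau> p))"
      using L by (simp add: \<tau>_def field_simps)
    also have "exp \<dots> = of_real (exp (- \<sigma> * ln (real p))) * exp (- w) * exp (- w * of_real (\<tau> p))"
      by (simp only: exp_add exp_of_real)
    also have "exp (- \<sigma> * ln (real p)) = real p powr - \<sigma>" using p by (simp add: powr_def)
    finally show ?thesis .
  qed
  have nw: "norm (exp (- w)) \<le> 2"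
  proof -
    have "norm (exp (- w)) \<le> exp (norm (- w))" by (rule norm_exp)
    also have "\<dots> \<le> exp (1/2)" using w by simp
    also have "\<dots> \<le> 1 + 1/2 + (1/2)^2" by (rule exp_bound) auto
    also have "\<dots> \<le> (2::real)" by (simp add: power2_eq_square)
    finally show ?thesis .
  qed
  have nsg: "norm (sgn v) = 1" using v by (simp add: norm_sgn)
  have vs: "v = sgn v * of_real (norm v)" using v by (simp add: sgn_div_norm scaleR_conv_of_real field_simps)
  define E where "E = (\<Sum>p\<in>?B. of_real (real p powr - \<sigma>) * (exp (- w * of_real (\<tau> p)) - 1))"
  have "norm E \<le> (\<Sum>p\<in>?B. real p powr - \<sigma> * (1 / L))"
    unfolding E_def
  proof (rule sum_norm_le)
    fix p assume p: "p \<in> ?B"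
    have n1: "norm (- w * of_real (\<tau> p)) \<le> 1/2 * (1 / L)"
      unfolding norm_mult using w \<tau>[OF p] by (intro mult_mono) auto
    moreover have "1/2 * (1 / L) \<le> 1/2" using L by (simp add: field_simps)
    ultimately have "norm (- w * of_real (\<tau> p)) \<le> 1/2" by linarith
    from norm_exp_minus_1_le[OF this] n1 have "norm (exp (- w * of_real (\<tau> p)) - 1) \<le> 1 / L" by simp
    thus "norm (of_real (real p powr - \<sigma>) * (exp (- w * of_real (\<tau> p)) - 1)) \<le> real p powr - \<sigma> * (1 / L)"
      unfolding norm_mult by (intro mult_mono) auto
  qed
  also have "\<dots> = S * (1 / L)" unfolding S by (rule sum_distrib_right [symmetric])
  also have "\<dots> \<le> (norm v + 1) * (1 / L)"
  proof -
    have "real N powr - \<sigma> \<le> real N powr 0" using N \<sigma> by (intro powr_mono) auto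
    hence "S \<le> norm v + 1" using Sv N by simp
    thus ?thesis using L by (intro mult_right_mono) auto
  qed
  finally have E: "norm E \<le> (norm v + 1) / L" by simp
  have "(\<Sum>p\<in>?B. sgn v * of_nat p powr - (of_real \<sigma> + w / of_real L)) = (\<Sum>p\<in>?B. sgn v * exp (- w) * (of_real (real p powr - \<sigma>) * exp (- w * of_real (\<tau> p))))"
    by (intro sum.cong refl) (simp only: pw mult_ac)
  also have "\<dots> = sgn v * exp (- w) * (E + of_real S)"
    unfolding S E_def of_real_sum sum.distrib [symmetric] sum_distrib_left
    by (intro sum.cong refl) (simp add: algebra_simps)
  finally have "(\<Sum>p\<in>?B. sgn v * of_nat p powr - (of_real \<sigma> + w / of_real L)) - v * exp (- w)
     = sgn v * exp (- w) * (E + of_real S) - (sgn v * of_real (norm v)) * exp (- w)"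
    using vs by simp
  also have "\<dots> = sgn v * exp (- w) * (E + of_real (S - norm v))" by (simp add: algebra_simps)
  also have "norm \<dots> = norm (exp (- w)) * norm (E + of_real (S - norm v))" by (simp add: norm_mult nsg)
  also have "\<dots> \<le> 2 * ((norm v + 1) / L + real N powr - \<sigma>)"
  proof (intro mult_mono nw)
    have "norm (E + of_real (S - norm v)) \<le> norm E + norm (of_real (S - norm v) :: complex)" by (rule norm_triangle_ineq)
    also have "norm (of_real (S - norm v) :: complex) = S - norm v" using Sv by (simp only: norm_of_real)
    also have "norm E + (S - norm v) \<le> (norm v + 1) / L + real N powr - \<sigma>" using E Sv by linarith
    finally show "norm (E + of_real (S - norm v)) \<le> (norm v + 1) / L + real N powr - \<sigma>" .
  qed auto
  finally show ?thesis by (simp add: algebra_simps)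
qed

lemma sum_block_le_ztail:
  assumes "a > 1"
  shows "(\<Sum>p | prime p \<and> N < p \<and> p \<le> N'. real p powr - a) \<le> ztail N a"
proof -
  have "(\<Sum>p | prime p \<and> N < p \<and> p \<le> N'. real p powr - a) \<le> (\<Sum>p\<in>{N<..N'}. real p powr - a)"
    by (intro sum_mono2) auto
  also have "\<dots> = (\<Sum>n<N'-N. real (Suc (n + N)) powr - a)"
    by (rule sum.reindex_bij_witness[of _ "\<lambda>n. Suc (n + N)" "\<lambda>k. k - Suc N"]) auto
  also have "\<dots> \<le> ztail N a"
    unfolding ztail_def by (intro sum_le_suminf summable_ztail assms) auto
  finally show ?thesis .
qed

text \<open>The phases alternate up to N and equal \<open>sgn v\<close> on a block where the sum of
  p^(-\<sigma>) is about |v|, so the block adds about v e^(-w) to the first logarithm. On the scale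
  1 / L the remaining primes are frozen at the limits \<open>l k\<close>, and for k \<ge> 2 the
  block adds no more than a tail of the sum of p^(-2\<alpha>).\<close>

lemma twist_approx:
  fixes v :: complex and l :: "nat \<Rightarrow> complex"
  assumes \<sigma>: "1/2 < \<sigma>" "\<sigma> < 1" and v: "v \<noteq> 0" and \<epsilon>: "\<epsilon> > 0"
    and l: "\<And>k \<epsilon>. 1 \<le> k \<Longrightarrow> k \<le> r \<Longrightarrow> \<epsilon> > 0 \<Longrightarrow> \<exists>N1 \<eta>. \<eta> > 0 \<and>
          (\<forall>N\<ge>N1. \<forall>s. norm (s - of_real \<sigma>) < \<eta> \<longrightarrow> norm (logprod k N s - l k) < \<epsilon>)"
  shows "\<exists>N' L \<xi>. N' \<ge> N0 \<and> L \<ge> L0 \<and> L \<ge> 1 \<and> (\<forall>p. norm (\<xi> p) = 1) \<and>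
    (\<forall>w k. norm w \<le> 1/2 \<longrightarrow> 1 \<le> k \<longrightarrow> k \<le> r \<longrightarrow>
       norm (tprod {p. prime p \<and> p \<le> N'} \<xi> k (of_real \<sigma> + w / of_real L)
          - exp (l k + (if k = 1 then v * exp (- w) else 0))) \<le> \<epsilon>)"
proof -
  \<comment> \<open>Bounds the modulus of the limit product, as |exp (-w)| \<le> 2 for |w| \<le>
    1/2. It converts the relative error 2 \<epsilon>' into the absolute error \<epsilon>.\<close>
  define Bx where "Bx = exp ((\<Sum>k\<in>{1..r}. norm (l k)) + 2 * norm v)"
  have Bx: "Bx > 0" by (simp add: Bx_def)
  define \<epsilon>' where "\<epsilon>' = min (1/2) (\<epsilon> / (2 * Bx))"
  have \<epsilon>': "\<epsilon>' > 0" "\<epsilon>' \<le> 1/2" "2 * \<epsilon>' * Bx \<le> \<epsilon>"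
    using Bx \<epsilon> by (auto simp: \<epsilon>'_def min_def field_simps)
  have \<epsilon>3: "\<epsilon>' / 3 > 0" using \<epsilon>' by simp
  define \<alpha> where "\<alpha> = (\<sigma> + 1/2) / 2"
  have \<alpha>: "1/2 < \<alpha>" "\<alpha> < \<sigma>" using \<sigma> by (auto simp: \<alpha>_def)
  have lim: "(\<lambda>N. 1 / (2 * ln (real N))) \<longlonglongrightarrow> 0" by real_asymp
  have e1: "\<forall>\<^sub>F N in sequentially. \<forall>k\<in>{1..r}. \<forall>s. norm (s - of_real \<sigma>) \<le> 1 / (2 * ln (real N)) \<longrightarrow> norm (logprod k N s - l k) < \<epsilon>' / 3"
  proof (rule eventually_ball_finite, simp, intro ballI)
    fix k assume k: "k \<in> {1..r}"
    obtain N1 \<eta> where \<eta>: "\<eta> > 0" "\<forall>N\<ge>N1. \<forall>s. norm (s - of_real \<sigma>) < \<eta> \<longrightarrow> norm (logprod k N s - l k) < \<epsilon>' / 3"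
      using l[OF _ _ \<epsilon>3, of k] k by auto
    have "\<forall>\<^sub>F N in sequentially. 1 / (2 * ln (real N)) < \<eta>" using lim \<eta>(1) by (rule order_tendstoD)
    thus "\<forall>\<^sub>F N in sequentially. \<forall>s. norm (s - of_real \<sigma>) \<le> 1 / (2 * ln (real N)) \<longrightarrow> norm (logprod k N s - l k) < \<epsilon>' / 3"
      using eventually_ge_at_top[of N1] by eventually_elim (use \<eta>(2) in force)
  qed
  have "(\<lambda>N. 4 * ztail N (2 * \<alpha>)) \<longlonglongrightarrow> 4 * 0" using \<alpha> by (intro tendsto_intros ztail_tendsto_0) auto
  hence e2: "\<forall>\<^sub>F N in sequentially. 4 * ztail N (2 * \<alpha>) < \<epsilon>' / 3" by (rule order_tendstoD) (use \<epsilon>3 in simp)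
  have e3: "\<forall>\<^sub>F N in sequentially. 1 / (2 * ln (real N)) < \<sigma> - \<alpha>" using lim by (rule order_tendstoD) (use \<alpha> in simp)
  have "(\<lambda>N. 2 * (norm v + 1) * (1 / ln (real N)) + 2 * real N powr - \<sigma>) \<longlonglongrightarrow> 2 * (norm v + 1) * 0 + 2 * 0"
  proof (intro tendsto_intros)
    show "(\<lambda>N. 1 / ln (real N)) \<longlonglongrightarrow> 0" by real_asymp
    show "(\<lambda>N. real N powr - \<sigma>) \<longlonglongrightarrow> 0" using \<sigma> by real_asymp
  qed
  hence e4: "\<forall>\<^sub>F N in sequentially. 2 * (norm v + 1) * (1 / ln (real N)) + 2 * real N powr - \<sigma> < \<epsilon>' / 3"
    by (rule order_tendstoD) (use \<epsilon>3 in simp)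
  have "filterlim (\<lambda>N. ln (real N)) at_top sequentially" by real_asymp
  hence e5: "\<forall>\<^sub>F N in sequentially. ln (real N) \<ge> max 1 L0" by (rule filterlim_at_top[THEN iffD1, rule_format])
  have "\<forall>\<^sub>F N in sequentially. (\<forall>k\<in>{1..r}. \<forall>s. norm (s - of_real \<sigma>) \<le> 1 / (2 * ln (real N)) \<longrightarrow> norm (logprod k N s - l k) < \<epsilon>' / 3)
      \<and> 4 * ztail N (2 * \<alpha>) < \<epsilon>' / 3 \<and> 1 / (2 * ln (real N)) < \<sigma> - \<alpha>
      \<and> 2 * (norm v + 1) * (1 / ln (real N)) + 2 * real N powr - \<sigma> < \<epsilon>' / 3 \<and> ln (real N) \<ge> max 1 L0"
    by (intro eventually_conj e1 e2 e3 e4 e5)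
  then obtain N2 where N2: "\<And>N. N \<ge> N2 \<Longrightarrow> (\<forall>k\<in>{1..r}. \<forall>s. norm (s - of_real \<sigma>) \<le> 1 / (2 * ln (real N)) \<longrightarrow> norm (logprod k N s - l k) < \<epsilon>' / 3)
      \<and> 4 * ztail N (2 * \<alpha>) < \<epsilon>' / 3 \<and> 1 / (2 * ln (real N)) < \<sigma> - \<alpha>
      \<and> 2 * (norm v + 1) * (1 / ln (real N)) + 2 * real N powr - \<sigma> < \<epsilon>' / 3 \<and> ln (real N) \<ge> max 1 L0"
    unfolding eventually_sequentially by blast
  have pos: "\<sigma> > 0" "norm v > 0" using \<sigma> v by auto
  obtain N N' :: nat where N: "N \<ge> max N2 N0" "N \<ge> 2" "N' \<le> 2 * N" "N' \<ge> N"
    and blk: "(\<Sum>p | prime p \<and> N < p \<and> p \<le> N'. real p powr - \<sigma>) \<ge> norm v"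
    "(\<Sum>p | prime p \<and> N < p \<and> p \<le> N'. real p powr - \<sigma>) \<le> norm v + real N powr - \<sigma>"
    by (rule prime_block[OF \<sigma>(2) pos, of "max N2 N0"])
  define L where "L = ln (real N)"
  have NN: "\<And>k s. k \<in> {1..r} \<Longrightarrow> norm (s - of_real \<sigma>) \<le> 1 / (2 * L) \<Longrightarrow> norm (logprod k N s - l k) < \<epsilon>' / 3"
    "4 * ztail N (2 * \<alpha>) < \<epsilon>' / 3" "1 / (2 * L) < \<sigma> - \<alpha>" "2 * (norm v + 1) * (1 / L) + 2 * real N powr - \<sigma> < \<epsilon>' / 3"
    "L \<ge> 1" "L \<ge> L0"
    using N2[of N] N by (auto simp: L_def)
  define \<xi> where "\<xi> = (\<lambda>p. if p \<le> N then psign p else sgn v)"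
  have n\<xi>: "norm (\<xi> p) = 1" for p using v by (simp add: \<xi>_def norm_sgn)
  let ?P = "{p. prime p \<and> p \<le> N'}"
  let ?B = "{p. prime p \<and> N < p \<and> p \<le> N'}"
  show ?thesis
  proof (intro exI[of _ N'] exI[of _ L] exI[of _ \<xi>] conjI allI impI)
    fix w :: complex and k :: nat
    assume w: "norm w \<le> 1/2" and k: "1 \<le> k" "k \<le> r"
    define s where "s = of_real \<sigma> + w / of_real L"
    have ds: "norm (s - of_real \<sigma>) \<le> 1 / (2 * L)"
      using w NN(5) by (simp add: s_def norm_divide field_simps)
    have Res: "Re s \<ge> \<alpha>" using abs_Re_le_cmod[of "s - of_real \<sigma>"] ds NN(3) by simp
    define t where "t = l k + (if k = 1 then v * exp (- w) else 0)"
    define f where "f = (\<lambda>p. - Ln (1 - \<xi> p ^ k * of_nat p powr - (of_nat k * s)))"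
    define u where "u = (\<lambda>p. \<xi> p ^ k * of_nat p powr - (of_nat k * s))"
    have tp: "tprod ?P \<xi> k s = exp (\<Sum>p\<in>?P. f p)"
      unfolding f_def using n\<xi> Res \<alpha> k by (intro tprod_eq_exp) auto
    have "?P = {p. prime p \<and> p \<le> N} \<union> ?B" using N by auto
    hence "(\<Sum>p\<in>?P. f p) = (\<Sum>p | prime p \<and> p \<le> N. f p) + (\<Sum>p\<in>?B. f p)"
      by (simp only:) (rule sum.union_disjoint, auto)
    also have "(\<Sum>p | prime p \<and> p \<le> N. f p) = logprod k N s"
    proof -
      have "logprod k N s = (\<Sum>p\<in>{p\<in>{..N}. prime p}. - Ln (1 - psign p ^ k * of_nat p powr - (of_nat k * s)))"
        unfolding logprod_def by (rule sum.inter_filter [symmetric]) simp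
      also have "\<dots> = (\<Sum>p | prime p \<and> p \<le> N. f p)"
        by (intro sum.cong) (auto simp: f_def \<xi>_def)
      finally show ?thesis by simp
    qed
    finally have sumf: "(\<Sum>p\<in>?P. f p) = logprod k N s + (\<Sum>p\<in>?B. f p)" .
    have fin: "finite ?B" by (rule finite_subset[of _ "{..N'}"]) auto
    have uu: "norm (u p) \<le> 3/4" "norm (u p) \<le> real p powr - (real k * \<alpha>)" if "p \<in> ?B" for p
      using norm_prime_factor_le[OF _ n\<xi> Res \<alpha>(1) k(1), of p p] that by (auto simp: u_def)
    have b: "norm ((\<Sum>p\<in>?B. f p) - (if k = 1 then v * exp (- w) else 0)) < \<epsilon>' / 3 + \<epsilon>' / 3"
    proof (cases "k = 1")
      case True
      have "norm ((\<Sum>p\<in>?B. f p) - (\<Sum>p\<in>?B. u p)) \<le> (\<Sum>p\<in>?B. 4 * real p powr - (2 * \<alpha>))"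
        unfolding sum_subtractf [symmetric]
      proof (rule sum_norm_le)
        fix p assume p: "p \<in> ?B"
        have "norm (f p - u p) \<le> 4 * norm (u p)^2"
          using Ln_one_minus_approx(1)[OF uu(1)[OF p]] by (simp add: f_def u_def)
        also have "\<dots> \<le> 4 * (real p powr - (real k * \<alpha>))^2" using uu(2)[OF p] by (intro mult_left_mono power_mono) auto
        also have "(real p powr - (real k * \<alpha>))^2 = real p powr - (2 * \<alpha>)"
          using True by (simp add: power2_eq_square flip: powr_add)
        finally show "norm (f p - u p) \<le> 4 * real p powr - (2 * \<alpha>)" .
      qed
      also have "\<dots> = 4 * (\<Sum>p\<in>?B. real p powr - (2 * \<alpha>))" by (rule sum_distrib_left [symmetric])
      also have "\<dots> \<le> 4 * ztail N (2 * \<alpha>)" using \<alpha> by (intro mult_left_mono sum_block_le_ztail) auto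
      finally have b1: "norm ((\<Sum>p\<in>?B. f p) - (\<Sum>p\<in>?B. u p)) < \<epsilon>' / 3" using NN(2) by linarith
      have "(\<Sum>p\<in>?B. u p) = (\<Sum>p\<in>?B. sgn v * of_nat p powr - (of_real \<sigma> + w / of_real L))"
        using True by (intro sum.cong refl) (auto simp: u_def \<xi>_def s_def)
      hence "norm ((\<Sum>p\<in>?B. u p) - v * exp (- w)) \<le> 2 * (norm v + 1) / L + 2 * real N powr - \<sigma>"
        using block_sum_approx[OF v N(2,3) L_def NN(5) w refl blk] \<sigma> by simp
      hence b2: "norm ((\<Sum>p\<in>?B. u p) - v * exp (- w)) < \<epsilon>' / 3"
        using NN(4) unfolding times_divide_eq_right mult_1_right by linarith
      have "norm (((\<Sum>p\<in>?B. f p) - (\<Sum>p\<in>?B. u p)) + ((\<Sum>p\<in>?B. u p) - v * exp (- w))) < \<epsilon>' / 3 + \<epsilon>' / 3"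
        using b1 b2 by (intro norm_triangle_lt add_strict_mono)
      thus ?thesis using True by simp
    next
      case False
      have "norm (\<Sum>p\<in>?B. f p) \<le> (\<Sum>p\<in>?B. 4 * real p powr - (2 * \<alpha>))"
      proof (rule sum_norm_le)
        fix p assume p: "p \<in> ?B"
        have "norm (f p) \<le> 4 * norm (u p)"
          using Ln_one_minus_approx(2)[OF uu(1)[OF p]] by (simp add: f_def u_def)
        also have "\<dots> \<le> 4 * real p powr - (real k * \<alpha>)" using uu(2)[OF p] by (rule mult_left_mono) simp
        also have "\<dots> \<le> 4 * real p powr - (2 * \<alpha>)"
          using False k \<alpha> p by (intro mult_left_mono powr_mono) auto
        finally show "norm (f p) \<le> 4 * real p powr - (2 * \<alpha>)" .
      qed
      also have "\<dots> = 4 * (\<Sum>p\<in>?B. real p powr - (2 * \<alpha>))" by (rule sum_distrib_left [symmetric])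
      also have "\<dots> \<le> 4 * ztail N (2 * \<alpha>)" using \<alpha> by (intro mult_left_mono sum_block_le_ztail) auto
      also have "\<dots> < \<epsilon>' / 3 + \<epsilon>' / 3" using NN(2) \<epsilon>3 by linarith
      finally show ?thesis using False by simp
    qed
    have a1: "norm (logprod k N s - l k) < \<epsilon>' / 3" using NN(1)[of k s] k ds by simp
    \<comment> \<open>The total error in the exponent: one third of \<epsilon>' for freezing the
      alternating part, and for k = 1 one third each for linearising the logarithms of the block and
      for evaluating its sum.\<close>
    define E where "E = (logprod k N s - l k) + ((\<Sum>p\<in>?B. f p) - (if k = 1 then v * exp (- w) else 0))"
    have "norm E < \<epsilon>' / 3 + (\<epsilon>' / 3 + \<epsilon>' / 3)" unfolding E_def by (intro norm_triangle_lt add_strict_mono a1 b)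
    hence E: "norm E \<le> \<epsilon>'" by simp
    have "tprod ?P \<xi> k s - exp t = exp t * (exp E - 1)"
    proof -
      have "(\<Sum>p\<in>?P. f p) = t + E" unfolding sumf E_def t_def by simp
      thus ?thesis unfolding tp by (simp add: exp_add algebra_simps)
    qed
    also have "norm \<dots> = norm (exp t) * norm (exp E - 1)" by (rule norm_mult)
    also have "\<dots> \<le> Bx * (2 * \<epsilon>')"
    proof (intro mult_mono)
      have "norm (exp E - 1) \<le> 2 * norm E" using E \<epsilon>' by (intro norm_exp_minus_1_le) linarith
      thus "norm (exp E - 1) \<le> 2 * \<epsilon>'" using E by linarith
      have "norm t \<le> norm (l k) + norm (if k = 1 then v * exp (- w) else 0)" unfolding t_def by (rule norm_triangle_ineq)
      also have "norm (if k = 1 then v * exp (- w) else 0) \<le> 2 * norm v"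
      proof -
        have "norm (exp (- w)) \<le> exp (norm (- w))" by (rule norm_exp)
        also have "\<dots> \<le> exp (1/2)" using w by simp
        also have "\<dots> \<le> 1 + 1/2 + (1/2)^2" by (rule exp_bound) auto
        also have "\<dots> \<le> (2::real)" by (simp add: power2_eq_square)
        finally have "norm v * norm (exp (- w)) \<le> norm v * 2" by (intro mult_left_mono) auto
        thus ?thesis by (auto simp: norm_mult mult.commute)
      qed
      also have "norm (l k) \<le> (\<Sum>k\<in>{1..r}. norm (l k))" using k by (intro member_le_sum) auto
      finally have "norm t \<le> (\<Sum>k\<in>{1..r}. norm (l k)) + 2 * norm v" by simp
      hence "exp (norm t) \<le> Bx" by (simp add: Bx_def)
      thus "norm (exp t) \<le> Bx" using norm_exp[of t] by linarith
    qed (use Bx in auto)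
    also have "\<dots> \<le> \<epsilon>" using \<epsilon>'(3) by (simp add: mult_ac)
    finally show "norm (tprod ?P \<xi> k (of_real \<sigma> + w / of_real L) - exp (l k + (if k = 1 then v * exp (- w) else 0))) \<le> \<epsilon>"
      by (simp only: s_def t_def)
  qed (use N NN n\<xi> in auto)
qed

section \<open>Lower bound for the number of zeros\<close>

text \<open>Newton's recursion is a sum of products of power sums with lower symmetric functions, so
  Lipschitz constants on bounded sets propagate by induction.\<close>

lemma esym_lipschitz:
  assumes "B \<ge> 0"
  shows "\<exists>C\<ge>0. \<forall>(p::nat \<Rightarrow> complex) q \<delta>. \<delta> \<ge> 0 \<longrightarrow>
    (\<forall>k\<in>{1..n}. norm (p k) \<le> B \<and> norm (q k) \<le> B \<and> norm (p k - q k) \<le> \<delta>) \<longrightarrow> norm (esym n p - esym n q) \<le> C * \<delta>"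
proof (induction n rule: less_induct)
  case (less n)
  show ?case
  proof (cases n)
    case 0
    thus ?thesis by (intro exI[of _ 0]) auto
  next
    case (Suc m)
    have "\<forall>j. j < n \<longrightarrow> (\<exists>C\<ge>0. \<forall>(p::nat \<Rightarrow> complex) q \<delta>. \<delta> \<ge> 0 \<longrightarrow>
      (\<forall>k\<in>{1..j}. norm (p k) \<le> B \<and> norm (q k) \<le> B \<and> norm (p k - q k) \<le> \<delta>) \<longrightarrow> norm (esym j p - esym j q) \<le> C * \<delta>)"
      using less.IH by blast
    then obtain C where C: "\<And>j. j < n \<Longrightarrow> C j \<ge> 0"
      "\<And>j p q \<delta>. j < n \<Longrightarrow> \<delta> \<ge> 0 \<Longrightarrow> (\<And>k. k \<in> {1..j} \<Longrightarrow> norm (p k :: complex) \<le> B \<and> norm (q k) \<le> B \<and> norm (p k - q k) \<le> \<delta>)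
         \<Longrightarrow> norm (esym j p - esym j q) \<le> C j * \<delta>"
      by metis
    define B1 where "B1 = max B 1"
    define D where "D = (\<Sum>i\<le>m. B * C (m - i) + (B1 * (1 + B)) ^ (m - i))"
    have D0: "D \<ge> 0" unfolding D_def using C(1) Suc assms
      by (intro sum_nonneg add_nonneg_nonneg mult_nonneg_nonneg zero_le_power) (auto simp: B1_def)
    show ?thesis
    proof (intro exI[of _ D] conjI D0 allI impI)
      fix p q :: "nat \<Rightarrow> complex" and \<delta> :: real
      assume d: "\<delta> \<ge> 0" and h: "\<forall>k\<in>{1..n}. norm (p k) \<le> B \<and> norm (q k) \<le> B \<and> norm (p k - q k) \<le> \<delta>"
      have qb: "norm (esym j q) \<le> (B1 * (1 + B)) ^ j" if "j \<le> m" for j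
      proof -
        have "norm (esym j q) \<le> (B1 * (1 + norm (q 1))) ^ j"
          using h that Suc by (intro norm_esym_le) (auto simp: B1_def le_max_iff_disj)
        also have "\<dots> \<le> (B1 * (1 + B)) ^ j"
          using h Suc by (intro power_mono mult_left_mono mult_nonneg_nonneg) (auto simp: B1_def)
        finally show ?thesis .
      qed
      define S where "S = (\<Sum>i\<le>m. (-1) ^ i * (p (Suc i) * (esym (m - i) p - esym (m - i) q) + (p (Suc i) - q (Suc i)) * esym (m - i) q))"
      have "S = (\<Sum>i\<le>m. (-1) ^ i * p (Suc i) * esym (m - i) p) - (\<Sum>i\<le>m. (-1) ^ i * q (Suc i) * esym (m - i) q)"
        unfolding S_def sum_subtractf [symmetric] by (intro sum.cong refl) (simp add: algebra_simps)
      hence eq: "esym n p - esym n q = S / of_nat (Suc m)"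
        unfolding Suc esym.simps by (simp only: diff_divide_distrib)
      have "norm (esym n p - esym n q) \<le> norm S / 1"
        unfolding eq norm_divide norm_of_nat by (intro divide_left_mono) auto
      also have "\<dots> \<le> (\<Sum>i\<le>m. (B * C (m - i) + (B1 * (1 + B)) ^ (m - i)) * \<delta>)"
        unfolding div_by_1 S_def
      proof (rule sum_norm_le)
        fix i assume i: "i \<in> {..m}"
        have "norm (p (Suc i) * (esym (m - i) p - esym (m - i) q)) \<le> B * (C (m - i) * \<delta>)"
        proof -
          have "norm (esym (m - i) p - esym (m - i) q) \<le> C (m - i) * \<delta>"
          proof (rule C(2))
            fix k assume "k \<in> {1..m - i}"
            hence "k \<in> {1..n}" using Suc by auto
            with h show "norm (p k) \<le> B \<and> norm (q k) \<le> B \<and> norm (p k - q k) \<le> \<delta>" by blast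
          qed (use Suc d in auto)
          moreover have "Suc i \<in> {1..n}" using i Suc by auto
          hence "norm (p (Suc i)) \<le> B" using h by blast
          ultimately show ?thesis unfolding norm_mult using assms by (intro mult_mono) auto
        qed
        moreover have "norm ((p (Suc i) - q (Suc i)) * esym (m - i) q) \<le> \<delta> * (B1 * (1 + B)) ^ (m - i)"
        proof -
          have "Suc i \<in> {1..n}" using i Suc by auto
          hence "norm (p (Suc i) - q (Suc i)) \<le> \<delta>" using h by blast
          thus ?thesis unfolding norm_mult using d i by (intro mult_mono qb) auto
        qed
        ultimately have "norm (p (Suc i) * (esym (m - i) p - esym (m - i) q) + (p (Suc i) - q (Suc i)) * esym (m - i) q)
           \<le> B * (C (m - i) * \<delta>) + \<delta> * (B1 * (1 + B)) ^ (m - i)" by (rule norm_triangle_mono)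
        thus "norm ((-1) ^ i * (p (Suc i) * (esym (m - i) p - esym (m - i) q) + (p (Suc i) - q (Suc i)) * esym (m - i) q))
           \<le> (B * C (m - i) + (B1 * (1 + B)) ^ (m - i)) * \<delta>"
          unfolding norm_mult norm_power by (simp add: algebra_simps)
      qed
      also have "\<dots> = D * \<delta>" unfolding D_def by (rule sum_distrib_right [symmetric])
      finally show "norm (esym n p - esym n q) \<le> D * \<delta>" .
    qed
  qed
qed

text \<open>There are finitely many factors, each of modulus at most 4 because |1 - z| \<ge> 1/4.
  Divided by 4 they have modulus at most 1, and then a difference of products is at most the sum of
  the differences of the factors.\<close>

lemma tprod_close:
  assumes P: "finite P" "\<And>p. p \<in> P \<Longrightarrow> prime p" and \<alpha>: "\<alpha> > 1/2" and \<epsilon>: "\<epsilon> > 0"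
  shows "\<exists>\<delta>>0. \<forall>y x s k. (\<forall>p. norm (y p) = 1) \<longrightarrow> (\<forall>p. norm (x p) = 1) \<longrightarrow> Re s \<ge> \<alpha> \<longrightarrow> 1 \<le> k \<longrightarrow> k \<le> r \<longrightarrow>
      (\<forall>p\<in>P. norm (y p - x p) < \<delta>) \<longrightarrow> norm (tprod P y k s - tprod P x k s) \<le> \<epsilon>"
proof -
  define n where "n = card P"
  define \<delta> where "\<delta> = \<epsilon> / (4 ^ n * (real n + 1) * 4 * (real r + 1))"
  have \<delta>: "\<delta> > 0" using \<epsilon> by (simp add: \<delta>_def add_nonneg_pos)
  show ?thesis
  proof (intro exI[of _ \<delta>] conjI \<delta> allI impI)
    fix y x :: "nat \<Rightarrow> complex" and s :: complex and k :: nat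
    assume y: "\<forall>p. norm (y p) = 1" and x: "\<forall>p. norm (x p) = 1" and s: "Re s \<ge> \<alpha>" and k: "1 \<le> k" "k \<le> r"
      and cl: "\<forall>p\<in>P. norm (y p - x p) < \<delta>"
    define a where "a = (\<lambda>u p. 1 - u p ^ k * of_nat p powr - (of_nat k * s) :: complex)"
    have a: "norm (a u p) \<ge> 1/4" if "p \<in> P" "norm (u p) = 1" for u p
    proof -
      have "norm (u p ^ k * of_nat p powr - (of_nat k * s)) \<le> 3/4"
        using norm_prime_factor_le(1)[OF P(2)[OF that(1)] that(2) s \<alpha> k(1)] .
      thus ?thesis using norm_triangle_ineq2[of 1 "u p ^ k * of_nat p powr - (of_nat k * s)"] by (simp add: a_def)
    qed
    have inv: "norm (inverse (a u p)) \<le> 4" if "p \<in> P" "norm (u p) = 1" for u p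
    proof -
      have "norm (inverse (a u p)) = inverse (norm (a u p))" by (rule norm_inverse)
      also have "\<dots> = 1 / norm (a u p)" by (rule inverse_eq_divide)
      also have "\<dots> \<le> 1 / (1/4)" using a[of p u] that by (intro divide_left_mono) auto
      finally show ?thesis by simp
    qed
    have diff: "norm (inverse (a y p) - inverse (a x p)) \<le> 16 * (real r * \<delta>)" if p: "p \<in> P" for p
    proof -
      have nz: "a y p \<noteq> 0" "a x p \<noteq> 0" using a[OF p, of y] a[OF p, of x] x y by auto
      have "inverse (a y p) - inverse (a x p) = inverse (a y p) * inverse (a x p) * (a x p - a y p)"
        using nz by (simp add: field_simps)
      also have "norm \<dots> = norm (inverse (a y p)) * norm (inverse (a x p)) * norm (a x p - a y p)" by (simp add: norm_mult)
      also have "\<dots> \<le> 4 * 4 * (real r * \<delta>)"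
      proof (intro mult_mono inv p)
        have "a x p - a y p = (y p ^ k - x p ^ k) * of_nat p powr - (of_nat k * s)" by (simp add: a_def algebra_simps)
        also have "norm \<dots> \<le> (real k * norm (y p - x p)) * 1"
          unfolding norm_mult
        proof (intro mult_mono norm_power_diff)
          show "norm (of_nat p powr - (of_nat k * s) :: complex) \<le> 1"
            using norm_prime_factor_le(1)[OF P(2)[OF p] _ s \<alpha> k(1), of 1] by simp
        qed (use x y in auto)
        also have "\<dots> \<le> real r * \<delta> * 1"
          using cl p k \<delta> by (intro mult_mono) (auto intro: less_imp_le)
        finally show "norm (a x p - a y p) \<le> real r * \<delta>" by simp
      qed (use x y in auto)
      finally show ?thesis by simp
    qed
    have tp: "tprod P u k s = 4 ^ n * (\<Prod>p\<in>P. inverse (a u p) / 4)" for u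
      using P(1) by (simp add: tprod_def a_def n_def prod_dividef)
    have "norm ((\<Prod>p\<in>P. inverse (a y p) / 4) - (\<Prod>p\<in>P. inverse (a x p) / 4)) \<le> (\<Sum>p\<in>P. norm (inverse (a y p) / 4 - inverse (a x p) / 4))"
    proof (rule norm_prod_diff)
      show "norm (inverse (a y p) / 4) \<le> 1" if "p \<in> P" for p using inv[OF that, of y] y by (simp add: norm_divide)
      show "norm (inverse (a x p) / 4) \<le> 1" if "p \<in> P" for p using inv[OF that, of x] x by (simp add: norm_divide)
    qed
    also have "\<dots> \<le> (\<Sum>p\<in>P. 4 * (real r * \<delta>))"
    proof (rule sum_mono)
      fix p assume "p \<in> P"
      have "norm (inverse (a y p) / 4 - inverse (a x p) / 4) = norm (inverse (a y p) - inverse (a x p)) / 4"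
        by (metis diff_divide_distrib norm_divide norm_numeral)
      thus "norm (inverse (a y p) / 4 - inverse (a x p) / 4) \<le> 4 * (real r * \<delta>)" using diff[OF \<open>p \<in> P\<close>] by simp
    qed
    also have "\<dots> = real n * (4 * (real r * \<delta>))" by (simp add: n_def)
    finally have pd: "norm ((\<Prod>p\<in>P. inverse (a y p) / 4) - (\<Prod>p\<in>P. inverse (a x p) / 4)) \<le> real n * (4 * (real r * \<delta>))" .
    have "norm (tprod P y k s - tprod P x k s) = 4 ^ n * norm ((\<Prod>p\<in>P. inverse (a y p) / 4) - (\<Prod>p\<in>P. inverse (a x p) / 4))"
      unfolding tp right_diff_distrib [symmetric] norm_mult by (simp add: norm_power)
    also have "\<dots> \<le> 4 ^ n * ((real n + 1) * (4 * ((real r + 1) * \<delta>)))"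
      using pd \<delta> by (intro mult_left_mono order_trans[OF pd] mult_mono) auto
    also have "\<dots> = \<epsilon>"
    proof -
      have "real n + 1 > 0" "real r + 1 > 0" by auto
      thus ?thesis by (simp add: \<delta>_def)
    qed
    finally show "norm (tprod P y k s - tprod P x k s) \<le> \<epsilon>" .
  qed
qed

text \<open>In place of Rouche's theorem: without a zero, 1 / f would be holomorphic, and the
  maximum principle would force |f 0| \<ge> m.\<close>

lemma zero_in_disc:
  assumes f: "f holomorphic_on cball 0 \<rho>" and \<rho>: "\<rho> > 0" and m: "m > 0"
    and f0: "norm (f 0) < m" and fs: "\<And>w. norm w = \<rho> \<Longrightarrow> norm (f w) \<ge> m"
  shows "\<exists>w. norm w \<le> \<rho> \<and> f w = 0"
proof (rule ccontr)
  assume "\<not> ?thesis"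
  hence nz: "f w \<noteq> 0" if "norm w \<le> \<rho>" for w using that by blast
  have hol: "(\<lambda>w. inverse (f w)) holomorphic_on cball 0 \<rho>"
    using f nz by (intro holomorphic_intros) auto
  have "norm (inverse (f 0)) \<le> inverse m"
  proof (rule maximum_modulus_frontier[of "\<lambda>w. inverse (f w)" "cball 0 \<rho>"])
    show "(\<lambda>w. inverse (f w)) holomorphic_on interior (cball 0 \<rho>)"
      using hol interior_subset holomorphic_on_subset by blast
    show "continuous_on (closure (cball 0 \<rho>)) (\<lambda>w. inverse (f w))"
      using holomorphic_on_imp_continuous_on[OF hol] by simp
    fix z :: complex assume "z \<in> frontier (cball 0 \<rho>)"
    hence "norm z = \<rho>" using \<rho> by (simp add: frontier_cball)
    from fs[OF this] show "norm (inverse (f z)) \<le> inverse m"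
      using m by (simp add: norm_inverse le_imp_inverse_le)
  qed (use \<rho> in auto)
  hence "norm (f 0) \<ge> m" using nz[of 0] \<rho> m by (simp add: norm_inverse inverse_le_iff_le)
  thus False using f0 by simp
qed

text \<open>The limit function is a polynomial in p_1 = exp (l 1 + v e^(-w)), the other power sums
  being the constants exp (l k). As exp (l 2) is not 0, the polynomial has a non-zero root, and v
  makes p_1 equal to it at w = 0. The zero at w = 0 is isolated, which provides the circle and the
  lower bound m.\<close>

lemma limit_zero_exists:
  fixes l :: "nat \<Rightarrow> complex"
  assumes r: "r \<ge> 2"
  shows "\<exists>v \<rho> m. v \<noteq> 0 \<and> 0 < \<rho> \<and> \<rho> \<le> 1/2 \<and> m > 0 \<and>
    esym r (\<lambda>k. exp (l k + (if k = 1 then v * exp (- 0) else 0))) = 0 \<and>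
    (\<forall>w. norm w = \<rho> \<longrightarrow> norm (esym r (\<lambda>k. exp (l k + (if k = 1 then v * exp (- w) else 0)))) \<ge> m)"
proof -
  define c where "c = (\<lambda>k. exp (l k))"
  obtain x where x: "x \<noteq> 0" "esym r (c(1 := x)) = 0"
    using esym_nonzero_root[of r c] r by (auto simp: c_def)
  \<comment> \<open>A logarithm exists since x is not 0. If it happens to vanish, the logarithm 2 pi
    i is taken instead, because v has to have a direction.\<close>
  define v0 where "v0 = Ln (x / exp (l 1))"
  define v where "v = (if v0 = 0 then 2 * of_real pi * \<i> else v0)"
  have v: "v \<noteq> 0" by (simp add: v_def)
  have ev: "exp (l 1 + v) = x"
  proof -
    have "exp v = exp v0" by (auto simp: v_def exp_two_pi_i)
    also have "\<dots> = x / exp (l 1)" unfolding v0_def using x by simp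
    finally show ?thesis by (simp add: exp_add)
  qed
  define g where "g = (\<lambda>w. esym r (\<lambda>k. exp (l k + (if k = 1 then v * exp (- w) else 0))))"
  have g: "g w = esym r (c(1 := exp (l 1 + v * exp (- w))))" for w
    unfolding g_def by (rule esym_cong) (auto simp: c_def)
  have g0: "g 0 = 0" using x ev by (simp add: g)
  have hol: "g holomorphic_on UNIV"
    unfolding g_def
  proof (intro esym_holomorphic)
    fix i
    show "(\<lambda>w. exp (l i + (if i = 1 then v * exp (- w) else 0))) holomorphic_on UNIV"
      by (cases "i = 1") (auto intro!: holomorphic_intros)
  qed
  \<comment> \<open>Otherwise the polynomial in p_1 would vanish at exp (l 1 + v + y) for all real y
    with at most one exception, that is at infinitely many points.\<close>
  have "\<exists>w. g w \<noteq> 0"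
  proof (rule ccontr)
    assume "\<not> ?thesis"
    hence gz: "g w = 0" for w by blast
    define A where "A = {y::real. 1 + of_real y / v \<noteq> 0}"
    have "y \<in> {- Re v}" if "y \<notin> A" for y
    proof -
      have "of_real y = - v" using that v by (simp add: A_def field_simps add_eq_0_iff)
      thus ?thesis by (metis Re_complex_of_real singletonI uminus_complex.sel(1))
    qed
    hence "UNIV = A \<union> {- Re v}" by blast
    hence infA: "infinite A" by (metis finite.emptyI finite_Un finite_insert infinite_UNIV_char_0)
    have "(\<lambda>y. exp (l 1 + v + of_real y)) ` A \<subseteq> {x. esym r (c(1 := x)) = 0}"
    proof clarify
      fix y assume y: "y \<in> A"
      define w where "w = - Ln (1 + of_real y / v)"
      have "exp (- w) = 1 + of_real y / v" using y by (simp add: w_def A_def)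
      hence "v * exp (- w) = v + of_real y" using v by (simp add: algebra_simps)
      thus "esym r (c(1 := exp (l 1 + v + of_real y))) = 0" using gz[of w] by (simp add: g add.assoc)
    qed
    hence "finite ((\<lambda>y. exp (l 1 + v + of_real y)) ` A)"
      using esym_finite_roots[of r c] r finite_subset by auto
    moreover have "inj_on (\<lambda>y. exp (l 1 + v + of_real y)) A"
    proof (rule inj_onI)
      fix y z assume "exp (l 1 + v + complex_of_real y) = exp (l 1 + v + complex_of_real z)"
      hence "norm (exp (l 1 + v + complex_of_real y)) = norm (exp (l 1 + v + complex_of_real z))" by simp
      thus "y = z" by simp
    qed
    ultimately show False using infA finite_imageD by blast
  qed
  then obtain w1 where w1: "g w1 \<noteq> 0" by blast
  obtain \<rho>0 where \<rho>0: "0 < \<rho>0" and "ball 0 \<rho>0 \<subseteq> (UNIV :: complex set)" and \<rho>0': "\<And>z. z \<in> ball 0 \<rho>0 - {0} \<Longrightarrow> g z \<noteq> 0"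
    by (rule isolated_zeros[OF hol open_UNIV connected_UNIV UNIV_I g0 UNIV_I w1]) (rule that; blast)
  define \<rho> where "\<rho> = min (1/2) (\<rho>0 / 2)"
  have \<rho>: "0 < \<rho>" "\<rho> \<le> 1/2" "\<rho> < \<rho>0" using \<rho>0 by (auto simp: \<rho>_def)
  have "continuous_on (sphere 0 \<rho>) (\<lambda>w. norm (g w))"
    using holomorphic_on_imp_continuous_on[OF hol] by (intro continuous_intros) (auto intro: continuous_on_subset)
  moreover have "of_real \<rho> \<in> sphere (0::complex) \<rho>" using \<rho> by simp
  ultimately obtain w0 where w0: "w0 \<in> sphere 0 \<rho>" "\<And>w. w \<in> sphere 0 \<rho> \<Longrightarrow> norm (g w0) \<le> norm (g w)"
    using continuous_attains_inf[of "sphere (0::complex) \<rho>" "\<lambda>w. norm (g w)"] compact_sphere by blast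
  have "g w0 \<noteq> 0" using w0(1) \<rho> by (intro \<rho>0') auto
  show ?thesis
    by (intro exI[of _ v] exI[of _ \<rho>] exI[of _ "norm (g w0)"]) (use v \<rho> g0 w0 \<open>g w0 \<noteq> 0\<close> in \<open>auto simp: g_def\<close>)
qed

text \<open>The Euler product over P is split off exactly, with phases p^(-it). The relative error
  left in the first factor is, for k = 1, the value of \<open>Hfun P\<close> divided by
  \<open>lam\<close>.\<close>

lemma zetam_eq_tprod:
  assumes "finite P" "\<And>p. p \<in> P \<Longrightarrow> prime p" "Re s \<ge> \<alpha>" "\<alpha> > 1/2" "k \<ge> 1"
  shows "zetam (of_nat k * (s + \<i> * of_real t))
      = (1 + (zetam (of_nat k * (s + \<i> * of_real t)) * (\<Prod>p\<in>P. 1 - of_nat p powr - (of_nat k * (s + \<i> * of_real t))) - 1))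
        * tprod P (\<lambda>p. nit p t) k s"
proof -
  let ?q = "\<lambda>p. 1 - of_nat p powr - (of_nat k * (s + \<i> * of_real t)) :: complex"
  have e: "?q p = 1 - nit p t ^ k * of_nat p powr - (of_nat k * s)" if p: "p \<in> P" for p
  proof -
    have p0: "p > 0" using assms(2)[OF p] by (simp add: prime_gt_0_nat)
    have "nit p t ^ k = nit p (real k * t)"
      by (simp add: nit_def Complex.DeMoivre mult_ac)
    moreover have "of_nat k * (s + \<i> * of_real t) = of_nat k * s + \<i> * of_real (real k * t)" by (simp add: algebra_simps)
    ultimately show ?thesis using powr_shift_eq_nit[OF p0, of "of_nat k * s" "real k * t"] by (simp only: mult.commute)
  qed
  have nz: "1 - nit p t ^ k * of_nat p powr - (of_nat k * s) \<noteq> 0" if p: "p \<in> P" for p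
  proof -
    have "norm (nit p t ^ k * of_nat p powr - (of_nat k * s)) \<le> 3/4"
      by (rule norm_prime_factor_le(1)[OF assms(2)[OF p] norm_nit assms(3-5)])
    thus ?thesis by auto
  qed
  have "(\<Prod>p\<in>P. ?q p) * tprod P (\<lambda>p. nit p t) k s = (\<Prod>p\<in>P. ?q p * inverse (1 - nit p t ^ k * of_nat p powr - (of_nat k * s)))"
    unfolding tprod_def by (rule prod.distrib [symmetric])
  also have "\<dots> = (\<Prod>p\<in>P. 1)"
    by (intro prod.cong refl) (simp only: e nz right_inverse not_False_eq_True)
  finally have "(\<Prod>p\<in>P. ?q p) * tprod P (\<lambda>p. nit p t) k s = 1" by simp
  thus ?thesis by (simp add: mult.assoc)
qed

text \<open>At a good time t, F(s + it) is close to the limit function on the disc |w| \<le> \<rho>,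
  so F has a zero within R = \<rho> / L of \<sigma> + it. Hence the heights of zeros cover the good
  times in [1, T - 1], and a covering needs at least a multiple of T / R points.\<close>

lemma zero_count_lower:
  assumes r: "r \<ge> 2" and s: "1/2 < \<sigma>\<^sub>1" "\<sigma>\<^sub>1 < \<sigma>\<^sub>2" "\<sigma>\<^sub>2 < 1"
  shows "\<exists>C>0. \<forall>\<^sub>F T in at_top. C * T \<le> of_int (zero_count (euler_zagier_diag r) (rect \<sigma>\<^sub>1 \<sigma>\<^sub>2 T))"
proof -
  define \<sigma> where "\<sigma> = (\<sigma>\<^sub>1 + \<sigma>\<^sub>2) / 2"
  have \<sigma>: "1/2 < \<sigma>" "\<sigma> < 1" "\<sigma>\<^sub>1 < \<sigma>" "\<sigma> < \<sigma>\<^sub>2" using s by (auto simp: \<sigma>_def)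
  have \<alpha>: "1/2 < \<sigma>\<^sub>1" "\<sigma>\<^sub>1 < 1" using s by auto
  have "\<forall>k. \<exists>l. 1 \<le> k \<longrightarrow> (\<forall>\<epsilon>>0. \<exists>N1 \<eta>. \<eta> > 0 \<and> (\<forall>N\<ge>N1. \<forall>s. norm (s - of_real \<sigma>) < \<eta> \<longrightarrow> norm (logprod k N s - l) < \<epsilon>))"
    using logprod_limit[OF \<sigma>(1)] by blast
  from choice[OF this] obtain l where l': "\<forall>k. 1 \<le> k \<longrightarrow> (\<forall>\<epsilon>>0. \<exists>N1 \<eta>. \<eta> > 0 \<and> (\<forall>N\<ge>N1. \<forall>s. norm (s - of_real \<sigma>) < \<eta> \<longrightarrow> norm (logprod k N s - l k) < \<epsilon>))"
    by blast
  have l: "\<And>k \<epsilon>. 1 \<le> k \<Longrightarrow> \<epsilon> > 0 \<Longrightarrow> \<exists>N1 \<eta>. \<eta> > 0 \<and> (\<forall>N\<ge>N1. \<forall>s. norm (s - of_real \<sigma>) < \<eta> \<longrightarrow> norm (logprod k N s - l k) < \<epsilon>)"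
    by (rule l'[rule_format])
  define X where "X = (\<lambda>v k w. exp (l k + (if k = 1 then v * exp (- w) else 0)))"
  from limit_zero_exists[OF r, of l] obtain v \<rho> m1 where v: "v \<noteq> 0" and \<rho>: "0 < \<rho>" "\<rho> \<le> 1/2" and m1: "m1 > 0"
    and g0: "esym r (\<lambda>k. X v k 0) = 0" and gs': "\<forall>w. norm w = \<rho> \<longrightarrow> norm (esym r (\<lambda>k. X v k w)) \<ge> m1"
    unfolding X_def by blast
  have gs: "norm (esym r (\<lambda>k. X v k w)) \<ge> m1" if "norm w = \<rho>" for w
    using gs'[rule_format, OF that] .
  \<comment> \<open>Half of the lower bound on the circle: a perturbation smaller than m leaves the
    modulus above m on the circle and below m at the centre, where the limit function
    vanishes.\<close>
  define m where "m = m1 / 2"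
  have m: "m > 0" using m1 by (simp add: m_def)
  have "\<exists>Bx. \<forall>w\<in>cball 0 \<rho>. norm (X v k w) \<le> Bx" for k
  proof -
    have "(\<lambda>w. X v k w) holomorphic_on UNIV" unfolding X_def by (cases "k = 1") (auto intro!: holomorphic_intros)
    hence "continuous_on (cball 0 \<rho>) (\<lambda>w. X v k w)"
      using holomorphic_on_imp_continuous_on holomorphic_on_subset by blast
    hence "bounded ((\<lambda>w. X v k w) ` cball 0 \<rho>)" by (intro compact_imp_bounded compact_continuous_image compact_cball)
    thus ?thesis by (auto simp: bounded_iff)
  qed
  then obtain bx where bx: "\<And>k w. w \<in> cball 0 \<rho> \<Longrightarrow> norm (X v k w) \<le> bx k" by metis
  define B where "B = (\<Sum>k\<in>{1..r}. \<bar>bx k\<bar>) + 1"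
  have B: "B \<ge> 1" unfolding B_def using sum_nonneg[of "{1..r}" "\<lambda>k. \<bar>bx k\<bar>"] by simp
  have XB: "norm (X v k w) \<le> B - 1" if "k \<in> {1..r}" "norm w \<le> \<rho>" for k w
  proof -
    have "norm (X v k w) \<le> \<bar>bx k\<bar>" using bx[of w k] that by simp
    also have "\<dots> \<le> (\<Sum>k\<in>{1..r}. \<bar>bx k\<bar>)" using that by (intro member_le_sum) auto
    finally show ?thesis by (simp add: B_def)
  qed
  have "B \<ge> 0" using B by simp
  from esym_lipschitz[OF this, of r] obtain Cl where Cl0: "Cl \<ge> 0" and Cl1: "\<forall>(p::nat \<Rightarrow> complex) q \<delta>. \<delta> \<ge> 0 \<longrightarrow>
    (\<forall>k\<in>{1..r}. norm (p k) \<le> B \<and> norm (q k) \<le> B \<and> norm (p k - q k) \<le> \<delta>) \<longrightarrow> norm (esym r p - esym r q) \<le> Cl * \<delta>"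
    by blast
  have Cl: "Cl \<ge> 0" "\<And>p q \<delta>. \<delta> \<ge> 0 \<Longrightarrow> (\<And>k. k \<in> {1..r} \<Longrightarrow> norm (p k :: complex) \<le> B \<and> norm (q k) \<le> B \<and> norm (p k - q k) \<le> \<delta>) \<Longrightarrow>
        norm (esym r p - esym r q) \<le> Cl * \<delta>" by (rule Cl0, rule Cl1[rule_format])
  define \<delta>0 where "\<delta>0 = min 1 (m / (Cl + 1))"
  have \<delta>0: "\<delta>0 > 0" "\<delta>0 \<le> 1" using m Cl by (auto simp: \<delta>0_def)
  have Cd: "Cl * \<delta>0 < m"
  proof -
    have "Cl * \<delta>0 \<le> Cl * (m / (Cl + 1))" using Cl by (intro mult_left_mono) (auto simp: \<delta>0_def)
    also have "\<dots> < m" using m Cl by (simp add: field_simps)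
    finally show ?thesis .
  qed
  \<comment> \<open>A lower bound for |lam z| on Re z < \<open>\<sigma>\<^sub>2\<close>, which turns
    smallness of \<open>Hfun\<close> into smallness of the relative error.\<close>
  define l0 where "l0 = 2 powr (1 - \<sigma>\<^sub>2) - 1"
  have l0: "l0 > 0" using s powr_less_mono[of 0 "1 - \<sigma>\<^sub>2" 2] by (simp add: l0_def)
  \<comment> \<open>The error budget \<delta>0 is spent as \<delta>0 / 2 on the relative error,
    multiplied by a product of modulus at most B, and as \<delta>0 / 4 each on the phases and on the
    twisted product.\<close>
  define h0 where "h0 = \<delta>0 / (2 * B)"
  have h0: "h0 > 0" using \<delta>0 B by (simp add: h0_def)
  define \<delta>' where "\<delta>' = (l0 * h0)^2"
  have \<delta>': "\<delta>' > 0" using l0 h0 by (simp add: \<delta>'_def)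
  have "(\<lambda>N. ztail N (2 * \<sigma>\<^sub>1)) \<longlonglongrightarrow> 0" using \<alpha> by (intro ztail_tendsto_0) auto
  \<comment> \<open>160 is 80 times 2, the quotient R2 / (R2 - R) for the choice R2 = 2 R
    below.\<close>
  hence "\<forall>\<^sub>F N in sequentially. ztail N (2 * \<sigma>\<^sub>1) < min h0 (\<delta>' / 160)" by (rule order_tendstoD) (use h0 \<delta>' in auto)
  then obtain N0 where N0: "\<And>N. N \<ge> N0 \<Longrightarrow> ztail N (2 * \<sigma>\<^sub>1) < min h0 (\<delta>' / 160)"
    unfolding eventually_sequentially by blast
  have \<epsilon>: "\<delta>0 / 4 > 0" using \<delta>0 by simp
  \<comment> \<open>The bound on L makes the disc of radius 2 R about \<sigma> fit into the
    strip.\<close>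
  from twist_approx[OF \<sigma>(1,2) v \<epsilon> l, of r "max 2 N0" "2 / (\<sigma>\<^sub>2 - \<sigma>\<^sub>1) + 1"]
  obtain N L \<xi> where N: "N \<ge> max 2 N0" and L: "L \<ge> 2 / (\<sigma>\<^sub>2 - \<sigma>\<^sub>1) + 1" "L \<ge> 1" and \<xi>': "\<forall>p. norm (\<xi> p) = 1"
    and tw': "\<forall>w k. norm w \<le> 1/2 \<longrightarrow> 1 \<le> k \<longrightarrow> k \<le> r \<longrightarrow>
       norm (tprod {p. prime p \<and> p \<le> N} \<xi> k (of_real \<sigma> + w / of_real L) - X v k w) \<le> \<delta>0 / 4"
    unfolding X_def by blast
  have \<xi>: "norm (\<xi> p) = 1" for p by (rule \<xi>'[rule_format])
  note tw = tw'[rule_format]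
  define P where "P = {p. prime p \<and> p \<le> N}"
  have P: "finite P" "\<And>p. p \<in> P \<Longrightarrow> prime p" by (auto simp: P_def)
  obtain \<delta> where \<delta>: "\<delta> > 0" and cl': "\<forall>y x s k. (\<forall>p. norm (y p) = 1) \<longrightarrow> (\<forall>p. norm (x p) = 1) \<longrightarrow> Re s \<ge> \<sigma>\<^sub>1 \<longrightarrow> 1 \<le> k \<longrightarrow> k \<le> r \<longrightarrow>
      (\<forall>p\<in>P. norm (y p - x p) < \<delta>) \<longrightarrow> norm (tprod P y k s - tprod P x k s) \<le> \<delta>0 / 4"
    using tprod_close[OF P \<alpha>(1) \<epsilon>, of r] by blast
  have cl: "\<And>y x s k. (\<And>p. norm (y p) = 1) \<Longrightarrow> (\<And>p. norm (x p) = 1) \<Longrightarrow> Re s \<ge> \<sigma>\<^sub>1 \<Longrightarrow> 1 \<le> k \<Longrightarrow> k \<le> r \<Longrightarrow>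
      (\<And>p. p \<in> P \<Longrightarrow> norm (y p - x p) < \<delta>) \<Longrightarrow> norm (tprod P y k s - tprod P x k s) \<le> \<delta>0 / 4"
    by (rule cl'[rule_format])
  define R where "R = \<rho> / L"
  have R: "R > 0" "R \<le> 1/2" "2 * R < (\<sigma>\<^sub>2 - \<sigma>\<^sub>1) / 2"
  proof -
    have L0: "L > 0" using L by simp
    show "R > 0" using \<rho> L0 by (simp add: R_def)
    have "\<rho> \<le> 1/2 * L" using \<rho> L by simp
    thus "R \<le> 1/2" using L0 by (simp add: R_def field_simps)
    have "2 / (\<sigma>\<^sub>2 - \<sigma>\<^sub>1) < L" using L by simp
    hence "2 < L * (\<sigma>\<^sub>2 - \<sigma>\<^sub>1)" using s by (simp add: field_simps)
    hence "4 * \<rho> < L * (\<sigma>\<^sub>2 - \<sigma>\<^sub>1)" using \<rho> by linarith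
    thus "2 * R < (\<sigma>\<^sub>2 - \<sigma>\<^sub>1) / 2" using L0 by (simp add: R_def field_simps)
  qed
  define good where "good = (\<lambda>t. (\<forall>p\<in>P. norm (nit p t - \<xi> p) < \<delta>) \<and>
                 (\<forall>s. dist (of_real \<sigma>) s \<le> R \<longrightarrow> norm (Hfun P (s + \<i> * of_real t))^2 < \<delta>'))"
  have hit: "\<exists>z. Re z \<in> {\<sigma>\<^sub>1<..<\<sigma>\<^sub>2} \<and> \<bar>Im z - t\<bar> \<le> R \<and> Fdiag r z = 0" if t: "good t" for t
  proof -
    define S where "S = (\<lambda>w. of_real \<sigma> + w / of_real L :: complex)"
    have S: "dist (of_real \<sigma>) (S w) \<le> R" "Re (S w) > \<sigma>\<^sub>1" "Re (S w) < \<sigma>\<^sub>2" if w: "norm w \<le> \<rho>" for w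
    proof -
      show d: "dist (of_real \<sigma>) (S w) \<le> R"
        using w L by (simp add: S_def R_def dist_norm norm_divide divide_right_mono)
      have "\<bar>Re (of_real \<sigma> - S w)\<bar> \<le> R" using d abs_Re_le_cmod[of "of_real \<sigma> - S w"] by (simp add: dist_norm)
      thus "Re (S w) > \<sigma>\<^sub>1" "Re (S w) < \<sigma>\<^sub>2" using R by (auto simp: \<sigma>_def field_simps abs_le_iff)
    qed
    define F where "F = (\<lambda>w. Fdiag r (S w + \<i> * of_real t))"
    have close: "norm (F w - esym r (\<lambda>k. X v k w)) < m" if w: "norm w \<le> \<rho>" for w
    proof -
      have "norm (esym r (\<lambda>k. zetam (of_nat k * (S w + \<i> * of_real t))) - esym r (\<lambda>k. X v k w)) \<le> Cl * \<delta>0"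
      proof (rule Cl(2))
        fix k assume k: "k \<in> {1..r}"
        define x where "x = zetam (of_nat k * (S w + \<i> * of_real t))"
        define h where "h = x * (\<Prod>p\<in>P. 1 - of_nat p powr - (of_nat k * (S w + \<i> * of_real t))) - 1"
        define Zt where "Zt = tprod P (\<lambda>p. nit p t) k (S w)"
        define Zx where "Zx = tprod P \<xi> k (S w)"
        have xe: "x = (1 + h) * Zt"
          unfolding x_def h_def Zt_def using P S(2)[OF w] \<alpha> k by (intro zetam_eq_tprod) auto
        have c1: "norm (Zt - Zx) \<le> \<delta>0 / 4"
          unfolding Zt_def Zx_def using t k S(2)[OF w] \<xi> by (intro cl) (auto simp: good_def)
        have c2: "norm (Zx - X v k w) \<le> \<delta>0 / 4"
          unfolding Zx_def P_def S_def using w \<rho> k by (intro tw) auto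
        have nX: "norm (X v k w) \<le> B - 1" using XB[OF k w] .
        have nZt: "norm Zt \<le> B"
        proof -
          have "norm Zt = norm ((Zt - Zx) + (Zx - X v k w) + X v k w)" by simp
          also have "\<dots> \<le> \<delta>0 / 4 + \<delta>0 / 4 + (B - 1)" by (intro norm_triangle_mono c1 c2 nX)
          finally show ?thesis using \<delta>0 by simp
        qed
        have nh: "norm h \<le> h0"
        proof (cases "k = 1")
          case True
          define z where "z = S w + \<i> * of_real t"
          have Rez: "Re z \<noteq> 1" "Re z < \<sigma>\<^sub>2" using S(3)[OF w] s by (auto simp: z_def)
          have lz: "lam z \<noteq> 0" by (rule lam_nonzero) fact
          have "h = Hfun P z / lam z"
            using True lz by (simp add: h_def x_def Hfun_def zetam_def z_def[symmetric] field_simps)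
          moreover have "norm (Hfun P z) \<le> l0 * h0"
          proof -
            have "norm (Hfun P z)^2 < \<delta>'" using t S(1)[OF w] unfolding good_def z_def by blast
            moreover have "l0 * h0 \<ge> 0" using l0 h0 by simp
            ultimately have "norm (Hfun P z) < l0 * h0" unfolding \<delta>'_def by (rule power_less_imp_less_base)
            thus ?thesis by simp
          qed
          moreover have "norm (lam z) \<ge> l0"
          proof -
            have "(2::real) powr (1 - \<sigma>\<^sub>2) \<le> 2 powr (1 - Re z)" using Rez by (intro powr_mono) auto
            thus ?thesis using norm_lam_ge[of z] unfolding l0_def by linarith
          qed
          ultimately have "norm h \<le> (l0 * h0) / l0"
            using l0 h0 by (simp only: norm_divide) (intro frac_le, auto)
          thus ?thesis using l0 by simp
        next
          case False
          \<comment> \<open>For k \<ge> 2 the argument lies in the region of absolute convergence,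
            so the sieved tail is small at every height and no condition on t is involved.\<close>
          hence k2: "k \<ge> 2" using k by auto
          have Rek: "Re (of_nat k * (S w + \<i> * of_real t)) \<ge> 2 * \<sigma>\<^sub>1"
          proof -
            have "2 * \<sigma>\<^sub>1 \<le> real k * Re (S w)" using k2 S(2)[OF w] \<alpha> by (intro mult_mono) auto
            thus ?thesis by simp
          qed
          have "x = zeta_series (of_nat k * (S w + \<i> * of_real t))"
            unfolding x_def using Rek \<alpha> by (intro zetam_eq_zeta_series) linarith
          hence "norm h \<le> ztail N (2 * \<sigma>\<^sub>1)"
            unfolding h_def P_def using zeta_euler_product_approx[of N "2 * \<sigma>\<^sub>1", OF _ Rek] N \<alpha> by simp
          thus ?thesis using N0[of N] N by simp
        qed
        have "x - X v k w = h * Zt + ((Zt - Zx) + (Zx - X v k w))" unfolding xe by (simp add: algebra_simps)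
        also have "norm \<dots> \<le> h0 * B + (\<delta>0 / 4 + \<delta>0 / 4)"
          unfolding norm_mult using nh nZt h0
          by (intro norm_triangle_mono c1 c2) (simp add: norm_mult mult_mono)
        also have "h0 * B = \<delta>0 / 2" using B by (simp add: h0_def)
        finally have d: "norm (x - X v k w) \<le> \<delta>0" by simp
        have "norm x \<le> norm (X v k w) + norm (x - X v k w)" by (rule norm_triangle_sub)
        hence "norm x \<le> B" using d nX \<delta>0 by linarith
        thus "norm (zetam (of_nat k * (S w + \<i> * of_real t))) \<le> B \<and> norm (X v k w) \<le> B
            \<and> norm (zetam (of_nat k * (S w + \<i> * of_real t)) - X v k w) \<le> \<delta>0"
          using d nX by (simp add: x_def)
      qed (use \<delta>0 in simp)
      thus ?thesis using Cd by (simp add: F_def Fdiag_def)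
    qed
    have "\<exists>w. norm w \<le> \<rho> \<and> F w = 0"
    proof (rule zero_in_disc[OF _ \<rho>(1) m])
      have "(\<lambda>w. S w + \<i> * of_real t) holomorphic_on cball 0 \<rho>"
        unfolding S_def using L by (intro holomorphic_intros) auto
      moreover have "(\<lambda>w. S w + \<i> * of_real t) ` cball 0 \<rho> \<subseteq> {s \<in> half_strip. Re s \<noteq> 1}"
        using S(2,3) s by (force simp: half_strip_def)
      ultimately have "(Fdiag r \<circ> (\<lambda>w. S w + \<i> * of_real t)) holomorphic_on cball 0 \<rho>"
        by (intro holomorphic_on_compose holomorphic_on_subset[OF Fdiag_holomorphic])
      thus "F holomorphic_on cball 0 \<rho>" by (simp add: F_def o_def)
      show "norm (F 0) < m" using close[of 0] g0 \<rho> by simp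
      fix w :: complex assume w: "norm w = \<rho>"
      have "norm (esym r (\<lambda>k. X v k w)) \<le> norm (F w) + norm (esym r (\<lambda>k. X v k w) - F w)" by (rule norm_triangle_sub)
      thus "norm (F w) \<ge> m" using gs[OF w] close[of w] w by (simp add: m_def norm_minus_commute)
    qed
    then obtain w where w: "norm w \<le> \<rho>" "F w = 0" by blast
    show ?thesis
    proof (intro exI[of _ "S w + \<i> * of_real t"] conjI)
      show "Fdiag r (S w + \<i> * of_real t) = 0" using w by (simp add: F_def)
      show "Re (S w + \<i> * of_real t) \<in> {\<sigma>\<^sub>1<..<\<sigma>\<^sub>2}" using S[OF w(1)] by simp
      have "\<bar>Im (of_real \<sigma> - S w)\<bar> \<le> R" using S(1)[OF w(1)] abs_Im_le_cmod[of "of_real \<sigma> - S w"] by (simp add: dist_norm)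
      thus "\<bar>Im (S w + \<i> * of_real t) - t\<bar> \<le> R" by simp
    qed
  qed
  obtain C where C: "C > 0" "\<forall>\<^sub>F T in at_top. \<forall>Z \<rho>. finite Z \<longrightarrow> \<rho> > 0 \<longrightarrow> (\<forall>t\<in>{1..T-1}. good t \<longrightarrow> (\<exists>y\<in>Z. \<bar>y - t\<bar> \<le> \<rho>)) \<longrightarrow>
        C * T \<le> \<rho> * real (card Z)"
  proof (rule good_times[OF \<alpha> _ P_def \<xi> R(1) _ _ \<delta> \<delta>' _ good_def, of "2 * R"])
    show "80 * ztail N (2 * \<sigma>\<^sub>1) * (2 * R / (2 * R - R)) \<le> \<delta>'"
      using N0[of N] N R by simp
    show "Re (of_real \<sigma>) - 2 * R \<ge> \<sigma>\<^sub>1" using R by (simp add: \<sigma>_def field_simps)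
  qed (use N R in auto)
  show ?thesis
  proof (intro exI[of _ "C / R"] conjI)
    show "C / R > 0" using C R by simp
    show "\<forall>\<^sub>F T in at_top. C / R * T \<le> of_int (zero_count (euler_zagier_diag r) (rect \<sigma>\<^sub>1 \<sigma>\<^sub>2 T))"
      using C(2)
    proof eventually_elim
      case (elim T)
      define G where "G = Gzeros r \<sigma>\<^sub>1 \<sigma>\<^sub>2 T"
      have G: "finite G" unfolding G_def using s by (intro finite_Gzeros)
      \<comment> \<open>Only distinct heights are counted here; zeros of equal height and
        multiplicities can only increase the count.\<close>
      have "C * T \<le> R * real (card (Im ` G))"
      proof (rule elim[rule_format])
        fix t assume t: "t \<in> {1..T - 1}" "good t"
        obtain z where z: "Re z \<in> {\<sigma>\<^sub>1<..<\<sigma>\<^sub>2}" "\<bar>Im z - t\<bar> \<le> R" "Fdiag r z = 0" using hit[OF t(2)] by blast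
        have "Gdiag r z = 0" using z s lam_nonzero[of z] by (simp add: Gdiag_eq)
        hence "z \<in> G" using z t R by (auto simp: G_def Gzeros_def rect_def)
        thus "\<exists>y\<in>Im ` G. \<bar>y - t\<bar> \<le> R" using z by blast
      qed (use G R in auto)
      also have "\<dots> \<le> R * real (card G)" using G R card_image_le by (intro mult_left_mono) auto
      also have "real (card G) = of_int (\<Sum>z\<in>G. 1)" by simp
      also have "\<dots> \<le> of_int (\<Sum>z\<in>G. zorder (Gdiag r) z)"
        unfolding of_int_le_iff using s by (intro sum_mono zorder_Gdiag_ge_1) (auto simp: G_def)
      also have "(\<Sum>z\<in>G. zorder (Gdiag r) z) = zero_count (euler_zagier_diag r) (rect \<sigma>\<^sub>1 \<sigma>\<^sub>2 T)"
        using s by (simp add: zero_count_eq G_def)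
      finally show ?case using R by (simp add: field_simps)
    qed
  qed
qed

theorem theorem3p7:
  fixes r :: nat and \<sigma>\<^sub>1 \<sigma>\<^sub>2 :: real
  assumes "r \<ge> 2" and "1/2 < \<sigma>\<^sub>1" and "\<sigma>\<^sub>1 < \<sigma>\<^sub>2" and "\<sigma>\<^sub>2 < 1"
  shows "\<exists>C\<^sub>1 C\<^sub>2 :: real. 0 < C\<^sub>1 \<and> C\<^sub>1 < C\<^sub>2 \<and>
    (\<forall>\<^sub>F T :: real in at_top.
       let N = real_of_int (zero_count (euler_zagier_diag r)
                 {s. \<sigma>\<^sub>1 < Re s \<and> Re s < \<sigma>\<^sub>2 \<and> 0 < Im s \<and> Im s < T})
       in C\<^sub>1 * T \<le> N \<and> N \<le> C\<^sub>2 * T)"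
proof -
  obtain C\<^sub>1 where C1: "C\<^sub>1 > 0"
    "\<forall>\<^sub>F T in at_top. C\<^sub>1 * T \<le> of_int (zero_count (euler_zagier_diag r) (rect \<sigma>\<^sub>1 \<sigma>\<^sub>2 T))"
    using zero_count_lower[OF assms] by blast
  obtain C where C: "\<forall>\<^sub>F T in at_top. of_int (zero_count (euler_zagier_diag r) (rect \<sigma>\<^sub>1 \<sigma>\<^sub>2 T)) \<le> C * T"
    using zero_count_upper[OF assms(2-4)] by blast
  define C\<^sub>2 where "C\<^sub>2 = max C (C\<^sub>1 + 1)"
  have "\<forall>\<^sub>F T in at_top. C\<^sub>1 * T \<le> of_int (zero_count (euler_zagier_diag r) (rect \<sigma>\<^sub>1 \<sigma>\<^sub>2 T)) \<and>
      of_int (zero_count (euler_zagier_diag r) (rect \<sigma>\<^sub>1 \<sigma>\<^sub>2 T)) \<le> C\<^sub>2 * T"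
    using C1(2) C eventually_ge_at_top[of 0]
  proof eventually_elim
    case (elim T)
    have "C * T \<le> C\<^sub>2 * T" using elim(3) by (intro mult_right_mono) (auto simp: C\<^sub>2_def)
    with elim show ?case by linarith
  qed
  moreover have "C\<^sub>1 < C\<^sub>2" by (simp add: C\<^sub>2_def)
  ultimately show ?thesis
    using C1(1) unfolding rect_def Let_def by blast
qed

end
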